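(* Let $G$ be an amenable graph, $A_i$ an anisotropic component of $C(G)$ with root $R_i$, $G_i=G[\bigcup_{X\in A_i}X]$, and let $J_i$ be the jellyfish graph obtained from $G_i$ by the modifications (M1), (M2), (M3), with head $H=J_i[R_i]$, and let $L_v$ be one of its legs. If $Fix(L_v,\mathcal{P}_G)=0$ then $Fix(J_i,\mathcal{P}_G)=Fix(H)$; otherwise $Fix(J_i,\mathcal{P}_G)=|V(H)|\cdot Fix(L_v,\mathcal{P}_G)$.
   Context: Color refinement on a graph $K$: start with $\mathcal{P}_0=\{V(K)\}$; given $\mathcal{P}_{i-1}$, two vertices lie in the same cell of $\mathcal{P}_i$ iff they lie in the same cell of $\mathcal{P}_{i-1}$ and have the same number of neighbors in every cell of $\mathcal{P}_{i-1}$; stop when stable; for $K=G$ the result is the stable partition $\mathcal{P}_G$. $G$ is amenable if, for every graph $H'$, running color refinement on $G\cup H'$ and declaring $G\cong H'$ iff each final cell contains equally many vertices of $G$ and $H'$ gives the correct answer. The cell graph $C(G)$ is the complete graph on $\mathcal{P}_G$. A cell $X$ is homogeneous if $G[X]$ is empty or complete, heterogeneous otherwise. A pair of distinct cells $X,Y$ is isotropic if the bipartite graph $G[X,Y]$ between them is empty or complete bipartite, anisotropic otherwise; anisotropic components are the connected components of the graph on $\mathcal{P}_G$ formed by the anisotropic pairs. For amenable $G$ each anisotropic component is a tree with at most one heterogeneous cell. The root $R_i$ of $A_i$ is its heterogeneous cell if one exists, otherwise a cell of least cardinality in $A_i$. Modifications applied to $G_i$: (M1) if $G_i[R_i]$ is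 a matching graph $rK_2$ ($r\ge 2$) or empty, replace it by its complement; (M2) for every other cell $X$ of $A_i$, if $G_i[X]$ is complete, replace it by its complement; (M3) for each pair of distinct cells $X,Y$ of $A_i$: if $XY$ is isotropic and $G_i[X,Y]$ is complete bipartite, replace it by the empty bipartite graph; if $XY$ is anisotropic and $G_i[X,Y]$ is the bipartite complement of a star forest $sK_{1,t}$, replace it by $sK_{1,t}$. The result $J_i$ is a jellyfish graph: its head is $H=J_i[R_i]$ and for each $v\in R_i$ the leg $L_v$ is the tree rooted at $v$ formed by $v$ and its descendants (in $J_i$, each vertex in a non-root cell $Y$ has a unique neighbor in the parent cell of $Y$ in $A_i$, its parent); legs are pairwise vertex-disjoint. For a graph $F$ with $V(F)\subseteq V(G)$, $Aut(F,\mathcal{P}_G)$ is the set of automorphisms of $F$ mapping each vertex into its own cell of $\mathcal{P}_G$; $S\subseteq V(F)$ is a $\mathcal{P}_G$-fixing set of $F$ if the only element of $Aut(F,\mathcal{P}_G)$ fixing each vertex of $S$ is the identity, and $Fix(F,\mathcal{P}_G)$ is the minimum size of such a set. $Fix(H)$ is the ordinary fixing number of $H$ (minimum size of a set whose pointwise stabilizer in $Aut(H)$ is trivial). *)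

theory Defs
  imports "Graph_Theory.Graph_Theory"
begin

text \<open>
  Finite simple undirected graphs are values of type \<^typ>\<open>'a pair_pre_digraph\<close> that satisfy
  \<^const>\<open>pair_graph\<close>: every edge is represented by both of its arcs.
\<close>

definition induced :: "'a pair_pre_digraph \<Rightarrow> 'a set \<Rightarrow> 'a pair_pre_digraph" where
  "induced F X = \<lparr> pverts = X, parcs = parcs F \<inter> X \<times> X \<rparr>"

definition graph_complement :: "'a pair_pre_digraph \<Rightarrow> 'a pair_pre_digraph" where
  "graph_complement F =
     \<lparr> pverts = pverts F, parcs = {(u, v) \<in> pverts F \<times> pverts F. u \<noteq> v} - parcs F \<rparr>"

definition bipartite_between ::
    "'a pair_pre_digraph \<Rightarrow> 'a set \<Rightarrow> 'a set \<Rightarrow> 'a pair_pre_digraph" where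
  "bipartite_between F X Y = \<lparr> pverts = X \<union> Y, parcs = parcs F \<inter> (X \<times> Y \<union> Y \<times> X) \<rparr>"

definition bipartite_complement ::
    "'a pair_pre_digraph \<Rightarrow> 'a set \<Rightarrow> 'a set \<Rightarrow> 'a pair_pre_digraph" where
  "bipartite_complement F X Y = \<lparr> pverts = X \<union> Y, parcs = (X \<times> Y \<union> Y \<times> X) - parcs F \<rparr>"

definition disjoint_union ::
    "'a pair_pre_digraph \<Rightarrow> 'b pair_pre_digraph \<Rightarrow> ('a + 'b) pair_pre_digraph" where
  "disjoint_union G H =
     \<lparr> pverts = pverts G <+> pverts H,
       parcs = map_prod Inl Inl ` parcs G \<union> map_prod Inr Inr ` parcs H \<rparr>"

definition isomorphic :: "'a pair_pre_digraph \<Rightarrow> 'b pair_pre_digraph \<Rightarrow> bool" where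
  "isomorphic G H \<longleftrightarrow> digraph_iso (with_proj G) (with_proj H)"

definition empty_graph :: "'a pair_pre_digraph \<Rightarrow> bool" where
  "empty_graph F \<longleftrightarrow> parcs F = {}"

definition complete_graph :: "'a pair_pre_digraph \<Rightarrow> bool" where
  "complete_graph F \<longleftrightarrow> parcs F = {(u, v) \<in> pverts F \<times> pverts F. u \<noteq> v}"

text \<open>The graph \<open>sK\<^bsub>1,t\<^esub>\<close>: the \<open>i\<close>-th star has centre \<open>(i, 0)\<close> and leaves \<open>(i, 1), \<dots>, (i, t)\<close>.\<close>

definition star_forest :: "nat \<Rightarrow> nat \<Rightarrow> (nat \<times> nat) pair_pre_digraph" where
  "star_forest s t =
     \<lparr> pverts = {..<s} \<times> {..t},
       parcs = {((i, 0), (i, j)) | i j. i < s \<and> j \<in> {1..t}} \<union>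
               {((i, j), (i, 0)) | i j. i < s \<and> j \<in> {1..t}} \<rparr>"

text \<open>\<open>rK\<^sub>2\<close>, since \<open>K\<^sub>2 = K\<^bsub>1,1\<^esub>\<close>.\<close>

definition matching_graph :: "nat \<Rightarrow> (nat \<times> nat) pair_pre_digraph" where
  "matching_graph r = star_forest r 1"

subsection \<open>Color refinement and amenability\<close>

definition refine :: "'a pair_pre_digraph \<Rightarrow> 'a set set \<Rightarrow> 'a set set" where
  "refine K P = pverts K //
     {(u, v) \<in> pverts K \<times> pverts K.
        (\<exists>C\<in>P. u \<in> C \<and> v \<in> C) \<and>
        (\<forall>C\<in>P. card {w \<in> C. (u, w) \<in> parcs K} = card {w \<in> C. (v, w) \<in> parcs K})}"

definition refinement :: "'a pair_pre_digraph \<Rightarrow> nat \<Rightarrow> 'a set set" where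
  "refinement K i = (refine K ^^ i) {pverts K}"

definition stable_partition :: "'a pair_pre_digraph \<Rightarrow> 'a set set" where
  "stable_partition K = refinement K (LEAST i. refinement K (Suc i) = refinement K i)"

definition indistinguishable :: "'a pair_pre_digraph \<Rightarrow> 'b pair_pre_digraph \<Rightarrow> bool" where
  "indistinguishable G H \<longleftrightarrow>
     (\<forall>C \<in> stable_partition (disjoint_union G H).
        card (C \<inter> Inl ` pverts G) = card (C \<inter> Inr ` pverts H))"

text \<open>Every finite graph has an isomorphic copy on natural numbers, so \<open>H\<close> ranges over all graphs.\<close>

definition amenable :: "'a pair_pre_digraph \<Rightarrow> bool" where
  "amenable G \<longleftrightarrow>
     (\<forall>H :: nat pair_pre_digraph. pair_graph H \<longrightarrow> (indistinguishable G H \<longleftrightarrow> isomorphic G H))"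

subsection \<open>Anisotropic components\<close>

definition homogeneous :: "'a pair_pre_digraph \<Rightarrow> 'a set \<Rightarrow> bool" where
  "homogeneous F X \<longleftrightarrow> empty_graph (induced F X) \<or> complete_graph (induced F X)"

abbreviation heterogeneous :: "'a pair_pre_digraph \<Rightarrow> 'a set \<Rightarrow> bool" where
  "heterogeneous F X \<equiv> \<not> homogeneous F X"

definition complete_between :: "'a pair_pre_digraph \<Rightarrow> 'a set \<Rightarrow> 'a set \<Rightarrow> bool" where
  "complete_between F X Y \<longleftrightarrow> parcs (bipartite_between F X Y) = X \<times> Y \<union> Y \<times> X"

definition isotropic :: "'a pair_pre_digraph \<Rightarrow> 'a set \<Rightarrow> 'a set \<Rightarrow> bool" where
  "isotropic F X Y \<longleftrightarrow> empty_graph (bipartite_between F X Y) \<or> complete_between F X Y"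

definition anisotropic_graph :: "'a pair_pre_digraph \<Rightarrow> 'a set pair_pre_digraph" where
  "anisotropic_graph G =
     \<lparr> pverts = stable_partition G,
       parcs = {(X, Y) \<in> stable_partition G \<times> stable_partition G. X \<noteq> Y \<and> \<not> isotropic G X Y} \<rparr>"

text \<open>
  The anisotropic graph is symmetric, so its strongly connected components are its connected
  components.
\<close>

definition anisotropic_components :: "'a pair_pre_digraph \<Rightarrow> 'a set set set" where
  "anisotropic_components G = pre_digraph.sccs_verts (with_proj (anisotropic_graph G))"

definition is_root :: "'a pair_pre_digraph \<Rightarrow> 'a set set \<Rightarrow> 'a set \<Rightarrow> bool" where
  "is_root G A R \<longleftrightarrow> R \<in> A \<and>
     (if \<exists>X\<in>A. heterogeneous G X then heterogeneous G R else \<forall>X\<in>A. card R \<le> card X)"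

subsection \<open>Jellyfish graphs\<close>

definition modified_cell ::
    "'a pair_pre_digraph \<Rightarrow> 'a set \<Rightarrow> 'a set \<Rightarrow> 'a pair_pre_digraph" where
  "modified_cell F R X =
     (let B = induced F X in
      if (if X = R then (\<exists>r\<ge>2. isomorphic B (matching_graph r)) \<or> empty_graph B
          else complete_graph B)
      then graph_complement B else B)"

text \<open>
  The bipartite complement of \<open>F[X, Y]\<close> serves both as the test (is it some \<open>sK\<^bsub>1,t\<^esub>\<close>?) and as the
  replacement.
\<close>

definition modified_pair ::
    "'a pair_pre_digraph \<Rightarrow> 'a set \<Rightarrow> 'a set \<Rightarrow> 'a pair_pre_digraph" where
  "modified_pair F X Y =
     (if isotropic F X Y then
        (if complete_between F X Y then \<lparr> pverts = X \<union> Y, parcs = {} \<rparr>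
         else bipartite_between F X Y)
      else
        (if \<exists>s\<ge>1. \<exists>t\<ge>1. isomorphic (bipartite_complement F X Y) (star_forest s t)
         then bipartite_complement F X Y
         else bipartite_between F X Y))"

definition jellyfish ::
    "'a pair_pre_digraph \<Rightarrow> 'a set set \<Rightarrow> 'a set \<Rightarrow> 'a pair_pre_digraph" where
  "jellyfish F A R =
     \<lparr> pverts = \<Union>A,
       parcs = (\<Union>X\<in>A. parcs (modified_cell F R X)) \<union>
               (\<Union>X\<in>A. \<Union>Y\<in>A - {X}. parcs (modified_pair F X Y)) \<rparr>"

text \<open>
  \<open>X\<close> is the parent cell of \<open>Y\<close> if it is the last but one vertex of a path from the root \<open>R\<close> to \<open>Y\<close>
  in the anisotropic graph; paths (\<open>apath\<close>) are arc lists without repeated vertices.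
\<close>

definition parent_cell :: "'a pair_pre_digraph \<Rightarrow> 'a set \<Rightarrow> 'a set \<Rightarrow> 'a set \<Rightarrow> bool" where
  "parent_cell G R X Y \<longleftrightarrow>
     (\<exists>p. pre_digraph.apath (with_proj (anisotropic_graph G)) R (p @ [(X, Y)]) Y)"

definition parent_rel ::
    "'a pair_pre_digraph \<Rightarrow> 'a set \<Rightarrow> 'a pair_pre_digraph \<Rightarrow> 'a rel" where
  "parent_rel G R J = {(u, w) \<in> parcs J. \<exists>X Y. parent_cell G R X Y \<and> u \<in> X \<and> w \<in> Y}"

definition leg ::
    "'a pair_pre_digraph \<Rightarrow> 'a set \<Rightarrow> 'a pair_pre_digraph \<Rightarrow> 'a \<Rightarrow> 'a pair_pre_digraph" where
  "leg G R J v = induced J {w. (v, w) \<in> (parent_rel G R J)\<^sup>*}"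

subsection \<open>Fixing numbers\<close>

definition automorphisms :: "'a pair_pre_digraph \<Rightarrow> ('a \<Rightarrow> 'a) set" where
  "automorphisms F = {f. f permutes pverts F \<and>
     (\<forall>u\<in>pverts F. \<forall>v\<in>pverts F. (f u, f v) \<in> parcs F \<longleftrightarrow> (u, v) \<in> parcs F)}"

definition cell_automorphisms :: "'a pair_pre_digraph \<Rightarrow> 'a set set \<Rightarrow> ('a \<Rightarrow> 'a) set" where
  "cell_automorphisms F P =
     {f \<in> automorphisms F. \<forall>C\<in>P. \<forall>v \<in> pverts F \<inter> C. f v \<in> C}"

definition is_fixing_set :: "('a \<Rightarrow> 'a) set \<Rightarrow> 'a set \<Rightarrow> bool" where
  "is_fixing_set \<Gamma> S \<longleftrightarrow> (\<forall>f\<in>\<Gamma>. (\<forall>x\<in>S. f x = x) \<longrightarrow> f = id)"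

definition Fix :: "'a pair_pre_digraph \<Rightarrow> nat" where
  "Fix F = (LEAST n. \<exists>S\<subseteq>pverts F. card S = n \<and> is_fixing_set (automorphisms F) S)"

definition Fix_cells :: "'a pair_pre_digraph \<Rightarrow> 'a set set \<Rightarrow> nat" where
  "Fix_cells F P =
     (LEAST n. \<exists>S\<subseteq>pverts F. card S = n \<and> is_fixing_set (cell_automorphisms F P) S)"

end

theory Submission
  imports Defs "HOL-Library.Disjoint_Sets" "HOL-Combinatorics.Permutations"
begin

text \<open>
  Amenability enters only through the following rigidity. If a graph on \<open>V(G)\<close> has, for every vertex
  and every cell of \<open>\<P>\<^sub>G\<close>, the same number of neighbours as \<open>G\<close>, then color refinement does not
  distinguish it from \<open>G\<close>, so it is the image of \<open>G\<close> under a permutation preserving the cells.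
  Replacing the edges inside one cell or between two cells then yields all of the structure:

  \<^item> the graph between two anisotropic cells is the only biregular graph with its degrees, hence a
    star forest or the complement of one;
  \<^item> a heterogeneous cell and an anisotropic neighbour of smaller size both put a nontrivial graph on
    a cell, which moreover can be moved along perfect matchings between cells of equal size. Two such
    graphs of independent origin on the same cell cannot exist, since relabelling one of them changes
    the number of common edges. This excludes cycles of anisotropic pairs, a decrease of the
    cell size on the way from the root, and heterogeneous cells other than the root.

  So the jellyfish graph is a forest of pairwise isomorphic legs planted on the head, and every
  automorphism of the head lifts to the whole graph, whatever the head is. If the legs have no
  nontrivial automorphism, only the head has to be fixed. Otherwise every leg needs its own fixing
  set, and these sets together also fix the head pointwise.
\<close>

section \<open>Rigidity of amenable graphs\<close>

text \<open>Rigidity yields an isomorphism with no control over what it does inside the cells, so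
  every contradiction rests on a number that such a map cannot change: the number of vertices in
  complete bipartite components of a block, the number of common pairs of two relations on a cell,
  the number of agreements of two matchings. The first shows that degrees rarely determine a block,
  the others that two structures clash. Independence is measured in blocks, that is, pairs of cells.
  A relation read off from the blocks in \<open>S\<close> is carried along by every map that
  respects adjacency on \<open>S\<close>, even if the map destroys adjacency elsewhere; relabelling
  a block outside \<open>S\<close> therefore leaves the relation intact. This is why the argument
  works with maps that respect a given set of blocks instead of automorphisms of \<open>G\<close>. A
  path of equally large cells puts no relation on its cells, only bijections between them. Cycles of
  such cells therefore need the version with matchings, all others the version with
  relations.\<close>

definition nbrs :: "'a rel \<Rightarrow> 'a \<Rightarrow> 'a set \<Rightarrow> 'a set" where
  "nbrs E u D = {w \<in> D. (u, w) \<in> E}"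

text \<open>All that later sections use of amenability. In \<open>rigid\<close> the isomorphism onto
  the competitor \<open>E'\<close> keeps every cell, because the rounds of color refinement cannot
  tell a vertex from its image. Each later use consists in a choice of \<open>E'\<close>.\<close>

locale rigid_partition =
  fixes V :: "'a set" and E :: "'a rel" and P :: "'a set set"
  assumes finite_V: "finite V"
    and E_sub: "E \<subseteq> V \<times> V"
    and sym_E: "sym E"
    and irrefl_E: "irrefl E"
    and partition: "partition_on V P"
    and equitable: "\<lbrakk>X \<in> P; Y \<in> P; u \<in> X; v \<in> X\<rbrakk> \<Longrightarrow> card (nbrs E u Y) = card (nbrs E v Y)"
    and rigid: "\<lbrakk>E' \<subseteq> V \<times> V; sym E'; irrefl E';
        \<And>X Y u. \<lbrakk>X \<in> P; Y \<in> P; u \<in> X\<rbrakk> \<Longrightarrow> card (nbrs E' u Y) = card (nbrs E u Y)\<rbrakk>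
      \<Longrightarrow> \<exists>f. f permutes V \<and> (\<forall>X\<in>P. f ` X = X) \<and>
            (\<forall>u\<in>V. \<forall>v\<in>V. (u, v) \<in> E \<longleftrightarrow> (f u, f v) \<in> E')"

section \<open>Color refinement as a chain of equivalence relations\<close>

definition refine_rel :: "'a pair_pre_digraph \<Rightarrow> 'a set set \<Rightarrow> 'a rel" where
  "refine_rel K P = {(u, v) \<in> pverts K \<times> pverts K.
      (\<exists>C\<in>P. u \<in> C \<and> v \<in> C) \<and>
      (\<forall>C\<in>P. card (nbrs (parcs K) u C) = card (nbrs (parcs K) v C))}"

lemma refine_eq_quotient: "refine K P = pverts K // refine_rel K P"
  by (simp add: refine_def refine_rel_def nbrs_def)

text \<open>With relations in place of partitions, refinement becomes inclusion, and comparing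
  rounds means comparing members of a decreasing sequence of finite sets.\<close>

primrec refinement_rel :: "'a pair_pre_digraph \<Rightarrow> nat \<Rightarrow> 'a rel" where
  "refinement_rel K 0 = pverts K \<times> pverts K"
| "refinement_rel K (Suc i) = refine_rel K (pverts K // refinement_rel K i)"

lemma equiv_quotient_ex:
  assumes "equiv A r"
  shows "(\<exists>C\<in>A//r. u \<in> C \<and> v \<in> C) \<longleftrightarrow> (u, v) \<in> r"
proof
  assume "\<exists>C\<in>A//r. u \<in> C \<and> v \<in> C"
  then show "(u, v) \<in> r" using assms by (meson quotient_eq_iff)
next
  assume uv: "(u, v) \<in> r"
  then have "u \<in> A" "v \<in> A" using assms by (auto simp: equiv_def refl_on_def)
  then have "r `` {u} \<in> A//r" "u \<in> r `` {u}" "v \<in> r `` {u}"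
    using uv quotientI[of u A r] equiv_class_self[OF assms, of u] by auto
  then show "\<exists>C\<in>A//r. u \<in> C \<and> v \<in> C" by blast
qed

lemma equiv_kernel:
  assumes "equiv A r"
  shows "equiv A {(u, v) \<in> r. \<forall>C\<in>Q. F u C = F v C}"
proof (rule equivI)
  show "{(u, v) \<in> r. \<forall>C\<in>Q. F u C = F v C} \<subseteq> A \<times> A"
    using equiv_type[OF assms] by blast
  show "refl_on A {(u, v) \<in> r. \<forall>C\<in>Q. F u C = F v C}"
    using assms by (auto simp: equiv_def refl_on_def)
  show "sym {(u, v) \<in> r. \<forall>C\<in>Q. F u C = F v C}"
    using assms by (auto simp: equiv_def dest: symD intro!: symI)
  have "trans r" using assms by (simp add: equiv_def)
  then show "trans {(u, v) \<in> r. \<forall>C\<in>Q. F u C = F v C}"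
    by (auto intro!: transI dest: transD)
qed

lemma refine_rel_eq:
  assumes "equiv (pverts K) r"
  shows "refine_rel K (pverts K // r) =
    {(u, v) \<in> r. \<forall>C\<in>pverts K // r. card (nbrs (parcs K) u C) = card (nbrs (parcs K) v C)}"
  unfolding refine_rel_def equiv_quotient_ex[OF assms] using equiv_type[OF assms] by blast

lemma equiv_refinement_rel: "equiv (pverts K) (refinement_rel K i)"
proof (induction i)
  case 0
  show ?case by (auto simp: equiv_def refl_on_def sym_def trans_def)
next
  case (Suc i)
  then show ?case by (simp add: refine_rel_eq equiv_kernel)
qed

lemma refinement_rel_Suc:
  "(u, v) \<in> refinement_rel K (Suc i) \<longleftrightarrow> (u, v) \<in> refinement_rel K i \<and>
     (\<forall>C\<in>pverts K // refinement_rel K i. card (nbrs (parcs K) u C) = card (nbrs (parcs K) v C))"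
  by (simp add: refine_rel_eq equiv_refinement_rel)

lemma refinement_rel_antimono: "i \<le> j \<Longrightarrow> refinement_rel K j \<subseteq> refinement_rel K i"
proof (rule lift_Suc_antimono_le[of "refinement_rel K"])
  show "refinement_rel K (Suc n) \<subseteq> refinement_rel K n" for n
    using refinement_rel_Suc[of _ _ K n] by (meson subrelI)
qed

text \<open>Nonemptiness matters in round zero: on an empty vertex set the initial partition is
  \<open>{{}}\<close>, whereas the quotient is empty.\<close>

lemma refinement_eq_quotient:
  assumes "pverts K \<noteq> {}"
  shows "refinement K i = pverts K // refinement_rel K i"
proof (induction i)
  case 0
  show ?case using assms by (auto simp: refinement_def quotient_def)
next
  case (Suc i)
  then show ?case by (simp add: refinement_def refine_eq_quotient)
qed

text \<open>While the partition changes, the relation loses at least one pair per round, which a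
  finite set of pairs can bear only finitely often.\<close>

lemma refinement_stabilizes:
  assumes "finite (pverts K)" "pverts K \<noteq> {}"
  shows "\<exists>i. refinement K (Suc i) = refinement K i"
proof (rule ccontr)
  assume neq: "\<nexists>i. refinement K (Suc i) = refinement K i"
  have less: "refinement_rel K (Suc i) \<subset> refinement_rel K i" for i
    using neq refinement_rel_antimono[of i "Suc i" K] refinement_eq_quotient[OF assms(2)]
    by (metis le_SucI order_refl psubsetI)
  have fin: "finite (refinement_rel K i)" for i
    by (rule finite_subset[OF refinement_rel_antimono[of 0 i]]) (use assms in auto)
  have "card (refinement_rel K i) + i \<le> card (refinement_rel K 0)" for i
  proof (induction i)
    case (Suc i)
    then show ?case using psubset_card_mono[OF fin less, of i] by linarith
  qed simp
  from this[of "Suc (card (refinement_rel K 0))"] show False by simp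
qed

definition stable_index :: "'a pair_pre_digraph \<Rightarrow> nat" where
  "stable_index K = (LEAST i. refinement K (Suc i) = refinement K i)"

lemma stable_index:
  assumes "finite (pverts K)" "pverts K \<noteq> {}"
  shows "refinement K (Suc (stable_index K)) = refinement K (stable_index K)"
    and "j < stable_index K \<Longrightarrow> refinement K (Suc j) \<noteq> refinement K j"
  unfolding stable_index_def
  using LeastI_ex[OF refinement_stabilizes[OF assms]]  not_less_Least by blast+

lemma stable_partition_eq:
  assumes "pverts K \<noteq> {}"
  shows "stable_partition K = pverts K // refinement_rel K (stable_index K)"
  using refinement_eq_quotient[OF assms] by (simp add: stable_partition_def stable_index_def)

lemma partition_on_stable_partition:
  assumes "pverts K \<noteq> {}"
  shows "partition_on (pverts K) (stable_partition K)"
  unfolding stable_partition_eq[OF assms] by (rule partition_on_quotient[OF equiv_refinement_rel])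

lemma stable_partition_equitable:
  assumes "finite (pverts K)" "pverts K \<noteq> {}"
    and "X \<in> stable_partition K" "Y \<in> stable_partition K" "u \<in> X" "v \<in> X"
  shows "card (nbrs (parcs K) u Y) = card (nbrs (parcs K) v Y)"
proof -
  let ?n = "stable_index K"
  \<comment> \<open>By stability the cells are also the classes of the following round, and that
    round compares degrees into the present cells.\<close>
  have "stable_partition K = pverts K // refinement_rel K (Suc ?n)"
    using stable_index(1)[OF assms(1,2)] refinement_eq_quotient[OF assms(2)] stable_partition_eq[OF assms(2)]
    by (simp del: refinement_rel.simps)
  then have "(u, v) \<in> refinement_rel K (Suc ?n)"
    using assms(3,5,6) equiv_quotient_ex[OF equiv_refinement_rel[of K "Suc ?n"], of u v] by blast
  then show ?thesis
    using assms(4) unfolding refinement_rel_Suc stable_partition_eq[OF assms(2)] by blast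
qed

section \<open>Refining the union of a graph and a relabelled competitor\<close>

definition doubled :: "('a \<Rightarrow> 'b) \<Rightarrow> 'a set \<Rightarrow> ('a + 'b) set" where
  "doubled g C = Inl ` C \<union> Inr ` g ` C"

text \<open>\<open>amenable\<close> quantifies over graphs on natural numbers, so a competitor on
  the vertices of \<open>G\<close> has to be carried over by an injection \<open>g\<close>.\<close>

definition image_graph :: "('a \<Rightarrow> 'b) \<Rightarrow> 'a set \<Rightarrow> 'a rel \<Rightarrow> 'b pair_pre_digraph" where
  "image_graph g V E = \<lparr> pverts = g ` V, parcs = map_prod g g ` E \<rparr>"

text \<open>Surjectivity of \<open>\<pi>\<close> keeps the preimages of classes nonempty. The lemma
  is applied to \<open>unfold_double\<close>, which folds both copies of the vertex set onto
  one.\<close>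

lemma quotient_vimage:
  assumes "\<pi> ` U = V" "equiv V r"
  shows "U // {(z, z') \<in> U \<times> U. (\<pi> z, \<pi> z') \<in> r} = (\<lambda>C. {z \<in> U. \<pi> z \<in> C}) ` (V // r)" (is "?L = ?R")
proof -
  have "?L = (\<lambda>z. {z' \<in> U. (\<pi> z, \<pi> z') \<in> r}) ` U"
    by (auto simp: quotient_def)
  also have "\<dots> = (\<lambda>x. {z' \<in> U. \<pi> z' \<in> r `` {x}}) ` V"
    using assms(1) by auto
  also have "\<dots> = ?R" by (auto simp: quotient_def)
  finally show ?thesis .
qed

lemma disjoint_union_arcs:
  "(Inl x, Inl y) \<in> parcs (disjoint_union G H) \<longleftrightarrow> (x, y) \<in> parcs G"
  "(Inr x', Inr y') \<in> parcs (disjoint_union G H) \<longleftrightarrow> (x', y') \<in> parcs H"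
  "(Inl x, Inr y') \<notin> parcs (disjoint_union G H)"
  "(Inr x', Inl y) \<notin> parcs (disjoint_union G H)"
  by (auto simp: disjoint_union_def map_prod_def split_beta image_iff intro: bexI[rotated])

lemma doubled_inj: "inj (doubled g)"
  by (rule injI) (auto simp: doubled_def)

context
  fixes G :: "'a pair_pre_digraph" and E' :: "'a rel" and g :: "'a \<Rightarrow> 'b"
  assumes E'_sub: "E' \<subseteq> pverts G \<times> pverts G"
    and inj_g: "inj_on g (pverts G)"
begin

definition "unfold_double = case_sum id (inv_into (pverts G) g)"

lemma unfold_double: "z \<in> doubled g (pverts G) \<Longrightarrow> unfold_double z \<in> pverts G"
  "unfold_double ` doubled g (pverts G) = pverts G"
  using inj_g by (auto simp: doubled_def unfold_double_def image_Un image_image inv_into_into)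

lemma doubled_eq:
  assumes "C \<subseteq> pverts G"
  shows "doubled g C = {z \<in> doubled g (pverts G). unfold_double z \<in> C}"
  using assms inj_g by (auto simp: doubled_def unfold_double_def image_iff subset_iff)

text \<open>Neighbours stay within one copy: in the first copy the count is a degree of
  \<open>G\<close>, in the second a degree of \<open>E'\<close>, and \<open>eq\<close> identifies
  them.\<close>

lemma card_nbrs_doubled:
  assumes C: "C \<subseteq> pverts G" and z: "z \<in> doubled g (pverts G)"
    and eq: "\<And>u. u \<in> pverts G \<Longrightarrow> card (nbrs E' u C) = card (nbrs (parcs G) u C)"
  shows "card (nbrs (parcs (disjoint_union G (image_graph g (pverts G) E'))) z (doubled g C))
       = card (nbrs (parcs G) (unfold_double z) C)"
    (is "card (nbrs ?U z _) = _")
proof (cases z)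
  case (Inl x)
  then have "nbrs ?U z (doubled g C) = Inl ` nbrs (parcs G) x C"
    by (auto simp: nbrs_def doubled_def disjoint_union_arcs)
  then show ?thesis by (simp add: Inl unfold_double_def card_image)
next
  case (Inr y)
  then obtain x where x: "x \<in> pverts G" "y = g x" using z by (auto simp: doubled_def)
  have "(g x, g w) \<in> map_prod g g ` E' \<longleftrightarrow> (x, w) \<in> E'" if "w \<in> C" for w
    using that x C E'_sub inj_g by (force simp: inj_on_eq_iff subset_iff)
  then have "nbrs ?U z (doubled g C) = (Inr \<circ> g) ` nbrs E' x C"
    using x Inr by (auto simp: nbrs_def doubled_def disjoint_union_arcs image_graph_def)
  moreover have "inj_on (Inr \<circ> g) (nbrs E' x C)"
    using inj_g C by (auto simp: inj_on_def nbrs_def)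
  ultimately have "card (nbrs ?U z (doubled g C)) = card (nbrs E' x C)"
    by (metis card_image)
  then show ?thesis using x Inr inj_g eq by (simp add: unfold_double_def)
qed

text \<open>Both conditions that define a round depend on a vertex of the union only through its
  projection, so the round on the union is the preimage of the round on \<open>G\<close>.\<close>

lemma refine_doubled:
  assumes r: "equiv (pverts G) r"
    and eq: "\<And>C u. C \<in> pverts G // r \<Longrightarrow> u \<in> pverts G \<Longrightarrow> card (nbrs E' u C) = card (nbrs (parcs G) u C)"
    and r': "equiv (pverts G) (refine_rel G (pverts G // r))"
  shows "refine (disjoint_union G (image_graph g (pverts G) E')) (doubled g ` (pverts G // r))
       = doubled g ` refine G (pverts G // r)"
proof -
  let ?V = "pverts G"
  let ?U = "disjoint_union G (image_graph g ?V E')"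
  have sub: "C \<subseteq> ?V" if "C \<in> ?V // r" for C
    by (rule in_quotient_imp_subset[OF r that])
  have U: "pverts ?U = doubled g ?V"
    by (auto simp: disjoint_union_def doubled_def image_graph_def)
  have "refine_rel ?U (doubled g ` (?V // r))
      = {(z, z') \<in> doubled g ?V \<times> doubled g ?V. (unfold_double z, unfold_double z') \<in> refine_rel G (?V // r)}"
  proof -
    have ex: "(\<exists>D\<in>doubled g ` (?V // r). z \<in> D \<and> z' \<in> D) \<longleftrightarrow>
        (\<exists>C\<in>?V // r. unfold_double z \<in> C \<and> unfold_double z' \<in> C)"
      if "z \<in> doubled g ?V" "z' \<in> doubled g ?V" for z z'
      using that by (auto simp: doubled_eq[OF sub])
    have all: "(\<forall>D\<in>doubled g ` (?V // r). card (nbrs (parcs ?U) z D) = card (nbrs (parcs ?U) z' D)) \<longleftrightarrow>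
        (\<forall>C\<in>?V // r. card (nbrs (parcs G) (unfold_double z) C) = card (nbrs (parcs G) (unfold_double z') C))"
      if "z \<in> doubled g ?V" "z' \<in> doubled g ?V" for z z'
      using that by (simp add: card_nbrs_doubled[OF sub _ eq])
    have "(z, z') \<in> refine_rel ?U (doubled g ` (?V // r)) \<longleftrightarrow> z \<in> doubled g ?V \<and> z' \<in> doubled g ?V \<and>
        (unfold_double z, unfold_double z') \<in> refine_rel G (?V // r)" for z z'
    proof (cases "z \<in> doubled g ?V \<and> z' \<in> doubled g ?V")
      case True
      then show ?thesis
        unfolding refine_rel_def mem_Collect_eq case_prod_conv mem_Sigma_iff U
        using ex[of z z'] all[of z z'] unfold_double(1) by (simp only: simp_thms)
    next
      case False
      then have "(z, z') \<notin> refine_rel ?U (doubled g ` (?V // r))"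
        unfolding refine_rel_def U by blast
      with False show ?thesis by blast
    qed
    then show ?thesis by blast
  qed
  then have "refine ?U (doubled g ` (?V // r)) = (\<lambda>C. {z \<in> doubled g ?V. unfold_double z \<in> C}) ` refine G (?V // r)"
    unfolding refine_eq_quotient U using quotient_vimage[OF unfold_double(2) r'] by simp
  also have "\<dots> = doubled g ` refine G (?V // r)"
  proof (rule image_cong[OF refl])
    fix C assume "C \<in> refine G (?V // r)"
    then have "C \<subseteq> ?V" unfolding refine_eq_quotient by (rule in_quotient_imp_subset[OF r'])
    then show "{z \<in> doubled g ?V. unfold_double z \<in> C} = doubled g C" by (rule doubled_eq[symmetric])
  qed
  finally show ?thesis .
qed

end

section \<open>Isomorphisms as bijections of vertices\<close>

lemma isomorphic_imp_bij:
  assumes "isomorphic G H"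
  obtains f where "bij_betw f (pverts G) (pverts H)"
    "\<And>u v. \<lbrakk>u \<in> pverts G; v \<in> pverts G\<rbrakk> \<Longrightarrow> (u, v) \<in> parcs G \<longleftrightarrow> (f u, f v) \<in> parcs H"
proof -
  obtain h where h: "pre_digraph.digraph_isomorphism (with_proj G) h"
    and H: "with_proj H = app_iso h (with_proj G)"
    using assms by (auto simp: isomorphic_def digraph_iso_def)
  let ?f = "iso_verts h"
  have verts: "pverts H = ?f ` pverts G" and arcs: "parcs H = iso_arcs h ` parcs G"
    and hd: "iso_head h = snd" and tl: "iso_tail h = fst"
    using arg_cong[OF H, of verts] arg_cong[OF H, of arcs] arg_cong[OF H, of head] arg_cong[OF H, of tail]
    by simp_all
  have inj: "inj_on ?f (pverts G)" and wf: "wf_digraph (with_proj G)"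
    and ar: "\<And>u v. (u, v) \<in> parcs G \<Longrightarrow> iso_arcs h (u, v) = (?f u, ?f v)"
    using h unfolding pre_digraph.digraph_isomorphism_def by (auto simp: hd tl prod_eq_iff)
  have sub: "parcs G \<subseteq> pverts G \<times> pverts G"
    using wf by (force simp: wf_digraph_def)
  show ?thesis
  proof
    show "bij_betw ?f (pverts G) (pverts H)" using inj verts by (simp add: bij_betw_def)
    fix u v assume uv: "u \<in> pverts G" "v \<in> pverts G"
    show "(u, v) \<in> parcs G \<longleftrightarrow> (?f u, ?f v) \<in> parcs H"
    proof
      assume "(u, v) \<in> parcs G" then show "(?f u, ?f v) \<in> parcs H" using ar arcs by force
    next
      assume "(?f u, ?f v) \<in> parcs H"
      then obtain a b where "(a, b) \<in> parcs G" "?f a = ?f u" "?f b = ?f v" using arcs ar by force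
      then show "(u, v) \<in> parcs G" using sub inj uv by (metis (no_types) inj_onD mem_Sigma_iff subsetD)
    qed
  qed
qed

lemma isomorphic_if_bij:
  assumes sub: "parcs G \<subseteq> pverts G \<times> pverts G" and subH: "parcs H \<subseteq> pverts H \<times> pverts H"
    and bij: "bij_betw f (pverts G) (pverts H)"
    and arc: "\<And>u v. \<lbrakk>u \<in> pverts G; v \<in> pverts G\<rbrakk> \<Longrightarrow> (u, v) \<in> parcs G \<longleftrightarrow> (f u, f v) \<in> parcs H"
  shows "isomorphic G H"
proof -
  let ?h = "\<lparr> iso_verts = f, iso_arcs = map_prod f f, iso_head = snd, iso_tail = fst \<rparr>"
  have inj: "inj_on f (pverts G)" and im: "f ` pverts G = pverts H"
    using bij by (auto simp: bij_betw_def)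
  have arcs: "parcs H = map_prod f f ` parcs G"
  proof (intro subset_antisym subsetI)
    fix e assume e: "e \<in> parcs H"
    then have "fst e \<in> f ` pverts G" "snd e \<in> f ` pverts G" using subH im by auto
    then obtain u v where "u \<in> pverts G" "v \<in> pverts G" "e = (f u, f v)" by (metis imageE prod.collapse)
    then show "e \<in> map_prod f f ` parcs G" using arc e by force
  qed (use sub arc in auto)
  have "inj_on (map_prod f f) (parcs G)"
    by (rule inj_on_subset[OF map_prod_inj_on[OF inj inj] sub])
  then have "pre_digraph.digraph_isomorphism (with_proj G) ?h"
    unfolding pre_digraph.digraph_isomorphism_def using inj sub
    by (auto simp: wf_digraph_def)
  moreover have "with_proj H = app_iso ?h (with_proj G)"
    using im arcs by (simp add: app_iso_def with_proj_def)
  ultimately show ?thesis by (auto simp: isomorphic_def digraph_iso_def)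
qed

text \<open>The competitor is known to have the right degrees into the final cells. Earlier rounds
  need degrees into coarser cells, which are unions of final ones.\<close>

lemma card_nbrs_union:
  assumes "finite V" "partition_on V P" "C \<subseteq> V" "\<And>X. X \<in> P \<Longrightarrow> X \<subseteq> C \<or> X \<inter> C = {}"
  shows "card (nbrs E u C) = (\<Sum>X\<in>{X \<in> P. X \<subseteq> C}. card (nbrs E u X))"
proof -
  have P: "\<Union>P = V" "disjoint P" using assms(2) by (auto simp: partition_on_def)
  have "nbrs E u C = (\<Union>X\<in>{X \<in> P. X \<subseteq> C}. nbrs E u X)"
  proof (intro subset_antisym subsetI)
    fix w assume w: "w \<in> nbrs E u C"
    then obtain X where "X \<in> P" "w \<in> X" using P assms(3) by (auto simp: nbrs_def)
    then show "w \<in> (\<Union>X\<in>{X \<in> P. X \<subseteq> C}. nbrs E u X)"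
      using assms(4)[of X] w by (auto simp: nbrs_def)
  qed (auto simp: nbrs_def)
  moreover have "finite {X \<in> P. X \<subseteq> C}"
    using finite_elements[OF assms(1,2)] by simp
  moreover have "finite (nbrs E u X)" if "X \<in> P" for X
    using that P assms(1) by (auto simp: nbrs_def intro: finite_subset)
  moreover have "nbrs E u X \<inter> nbrs E u Y = {}" if "X \<in> P" "Y \<in> P" "X \<noteq> Y" for X Y
    using that P(2) by (auto simp: nbrs_def disjoint_def)
  ultimately show ?thesis by (simp add: card_UN_disjoint)
qed

text \<open>The refinement of the union keeps pace with that of \<open>G\<close>, so each final cell
  consists of a cell of \<open>G\<close> and its copy, and amenability yields an isomorphism.
  Undoing the relabelling turns it into a permutation of the vertices of \<open>G\<close>.\<close>

theorem amenable_rigid_partition: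
  fixes G :: "'a pair_pre_digraph"
  assumes G: "pair_graph G" and am: "amenable G" and ne: "pverts G \<noteq> {}"
  shows "rigid_partition (pverts G) (parcs G) (stable_partition G)"
proof -
  interpret pair_graph G by fact
  let ?V = "pverts G" and ?P = "stable_partition G" and ?r = "refinement_rel G" and ?n = "stable_index G"
  have finV: "finite ?V" by (rule pair_finite_verts)
  have sub: "parcs G \<subseteq> ?V \<times> ?V" using in_arcsD1 in_arcsD2 by auto
  have part: "partition_on ?V ?P" by (rule partition_on_stable_partition[OF ne])
  show ?thesis
  proof
    show "finite ?V" "parcs G \<subseteq> ?V \<times> ?V" "partition_on ?V ?P" by fact+
    show "sym (parcs G)" using pair_sym_arcs by (simp add: symmetric_def)
    show "irrefl (parcs G)" using pair_no_loops by (force intro: irreflI)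
    show "card (nbrs (parcs G) u Y) = card (nbrs (parcs G) v Y)"
      if "X \<in> ?P" "Y \<in> ?P" "u \<in> X" "v \<in> X" for X Y u v
      using stable_partition_equitable[OF finV ne that] .
  next
    fix E' :: "'a rel"
    assume E': "E' \<subseteq> ?V \<times> ?V" and symE': "sym E'" and irreflE': "irrefl E'"
      and deg: "\<And>X Y u. \<lbrakk>X \<in> ?P; Y \<in> ?P; u \<in> X\<rbrakk> \<Longrightarrow> card (nbrs E' u Y) = card (nbrs (parcs G) u Y)"
    obtain g :: "'a \<Rightarrow> nat" where inj: "inj_on g ?V"
      using finite_imp_inj_to_nat_seg[OF finV] by auto
    let ?H = "image_graph g ?V E'"
    let ?U = "disjoint_union G ?H"
    have H: "pair_graph ?H"
    proof
      show "fst e \<in> pverts ?H" "snd e \<in> pverts ?H" if "e \<in> parcs ?H" for e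
        using that E' by (auto simp: image_graph_def)
      show "finite (pverts ?H)" "finite (parcs ?H)"
        using finV E' finite_subset[OF E'] by (auto simp: image_graph_def)
      show "fst e \<noteq> snd e" if e: "e \<in> parcs ?H" for e
      proof -
        obtain a b where ab: "(a, b) \<in> E'" "e = (g a, g b)" using e by (auto simp: image_graph_def)
        then have "a \<noteq> b" "a \<in> ?V" "b \<in> ?V" using irreflE' E' by (auto simp: irrefl_def)
        then show ?thesis using ab inj by (auto dest: inj_onD)
      qed
      show "symmetric (with_proj ?H)"
        using symE' by (auto simp: symmetric_def image_graph_def sym_def)
    qed
    have eq: "card (nbrs E' u C) = card (nbrs (parcs G) u C)"
      if C: "C \<in> ?V // ?r i" and i: "i \<le> ?n" and u: "u \<in> ?V" for C i u
    proof -
      have "X \<subseteq> C \<or> X \<inter> C = {}" if "X \<in> ?P" for X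
      proof (rule disjCI)
        assume "X \<inter> C \<noteq> {}"
        then obtain w where w: "w \<in> X" "w \<in> C" by blast
        have "X \<in> ?V // ?r ?n" using that stable_partition_eq[OF ne] by simp
        then have "X = ?r ?n `` {w}" using w(1) equiv_refinement_rel[of G ?n]
          by (metis Image_singleton_iff equiv_class_eq_iff quotientE)
        moreover have "C = ?r i `` {w}" using w(2) C equiv_refinement_rel[of G i]
          by (metis Image_singleton_iff equiv_class_eq_iff quotientE)
        ultimately show "X \<subseteq> C" using refinement_rel_antimono[OF i] by blast
      qed
      moreover have "C \<subseteq> ?V" by (rule in_quotient_imp_subset[OF equiv_refinement_rel C])
      moreover obtain X where "X \<in> ?P" "u \<in> X" using part u by (auto simp: partition_on_def)
      ultimately show ?thesis
        using deg by (simp add: card_nbrs_union[OF finV part])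
    qed
    \<comment> \<open>One round beyond \<open>?n\<close> is included, because it shows that the
      union stabilizes at the same index.\<close>
    have ref: "refinement ?U i = doubled g ` refinement G i" if "i \<le> Suc ?n" for i
      using that
    proof (induction i)
      case 0
      show ?case by (auto simp: refinement_def doubled_def disjoint_union_def image_graph_def)
    next
      case (Suc i)
      then have "refinement ?U (Suc i) = refine ?U (doubled g ` (?V // ?r i))"
        using refinement_eq_quotient[OF ne] by (simp add: refinement_def)
      also have "\<dots> = doubled g ` refine G (?V // ?r i)"
        by (rule refine_doubled[OF E' inj equiv_refinement_rel])
          (use Suc.prems eq equiv_refinement_rel[of G "Suc i"] in auto)
      also have "\<dots> = doubled g ` refinement G (Suc i)"
        using refinement_eq_quotient[OF ne, of i] by (simp add: refinement_def)
      finally show ?case .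
    qed
    have "stable_index ?U = ?n" unfolding stable_index_def[of ?U]
    proof (rule Least_equality)
      show "refinement ?U (Suc ?n) = refinement ?U ?n"
        using ref stable_index(1)[OF finV ne] by simp
      show "?n \<le> j" if j: "refinement ?U (Suc j) = refinement ?U j" for j
      proof (rule ccontr)
        assume "\<not> ?n \<le> j"
        then have "doubled g ` refinement G (Suc j) = doubled g ` refinement G j" "j < ?n"
          using j ref[of j] ref[of "Suc j"] by auto
        then show False
          using stable_index(2)[OF finV ne] doubled_inj by (metis inj_image_eq_iff)
      qed
    qed
    then have stU: "stable_partition ?U = doubled g ` ?P"
      using ref[of ?n] by (simp add: stable_partition_def stable_index_def)
    have "indistinguishable G ?H"
      unfolding indistinguishable_def stU
    proof (rule ballI)
      fix C assume "C \<in> doubled g ` ?P"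
      then obtain X where X: "X \<in> ?P" "C = doubled g X" by blast
      then have XV: "X \<subseteq> ?V" using part by (auto simp: partition_on_def)
      then have "C \<inter> Inl ` ?V = Inl ` X" "C \<inter> Inr ` pverts ?H = Inr ` g ` X"
        using X by (auto simp: doubled_def image_graph_def)
      moreover have "card (g ` X) = card X" using inj XV by (meson card_image inj_on_subset)
      ultimately show "card (C \<inter> Inl ` ?V) = card (C \<inter> Inr ` pverts ?H)"
        by (simp add: card_image)
    qed
    then have "isomorphic G ?H" using am H by (simp add: amenable_def)
    then obtain h where h: "bij_betw h ?V (g ` ?V)"
      and arc_h: "\<And>u v. \<lbrakk>u \<in> ?V; v \<in> ?V\<rbrakk> \<Longrightarrow> (u, v) \<in> parcs G \<longleftrightarrow> (h u, h v) \<in> map_prod g g ` E'"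
      by (rule isomorphic_imp_bij) (auto simp: image_graph_def)
    define f where "f u = (if u \<in> ?V then inv_into ?V g (h u) else u)" for u
    have bij_f: "bij_betw f ?V ?V"
    proof -
      have "bij_betw (inv_into ?V g \<circ> h) ?V ?V"
        using h inj by (auto intro!: bij_betw_trans bij_betw_inv_into simp: bij_betw_def[of g])
      then show ?thesis by (rule bij_betw_cong[THEN iffD1, rotated]) (simp add: f_def)
    qed
    have perm: "f permutes ?V" by (rule bij_imp_permutes[OF bij_f]) (simp add: f_def)
    have gf: "g (f u) = h u" "f u \<in> ?V" if "u \<in> ?V" for u
    proof -
      have "h u \<in> g ` ?V" using h that by (auto simp: bij_betw_def)
      then show "g (f u) = h u" "f u \<in> ?V" using that by (auto simp: f_def f_inv_into_f inv_into_into)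
    qed
    have arc: "(u, v) \<in> parcs G \<longleftrightarrow> (f u, f v) \<in> E'" if uv: "u \<in> ?V" "v \<in> ?V" for u v
    proof -
      have "(g a, g b) \<in> map_prod g g ` E' \<longleftrightarrow> (a, b) \<in> E'" if "a \<in> ?V" "b \<in> ?V" for a b
      proof
        assume "(g a, g b) \<in> map_prod g g ` E'"
        then obtain a' b' where ab: "(a', b') \<in> E'" "g a = g a'" "g b = g b'" by auto
        then have "a' \<in> ?V" "b' \<in> ?V" using E' by auto
        then show "(a, b) \<in> E'" using ab that inj by (simp add: inj_on_eq_iff)
      qed (use map_prod_imageI in fast)
      from this[of "f u" "f v"] show ?thesis using arc_h uv gf by simp
    qed
    \<comment> \<open>An isomorphism cannot leave a cell. By induction \<open>f\<close> permutes
      each class \<open>C\<close> of round \<open>i\<close>, so the neighbours of \<open>u\<close>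
      in \<open>C\<close> correspond to the \<open>E'\<close>-neighbours of \<open>f u\<close> in
      \<open>C\<close>, and there are as many of these as neighbours of \<open>f u\<close> in
      \<open>G\<close>.\<close>
    have rel_f: "\<forall>u\<in>?V. (u, f u) \<in> ?r i" if "i \<le> ?n" for i
      using that
    proof (induction i)
      case 0
      then show ?case using gf by simp
    next
      case (Suc i)
      then have IH: "\<And>u. u \<in> ?V \<Longrightarrow> (u, f u) \<in> ?r i" by simp
      show ?case
      proof
        fix u assume u: "u \<in> ?V"
        have "card (nbrs (parcs G) u C) = card (nbrs (parcs G) (f u) C)" if C: "C \<in> ?V // ?r i" for C
        proof -
          have CV: "C \<subseteq> ?V" by (rule in_quotient_imp_subset[OF equiv_refinement_rel C])
          have fC: "f w \<in> C" if "w \<in> C" for w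
            using in_quotient_imp_closed[OF equiv_refinement_rel C that IH] that CV by blast
          have inj_f: "inj_on f C" by (rule permutes_inj_on[OF perm])
          have "f ` C \<subseteq> C" using fC by blast
          then have "f ` C = C" by (rule endo_inj_surj[OF finite_subset[OF CV finV] _ inj_f])
          then have "nbrs E' (f u) C = {w \<in> f ` C. (f u, w) \<in> E'}" by (simp add: nbrs_def)
          also have "\<dots> = f ` {w \<in> C. (f u, f w) \<in> E'}" by blast
          also have "{w \<in> C. (f u, f w) \<in> E'} = nbrs (parcs G) u C"
            unfolding nbrs_def using arc[OF u] CV by blast
          finally have "nbrs E' (f u) C = f ` nbrs (parcs G) u C" .
          then have "card (nbrs (parcs G) u C) = card (nbrs E' (f u) C)"
            using card_image[OF inj_on_subset[OF inj_f]] by (simp add: nbrs_def)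
          then show ?thesis using eq[OF C, of "f u"] gf(2)[OF u] Suc.prems by simp
        qed
        then show "(u, f u) \<in> ?r (Suc i)" unfolding refinement_rel_Suc using IH[OF u] by blast
      qed
    qed
    have "f ` X = X" if X: "X \<in> ?P" for X
    proof -
      have XV: "X \<subseteq> ?V" using X part by (auto simp: partition_on_def)
      have "f w \<in> X" if "w \<in> X" for w
        using in_quotient_imp_closed[OF equiv_refinement_rel X[unfolded stable_partition_eq[OF ne]] that, of "f w"]
          that XV rel_f[of ?n] by blast
      then have "f ` X \<subseteq> X" by blast
      then show ?thesis
        by (rule endo_inj_surj[OF finite_subset[OF XV finV] _ permutes_inj_on[OF perm]])
    qed
    then show "\<exists>f. f permutes ?V \<and> (\<forall>X\<in>?P. f ` X = X) \<and>
        (\<forall>u\<in>?V. \<forall>v\<in>?V. (u, v) \<in> parcs G \<longleftrightarrow> (f u, f v) \<in> E')"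
      using perm arc by blast
  qed
qed

section \<open>Biregular bipartite graphs determined by their degrees\<close>

definition biregular :: "'a set \<Rightarrow> 'b set \<Rightarrow> nat \<Rightarrow> nat \<Rightarrow> ('a \<times> 'b) set \<Rightarrow> bool" where
  "biregular X Y p q E \<longleftrightarrow> E \<subseteq> X \<times> Y \<and> (\<forall>x\<in>X. card (E `` {x}) = p) \<and> (\<forall>y\<in>Y. card (E\<inverse> `` {y}) = q)"

lemma card_residue_class:
  assumes "j < (b::nat)"
  shows "card {k. k < b * q \<and> k mod b = j} = q"
proof -
  have "{k. k < b * q \<and> k mod b = j} = (\<lambda>m. m * b + j) ` {..<q}"
  proof (intro subset_antisym subsetI)
    fix k assume "k \<in> {k. k < b * q \<and> k mod b = j}"
    then have "k = (k div b) * b + j" "k div b < q"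
      by (auto simp: less_mult_imp_div_less mult.commute div_mult_mod_eq)
    then show "k \<in> (\<lambda>m. m * b + j) ` {..<q}" by blast
  next
    fix k assume "k \<in> (\<lambda>m. m * b + j) ` {..<q}"
    then obtain m where m: "k = m * b + j" "m < q" by blast
    have "m * b + j < Suc m * b" using assms by simp
    also have "\<dots> \<le> q * b" using m(2) by (intro mult_le_mono1) simp
    finally show "k \<in> {k. k < b * q \<and> k mod b = j}" using m assms by (simp add: mult.commute)
  qed
  moreover have "inj_on (\<lambda>m. m * b + j) {..<q}" using assms by (auto simp: inj_on_def)
  ultimately show ?thesis by (simp add: card_image)
qed

lemma eq_if_mod_eq_close:
  assumes "(k::nat) mod b = l mod b" "k < l + b" "l < k + b"
  shows "k = l"
proof -
  have "int b dvd int k - int l" using assms(1)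
    by (metis mod_eq_dvd_iff zmod_int)
  moreover have "\<bar>int k - int l\<bar> < int b" using assms by linarith
  ultimately show ?thesis using zdvd_imp_le[of "int b" "\<bar>int k - int l\<bar>"] by force
qed

text \<open>Vertex \<open>i\<close> of the left side receives the consecutive neighbours \<open>i p, \<dots>, i p + p - 1\<close> modulo \<open>b\<close>.\<close>

lemma biregular_exists_nat:
  assumes eq: "a * p = b * q" and p: "p \<le> b"
  shows "\<exists>E. biregular {..<a} {..<b} p q (E :: nat rel)"
proof (cases "p = 0")
  case True
  then have "b = 0 \<or> q = 0" using eq by auto
  then have "biregular {..<a} {..<b} p q {}" using True by (auto simp: biregular_def)
  then show ?thesis ..
next
  case False
  define E where "E = {(i, k mod b) | i k. i < a \<and> i * p \<le> k \<and> k < i * p + p}"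
  have div: "k div p = i" if "i * p \<le> k" "k < i * p + p" for i k
    using that False by (metis add.commute div_nat_eqI mult.commute mult_Suc_right)
  have "E \<subseteq> {..<a} \<times> {..<b}" using p False by (auto simp: E_def)
  moreover have "card (E `` {i}) = p" if "i < a" for i
  proof -
    have "E `` {i} = (\<lambda>k. k mod b) ` {i * p..<i * p + p}" using that by (auto simp: E_def)
    moreover have "inj_on (\<lambda>k. k mod b) {i * p..<i * p + p}"
    proof (rule inj_onI)
      fix k l assume "k \<in> {i * p..<i * p + p}" "l \<in> {i * p..<i * p + p}" "k mod b = l mod b"
      then show "k = l" using p by (intro eq_if_mod_eq_close[of k b l]) auto
    qed
    ultimately show ?thesis by (simp add: card_image)
  qed
  \<comment> \<open>The edges are the numbers \<open>k < a * p = b * q\<close>, with left end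
    \<open>k div p\<close>. Those ending in \<open>j\<close> form a residue class of size
    \<open>q\<close>; two of them with the same left end are congruent modulo \<open>b\<close> at
    distance less than \<open>p\<close>, hence equal.\<close>
  moreover have "card (E\<inverse> `` {j}) = q" if j: "j < b" for j
  proof -
    have "E\<inverse> `` {j} = (\<lambda>k. k div p) ` {k. k < b * q \<and> k mod b = j}"
    proof (intro subset_antisym subsetI)
      fix i assume "i \<in> E\<inverse> `` {j}"
      then obtain k where k: "i < a" "i * p \<le> k" "k < i * p + p" "k mod b = j" by (auto simp: E_def)
      have "Suc i * p \<le> a * p" using k(1) by (intro mult_le_mono1) simp
      then have "k < b * q" using k eq by simp
      then show "i \<in> (\<lambda>k. k div p) ` {k. k < b * q \<and> k mod b = j}" using div k by force
    next
      fix i assume "i \<in> (\<lambda>k. k div p) ` {k. k < b * q \<and> k mod b = j}"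
      then obtain k where k: "i = k div p" "k < a * p" "k mod b = j" using eq by auto
      moreover have "i < a" using k by (simp add: less_mult_imp_div_less)
      moreover have "i * p \<le> k" "k < i * p + p"
        using k(1) False dividend_less_div_times[of p k] by (simp_all add: add.commute)
      ultimately show "i \<in> E\<inverse> `` {j}" by (auto simp: E_def)
    qed
    moreover have "inj_on (\<lambda>k. k div p) {k. k < b * q \<and> k mod b = j}"
    proof (rule inj_onI)
      fix k l assume *: "k \<in> {k. k < b * q \<and> k mod b = j}" "l \<in> {k. k < b * q \<and> k mod b = j}" "k div p = l div p"
      have "k < (k div p) * p + p" "l < (l div p) * p + p" "(k div p) * p \<le> k" "(l div p) * p \<le> l"
        using False dividend_less_div_times[of p] by (auto simp: add.commute)
      then have "k < l + b" "l < k + b" unfolding *(3) using p by linarith+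
      then show "k = l" using * by (intro eq_if_mod_eq_close[of k b l]) auto
    qed
    ultimately show ?thesis by (simp add: card_image card_residue_class[OF j])
  qed
  ultimately have "biregular {..<a} {..<b} p q E" by (auto simp: biregular_def)
  then show ?thesis ..
qed

lemma biregular_exists:
  assumes fin: "finite X" "finite Y" and eq: "card X * p = card Y * q" and p: "p \<le> card Y"
  shows "\<exists>E. biregular X Y p q E"
proof -
  obtain f h where f: "bij_betw f X {..<card X}" and h: "bij_betw h Y {..<card Y}"
    using fin ex_bij_betw_finite_nat atLeast0LessThan by metis
  obtain E where E: "biregular {..<card X} {..<card Y} p q E"
    using biregular_exists_nat[OF eq p] by blast
  define E' where "E' = {(x, y) \<in> X \<times> Y. (f x, h y) \<in> E}"
  have "card (E' `` {x}) = p" if "x \<in> X" for x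
  proof -
    have fx: "f x \<in> {..<card X}" using f that by (auto simp: bij_betw_def)
    have "h ` (E' `` {x}) = E `` {f x}"
      using E h that by (auto simp: E'_def bij_betw_def biregular_def)
    moreover have "inj_on h (E' `` {x})" using h by (auto simp: E'_def bij_betw_def inj_on_def)
    ultimately show ?thesis using E fx by (metis biregular_def card_image)
  qed
  moreover have "card (E'\<inverse> `` {y}) = q" if "y \<in> Y" for y
  proof -
    have fx: "h y \<in> {..<card Y}" using h that by (auto simp: bij_betw_def)
    have "f ` (E'\<inverse> `` {y}) = E\<inverse> `` {h y}"
      using E f that by (auto simp: E'_def bij_betw_def biregular_def)
    moreover have "inj_on f (E'\<inverse> `` {y})" using f by (auto simp: E'_def bij_betw_def inj_on_def)
    ultimately show ?thesis using E fx by (metis biregular_def card_image)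
  qed
  ultimately have "biregular X Y p q E'" by (auto simp: biregular_def E'_def)
  then show ?thesis ..
qed

text \<open>The left vertices whose component is complete bipartite.\<close>

definition full_vertices :: "'a set \<Rightarrow> ('a \<times> 'b) set \<Rightarrow> 'a set" where
  "full_vertices X E = {x \<in> X. \<forall>x'. E `` {x} \<inter> E `` {x'} \<noteq> {} \<longrightarrow> E `` {x'} = E `` {x}}"

text \<open>Injective maps of the sides respect equality and disjointness of neighbourhoods, and
  \<open>full_vertices\<close> speaks of nothing else.\<close>

lemma card_full_vertices_iso:
  assumes E: "E \<subseteq> X \<times> Y" and E': "E' \<subseteq> X \<times> Y" and f: "bij_betw f X X" and h: "bij_betw h Y Y"
    and iso: "\<And>x y. \<lbrakk>x \<in> X; y \<in> Y\<rbrakk> \<Longrightarrow> (x, y) \<in> E \<longleftrightarrow> (f x, h y) \<in> E'"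
  shows "card (full_vertices X E) = card (full_vertices X E')"
proof -
  have fX: "f ` X = X" "inj_on f X" and hY: "h ` Y = Y" "inj_on h Y"
    using f h by (auto simp: bij_betw_def)
  have nb: "E' `` {f x} = h ` (E `` {x})" if "x \<in> X" for x
  proof (intro subset_antisym subsetI)
    fix y assume "y \<in> E' `` {f x}"
    moreover from this obtain z where "z \<in> Y" "y = h z" using E' hY(1) by blast
    ultimately show "y \<in> h ` (E `` {x})" using iso that by auto
  qed (use iso that E in auto)
  have eq: "h ` (E `` {x}) = h ` (E `` {x'}) \<longleftrightarrow> E `` {x} = E `` {x'}"
    and int: "h ` (E `` {x}) \<inter> h ` (E `` {x'}) \<noteq> {} \<longleftrightarrow> E `` {x} \<inter> E `` {x'} \<noteq> {}" for x x'
  proof -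
    have "E `` {x} \<subseteq> Y" "E `` {x'} \<subseteq> Y" using E by auto
    then show "h ` (E `` {x}) = h ` (E `` {x'}) \<longleftrightarrow> E `` {x} = E `` {x'}"
      by (rule inj_on_image_eq_iff[OF hY(2)])
    show "h ` (E `` {x}) \<inter> h ` (E `` {x'}) \<noteq> {} \<longleftrightarrow> E `` {x} \<inter> E `` {x'} \<noteq> {}"
      using inj_on_image_Int[OF hY(2) \<open>E `` {x} \<subseteq> Y\<close> \<open>E `` {x'} \<subseteq> Y\<close>] by (metis image_is_empty)
  qed
  \<comment> \<open>In \<open>full_vertices\<close> the variable \<open>x'\<close> ranges over the
    whole type; a common neighbour forces it into \<open>X\<close>.\<close>
  have in_X: "x' \<in> X" if "E `` {x} \<inter> E `` {x'} \<noteq> {}" for x x' using that E by auto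
  have in_X': "x' \<in> X" if "E' `` {x} \<inter> E' `` {x'} \<noteq> {}" for x x' using that E' by auto
  have "f x \<in> full_vertices X E' \<longleftrightarrow> x \<in> full_vertices X E" if x: "x \<in> X" for x
  proof
    assume L: "f x \<in> full_vertices X E'"
    have "E `` {x'} = E `` {x}" if "E `` {x} \<inter> E `` {x'} \<noteq> {}" for x'
    proof -
      have x': "x' \<in> X" using in_X that .
      have "E' `` {f x} \<inter> E' `` {f x'} \<noteq> {}" using that unfolding nb[OF x] nb[OF x'] int .
      then have "E' `` {f x'} = E' `` {f x}" using L by (simp add: full_vertices_def)
      then show ?thesis unfolding nb[OF x] nb[OF x'] eq .
    qed
    then show "x \<in> full_vertices X E" using x by (simp add: full_vertices_def)
  next
    assume R: "x \<in> full_vertices X E"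
    have "E' `` {z} = E' `` {f x}" if z: "E' `` {f x} \<inter> E' `` {z} \<noteq> {}" for z
    proof -
      obtain x' where x': "x' \<in> X" "z = f x'" using in_X'[OF z] fX(1) by blast
      have "E `` {x} \<inter> E `` {x'} \<noteq> {}" using z unfolding x'(2) nb[OF x] nb[OF x'(1)] int .
      then have "E `` {x'} = E `` {x}" using R by (simp add: full_vertices_def)
      then show ?thesis unfolding x'(2) nb[OF x] nb[OF x'(1)] eq .
    qed
    then show "f x \<in> full_vertices X E'" using x fX(1) by (auto simp: full_vertices_def)
  qed
  moreover have sub: "full_vertices X E \<subseteq> X" "full_vertices X E' \<subseteq> f ` X"
    unfolding fX(1) by (auto simp: full_vertices_def)
  ultimately have "f ` full_vertices X E = full_vertices X E'" by blast
  moreover have "inj_on f (full_vertices X E)"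
    by (rule inj_on_subset[OF fX(2) sub(1)])
  ultimately show ?thesis by (metis card_image)
qed

lemma card_swap: "\<lbrakk>finite A; a \<in> A; b \<notin> A\<rbrakk> \<Longrightarrow> card (insert b (A - {a})) = card A"
  by (metis Diff_iff card.remove card_insert_disjoint finite_Diff)

text \<open>
  The first graph has a component \<open>K\<^bsub>q,p\<^esub>\<close>. Switching one of its edges with an edge outside
  destroys that component and cannot create a new one.
\<close>

lemma biregular_not_unique:
  assumes fin: "finite X" "finite Y" and eq: "card X * p = card Y * q"
    and p: "2 \<le> p" "2 * p \<le> card Y" and q: "2 \<le> q"
  shows "\<exists>E1 E2. biregular X Y p q E1 \<and> biregular X Y p q E2 \<and>
    card (full_vertices X E1) \<noteq> card (full_vertices X E2)"
proof -
  \<comment> \<open>Counting edges turns the room for two blocks of size \<open>p\<close> in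
    \<open>Y\<close> into room for two blocks of size \<open>q\<close> in \<open>X\<close>, so that
    something remains outside the complete component.\<close>
  have "2 * q * p \<le> card X * p" using p(2) eq by (simp add: mult.commute mult_le_mono1 mult.assoc)
  then have q2: "2 * q \<le> card X" using p(1) by simp
  obtain X1 where X1: "X1 \<subseteq> X" "card X1 = q" "finite X1"
    using obtain_subset_with_card_n[of q X] q2 by auto
  obtain Y1 where Y1: "Y1 \<subseteq> Y" "card Y1 = p" "finite Y1"
    using obtain_subset_with_card_n[of p Y] p(2) by auto
  have "card (X - X1) * p = card (Y - Y1) * q"
    using eq X1 Y1 by (simp add: card_Diff_subset diff_mult_distrib diff_mult_distrib2 mult.commute)
  moreover have "p \<le> card (Y - Y1)" using p(2) Y1 by (simp add: card_Diff_subset)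
  ultimately obtain E0 where E0: "biregular (X - X1) (Y - Y1) p q E0"
    using biregular_exists[of "X - X1" "Y - Y1" p q] fin by blast
  define E1 where "E1 = X1 \<times> Y1 \<union> E0"
  have E0_sub: "E0 \<subseteq> (X - X1) \<times> (Y - Y1)" using E0 by (simp add: biregular_def)
  have E1_in: "E1 `` {u} = Y1" if "u \<in> X1" for u using that E0_sub by (auto simp: E1_def)
  have E1_out: "E1 `` {u} = E0 `` {u}" if "u \<notin> X1" for u using that by (auto simp: E1_def)
  have E1_in': "E1\<inverse> `` {w} = X1" if "w \<in> Y1" for w using that E0_sub by (auto simp: E1_def)
  have E1_out': "E1\<inverse> `` {w} = E0\<inverse> `` {w}" if "w \<notin> Y1" for w using that by (auto simp: E1_def)
  have E1: "biregular X Y p q E1"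
    unfolding biregular_def
  proof (intro conjI ballI)
    show "E1 \<subseteq> X \<times> Y" using E0_sub X1 Y1 by (auto simp: E1_def)
    show "card (E1 `` {u}) = p" if "u \<in> X" for u
      using that E0 Y1 by (cases "u \<in> X1") (auto simp: E1_in E1_out biregular_def)
    show "card (E1\<inverse> `` {w}) = q" if "w \<in> Y" for w
      using that E0 X1 by (cases "w \<in> Y1") (auto simp: E1_in' E1_out' biregular_def)
  qed
  have two: "\<exists>a\<in>A. a \<noteq> c" if "2 \<le> card A" for A :: "'c set" and c
  proof (rule ccontr)
    assume "\<not> (\<exists>a\<in>A. a \<noteq> c)"
    then have "A \<subseteq> {c}" by blast
    then have "card A \<le> card {c}" by (intro card_mono) auto
    then show False using that by simp
  qed
  have "card X1 < card X" using q q2 X1(2) by linarith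
  then obtain x' where x': "x' \<in> X" "x' \<notin> X1" using X1 fin by (metis card_mono leD subsetI)
  obtain x where x: "x \<in> X1" using q X1 by fastforce
  obtain y where y: "y \<in> Y1" using p Y1 by fastforce
  obtain x1 where x1: "x1 \<in> X1" "x1 \<noteq> x" using two X1(2) q by metis
  obtain y1 where y1: "y1 \<in> Y1" "y1 \<noteq> y" using two Y1(2) p by metis
  have "card (E0 `` {x'}) = p" using E0 x' by (simp add: biregular_def)
  then obtain y' where y': "(x', y') \<in> E0" using p by (metis Image_singleton_iff card.empty ex_in_conv not_numeral_le_zero)
  obtain y2 where y2: "(x', y2) \<in> E0" "y2 \<noteq> y'" using two \<open>card (E0 `` {x'}) = p\<close> p by (metis Image_singleton_iff)
  have y'_out: "y' \<in> Y" "y' \<notin> Y1" "y2 \<notin> Y1" using y' y2 E0_sub by auto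
  \<comment> \<open>The switch leaves all degrees unchanged. The vertex \<open>x1\<close> keeps the
    neighbourhood \<open>Y1\<close>, which now overlaps those of \<open>x\<close> and
    \<open>x'\<close> without being equal to them, so neither of the two is full.\<close>
  define E2 where "E2 = (E1 - {(x, y), (x', y')}) \<union> {(x, y'), (x', y)}"
  have ne: "x \<noteq> x'" "y \<noteq> y'" using x x' y y'_out by auto
  have E2x: "E2 `` {x} = insert y' (Y1 - {y})"
    and E2x': "E2 `` {x'} = insert y (E0 `` {x'} - {y'})"
    using ne E1_in[OF x] E1_out[OF x'(2)] by (auto simp: E2_def)
  have E2u: "E2 `` {u} = E1 `` {u}" if "u \<noteq> x" "u \<noteq> x'" for u using that by (auto simp: E2_def)
  have E2y: "E2\<inverse> `` {y} = insert x' (X1 - {x})"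
    and E2y': "E2\<inverse> `` {y'} = insert x (E0\<inverse> `` {y'} - {x'})"
    using ne E1_in'[OF y] E1_out'[OF y'_out(2)] by (auto simp: E2_def)
  have E2w: "E2\<inverse> `` {w} = E1\<inverse> `` {w}" if "w \<noteq> y" "w \<noteq> y'" for w using that by (auto simp: E2_def)
  have E2: "biregular X Y p q E2"
    unfolding biregular_def
  proof (intro conjI ballI)
    show "E2 \<subseteq> X \<times> Y" using E1 x x' y y'_out X1 Y1 by (auto simp: E2_def biregular_def)
    have "finite E0" using E0_sub fin by (meson finite_Diff finite_SigmaI finite_subset)
    then have finI: "finite (E0 `` {x'})" "finite (E0\<inverse> `` {y'})" by (auto intro: finite_Image)
    show "card (E2 `` {u}) = p" if "u \<in> X" for u
    proof -
      have "card (insert y' (Y1 - {y})) = p" using card_swap[OF Y1(3) y y'_out(2)] Y1(2) by simp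
      moreover have "card (insert y (E0 `` {x'} - {y'})) = p"
        using card_swap[OF finI(1), of y' y] y' y E0_sub \<open>card (E0 `` {x'}) = p\<close> by auto
      moreover have "card (E1 `` {u}) = p" using E1 that by (simp add: biregular_def)
      ultimately show ?thesis using E2x E2x' E2u by metis
    qed
    show "card (E2\<inverse> `` {w}) = q" if "w \<in> Y" for w
    proof -
      have "card (insert x' (X1 - {x})) = q" using card_swap[OF X1(3) x x'(2)] X1(2) by simp
      moreover have "card (insert x (E0\<inverse> `` {y'} - {x'})) = q"
      proof -
        have "x' \<in> E0\<inverse> `` {y'}" "x \<notin> E0\<inverse> `` {y'}" using y' x E0_sub by auto
        moreover have "card (E0\<inverse> `` {y'}) = q" using E0 y'_out by (simp add: biregular_def)
        ultimately show ?thesis using card_swap[OF finI(2)] by simp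
      qed
      moreover have "card (E1\<inverse> `` {w}) = q" using E1 that by (simp add: biregular_def)
      ultimately show ?thesis using E2y E2y' E2w by metis
    qed
  qed
  have x1_ne: "x1 \<noteq> x'" using x1 x' by auto
  have E2x1: "E2 `` {x1} = Y1" using E2u[OF x1(2) x1_ne] E1_in[OF x1(1)] by simp
  have x_not: "x \<notin> full_vertices X E2"
  proof
    assume "x \<in> full_vertices X E2"
    moreover have "y1 \<in> E2 `` {x} \<inter> E2 `` {x1}" unfolding E2x E2x1 using y1 by blast
    ultimately have "E2 `` {x1} = E2 `` {x}" unfolding full_vertices_def by blast
    then show False unfolding E2x E2x1 using y'_out by blast
  qed
  have x'_not: "x' \<notin> full_vertices X E2"
  proof
    assume "x' \<in> full_vertices X E2"
    moreover have "y \<in> E2 `` {x'} \<inter> E2 `` {x1}" unfolding E2x' E2x1 using y by blast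
    ultimately have "E2 `` {x1} = E2 `` {x'}" unfolding full_vertices_def by blast
    moreover have "y2 \<in> E2 `` {x'}" unfolding E2x' using y2 by blast
    ultimately show False unfolding E2x1 using y'_out by blast
  qed
  have in_full: "u \<in> full_vertices X E1" if "u \<in> X1" for u
  proof -
    have "E1 `` {z} = Y1" if "Y1 \<inter> E1 `` {z} \<noteq> {}" for z
      using that E1_in E1_out E0_sub by (cases "z \<in> X1") auto
    then show ?thesis using that X1 E1_in[OF that] by (auto simp: full_vertices_def)
  qed
  \<comment> \<open>No vertex becomes full. A vertex \<open>u\<close> outside \<open>X1\<close>
    other than \<open>x'\<close> keeps its neighbourhood. If that met the neighbourhood of
    \<open>x'\<close> before the switch, it now meets that of \<open>x\<close> (when
    \<open>w = y'\<close>) or still that of \<open>x'\<close>; fullness in \<open>E2\<close> would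
    then bring \<open>y1\<close> or \<open>y\<close> into the neighbourhood of \<open>u\<close>,
    which avoids \<open>Y1\<close>.\<close>
  have sub: "full_vertices X E2 \<subseteq> full_vertices X E1"
  proof
    fix u assume u: "u \<in> full_vertices X E2"
    then have neq: "u \<noteq> x" "u \<noteq> x'" and uX: "u \<in> X" using x_not x'_not by (auto simp: full_vertices_def)
    show "u \<in> full_vertices X E1"
    proof (cases "u \<in> X1")
      case True then show ?thesis by (rule in_full)
    next
      case False
      have full: "E2 `` {z} = E2 `` {u}" if "w \<in> E2 `` {u}" "w \<in> E2 `` {z}" for z w
        using u that unfolding full_vertices_def by blast
      have Eu: "E2 `` {u} = E0 `` {u}" using E2u[OF neq] E1_out[OF False] by simp
      have "E1 `` {z} = E1 `` {u}" if w: "w \<in> E1 `` {u}" "w \<in> E1 `` {z}" for z w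
      proof -
        have wY: "w \<notin> Y1" using w(1) E1_out[OF False] E0_sub by auto
        then have z: "z \<notin> X1" using w(2) E1_in by blast
        have wu: "w \<in> E2 `` {u}" using w(1) E2u[OF neq] by simp
        show ?thesis
        proof (cases "z = x'")
          case True
          show ?thesis
          proof (cases "w = y'")
            case True
            then have "E2 `` {x} = E2 `` {u}" using full wu E2x by blast
            moreover have "y1 \<in> E2 `` {x}" using E2x y1 by blast
            ultimately show ?thesis using Eu y1 E0_sub by blast
          next
            case False
            then have "w \<in> E2 `` {x'}" using w(2) \<open>z = x'\<close> E1_out[OF x'(2)] E2x' by blast
            then have "E2 `` {x'} = E2 `` {u}" using full wu by blast
            moreover have "y \<in> E2 `` {x'}" using E2x' by blast
            ultimately show ?thesis using Eu y E0_sub by blast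
          qed
        next
          case False
          then have "E2 `` {z} = E1 `` {z}" using E2u z x by metis
          then show ?thesis using full[OF wu, of z] w(2) E2u[OF neq] by simp
        qed
      qed
      then show ?thesis using uX unfolding full_vertices_def by blast
    qed
  qed
  have "full_vertices X E2 \<subset> full_vertices X E1" using sub x_not in_full[OF x] by blast
  moreover have "finite (full_vertices X E1)" using fin by (simp add: full_vertices_def)
  ultimately have "card (full_vertices X E2) < card (full_vertices X E1)" by (rule psubset_card_mono[rotated])
  then show ?thesis using E1 E2 by (metis less_irrefl)
qed

section \<open>Degrees that determine a biregular graph\<close>

definition biregular_unique :: "'a set \<Rightarrow> 'b set \<Rightarrow> nat \<Rightarrow> nat \<Rightarrow> ('a \<times> 'b) set \<Rightarrow> bool" where
  "biregular_unique X Y p q E \<longleftrightarrow> biregular X Y p q E \<and>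
     (\<forall>E'. biregular X Y p q E' \<longrightarrow> (\<exists>f h. bij_betw f X X \<and> bij_betw h Y Y \<and>
        (\<forall>x\<in>X. \<forall>y\<in>Y. (x, y) \<in> E \<longleftrightarrow> (f x, h y) \<in> E')))"

lemma biregular_card_eq:
  assumes "finite X" "finite Y" "biregular X Y p q E"
  shows "card X * p = card Y * q"
proof -
  have E: "E \<subseteq> X \<times> Y" using assms(3) by (simp add: biregular_def)
  have "card X * p = (\<Sum>x\<in>X. card {y \<in> Y. (x, y) \<in> E})"
  proof -
    have "{y \<in> Y. (x, y) \<in> E} = E `` {x}" for x using E by auto
    then show ?thesis using assms(3) by (simp add: biregular_def)
  qed
  also have "\<dots> = (\<Sum>y\<in>Y. card {x \<in> X. (x, y) \<in> E})"
    by (rule sum_multicount_gen[symmetric, OF assms(2,1)]) auto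
  also have "\<dots> = card Y * q"
  proof -
    have "{x \<in> X. (x, y) \<in> E} = E\<inverse> `` {y}" for y using E by auto
    then show ?thesis using assms(3) by (simp add: biregular_def)
  qed
  finally show ?thesis .
qed

lemma biregular_complement:
  assumes "finite X" "finite Y" "biregular X Y p q E"
  shows "biregular X Y (card Y - p) (card X - q) (X \<times> Y - E)"
  unfolding biregular_def
proof (intro conjI ballI)
  have E: "E \<subseteq> X \<times> Y" using assms(3) by (simp add: biregular_def)
  show "card ((X \<times> Y - E) `` {x}) = card Y - p" if "x \<in> X" for x
  proof -
    have "(X \<times> Y - E) `` {x} = Y - E `` {x}" "E `` {x} \<subseteq> Y" using that E by auto
    then show ?thesis using assms that by (simp add: biregular_def card_Diff_subset finite_subset)
  qed
  show "card ((X \<times> Y - E)\<inverse> `` {y}) = card X - q" if "y \<in> Y" for y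
  proof -
    have "(X \<times> Y - E)\<inverse> `` {y} = X - E\<inverse> `` {y}" "E\<inverse> `` {y} \<subseteq> X" using that E by auto
    then show ?thesis using assms that by (simp add: biregular_def card_Diff_subset finite_subset)
  qed
qed blast

lemma biregular_unique_complement:
  assumes fin: "finite X" "finite Y" and un: "biregular_unique X Y p q E"
    and le: "p \<le> card Y" "q \<le> card X"
  shows "biregular_unique X Y (card Y - p) (card X - q) (X \<times> Y - E)"
  unfolding biregular_unique_def
proof (intro conjI allI impI)
  show "biregular X Y (card Y - p) (card X - q) (X \<times> Y - E)"
    using biregular_complement[OF fin] un by (simp add: biregular_unique_def)
  fix E' assume "biregular X Y (card Y - p) (card X - q) E'"
  then have "biregular X Y p q (X \<times> Y - E')"
    using biregular_complement[OF fin] le by fastforce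
  then obtain f h where fh: "bij_betw f X X" "bij_betw h Y Y"
    "\<forall>x\<in>X. \<forall>y\<in>Y. (x, y) \<in> E \<longleftrightarrow> (f x, h y) \<in> X \<times> Y - E'"
    using un unfolding biregular_unique_def by blast
  moreover have "f x \<in> X" if "x \<in> X" for x using fh(1) that by (auto simp: bij_betw_def)
  moreover have "h y \<in> Y" if "y \<in> Y" for y using fh(2) that by (auto simp: bij_betw_def)
  ultimately have "\<forall>x\<in>X. \<forall>y\<in>Y. (x, y) \<in> X \<times> Y - E \<longleftrightarrow> (f x, h y) \<in> E'" by auto
  then show "\<exists>f h. bij_betw f X X \<and> bij_betw h Y Y \<and>
      (\<forall>x\<in>X. \<forall>y\<in>Y. (x, y) \<in> X \<times> Y - E \<longleftrightarrow> (f x, h y) \<in> E')"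
    using fh(1,2) by blast
qed

text \<open>Otherwise uniqueness would make two graphs with different numbers of full vertices both
  isomorphic to \<open>E\<close>.\<close>

lemma biregular_unique_sparse:
  assumes fin: "finite X" "finite Y" and un: "biregular_unique X Y p q E"
    and "2 * p \<le> card Y"
  shows "p \<le> 1 \<or> q \<le> 1"
proof (rule ccontr)
  assume "\<not> (p \<le> 1 \<or> q \<le> 1)"
  moreover have "card X * p = card Y * q"
    using biregular_card_eq[OF fin] un by (auto simp: biregular_unique_def)
  ultimately obtain E1 E2 where E12: "biregular X Y p q E1" "biregular X Y p q E2"
    "card (full_vertices X E1) \<noteq> card (full_vertices X E2)"
    using biregular_not_unique[OF fin, of p q] assms(4) by auto
  have "card (full_vertices X E) = card (full_vertices X E')" if E': "biregular X Y p q E'" for E'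
  proof -
    obtain f h where fh: "bij_betw f X X" "bij_betw h Y Y" "\<forall>x\<in>X. \<forall>y\<in>Y. (x, y) \<in> E \<longleftrightarrow> (f x, h y) \<in> E'"
      using un E' unfolding biregular_unique_def by blast
    show ?thesis
      by (rule card_full_vertices_iso[OF _ _ fh(1,2)]) (use un E' fh(3) in \<open>auto simp: biregular_unique_def biregular_def\<close>)
  qed
  then show False using E12 by metis
qed

text \<open>Either \<open>p\<close> or \<open>card Y - p\<close> is at most half of
  \<open>card Y\<close>, so the sparse case applies to the graph or to its bipartite complement,
  which inherits uniqueness.\<close>

theorem biregular_unique_cases:
  assumes fin: "finite X" "finite Y" and un: "biregular_unique X Y p q E"
    and le: "p < card Y" "q < card X"
  shows "p \<le> 1 \<or> q \<le> 1 \<or> card Y - p = 1 \<or> card X - q = 1"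
proof (cases "2 * p \<le> card Y")
  case True
  then show ?thesis using biregular_unique_sparse[OF fin un] by blast
next
  case False
  then have "card Y - p \<le> 1 \<or> card X - q \<le> 1"
    using biregular_unique_sparse[OF fin biregular_unique_complement[OF fin un]] le by simp
  then show ?thesis using le by linarith
qed

section \<open>Relabelling relations on a finite set\<close>

definition relabel :: "('a \<Rightarrow> 'a) \<Rightarrow> 'a rel \<Rightarrow> 'a rel" where
  "relabel \<tau> Q = {(x, y). (\<tau> x, \<tau> y) \<in> Q}"

text \<open>The closed walk \<open>a\<close>, \<open>u\<close>, \<open>b\<close>, \<open>w\<close>
  uses pairs alternately inside and outside \<open>Q\<close>. Exchanging \<open>a\<close> with
  \<open>b\<close>, or \<open>u\<close> with \<open>w\<close>, exchanges the two kinds.\<close>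

definition alternating :: "'a rel \<Rightarrow> 'a \<Rightarrow> 'a \<Rightarrow> 'a \<Rightarrow> 'a \<Rightarrow> bool" where
  "alternating Q a b u w \<longleftrightarrow> distinct [a, b, u, w] \<and>
     (a, u) \<in> Q \<and> (b, w) \<in> Q \<and> (a, w) \<notin> Q \<and> (b, u) \<notin> Q"

lemma permutes_extend:
  assumes "finite Y" "S \<subseteq> Y" "f ` S \<subseteq> Y" "inj_on f S"
  shows "\<exists>\<sigma>. \<sigma> permutes Y \<and> (\<forall>x\<in>S. \<sigma> x = f x)"
proof -
  have "card (Y - S) = card (Y - f ` S)"
    using assms by (simp add: card_Diff_subset card_image finite_subset)
  then obtain g where g: "bij_betw g (Y - S) (Y - f ` S)"
    using finite_same_card_bij[of "Y - S" "Y - f ` S"] assms(1) by blast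
  define \<sigma> where "\<sigma> x = (if x \<in> S then f x else if x \<in> Y then g x else x)" for x
  have "bij_betw \<sigma> S (f ` S)"
    using assms(4) by (simp add: bij_betw_def \<sigma>_def inj_on_def image_def)
  moreover have "bij_betw \<sigma> (Y - S) (Y - f ` S)"
    using g by (rule bij_betw_cong[THEN iffD1, rotated]) (simp add: \<sigma>_def)
  ultimately have "bij_betw \<sigma> (S \<union> (Y - S)) (f ` S \<union> (Y - f ` S))"
    by (rule bij_betw_combine) blast
  moreover have "S \<union> (Y - S) = Y" "f ` S \<union> (Y - f ` S) = Y" using assms by auto
  ultimately have "\<sigma> permutes Y"
    using assms(2) by (auto intro!: bij_imp_permutes simp: \<sigma>_def)
  then show ?thesis by (auto simp: \<sigma>_def)
qed

text \<open>
  After moving an alternating quadruple of \<open>Q\<^sub>1\<close> onto one of \<open>Q\<^sub>2\<close>, the second difference of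
  \<open>\<tau> \<mapsto> card (relabel \<tau> Q\<^sub>1 \<inter> Q\<^sub>2)\<close> along the transpositions \<open>(a b)\<close> and \<open>(u w)\<close> is positive.
\<close>

lemma relabel_Int_not_constant:
  assumes fin: "finite Y" and Q1: "Q1 \<subseteq> Y \<times> Y" "sym Q1" and Q2: "Q2 \<subseteq> Y \<times> Y" "sym Q2"
    and alt1: "alternating Q1 a1 b1 u1 w1" and alt2: "alternating Q2 a b u w"
  shows "\<not> (\<forall>\<tau>. \<tau> permutes Y \<longrightarrow> card (relabel \<tau> Q1 \<inter> Q2) = c)"
proof
  assume const: "\<forall>\<tau>. \<tau> permutes Y \<longrightarrow> card (relabel \<tau> Q1 \<inter> Q2) = c"
  have d1: "distinct [a1, b1, u1, w1]" and d2: "distinct [a, b, u, w]"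
    using alt1 alt2 by (auto simp: alternating_def)
  have in1: "{a1, b1, u1, w1} \<subseteq> Y" and in2: "{a, b, u, w} \<subseteq> Y"
    using alt1 alt2 Q1(1) Q2(1) unfolding alternating_def by blast+
  obtain \<sigma> where \<sigma>: "\<sigma> permutes Y" "\<sigma> a = a1" "\<sigma> b = b1" "\<sigma> u = u1" "\<sigma> w = w1"
  proof -
    define f where "f = id(a := a1, b := b1, u := u1, w := w1)"
    have f: "f a = a1" "f b = b1" "f u = u1" "f w = w1" using d2 by (simp_all add: f_def)
    then have "f ` {a, b, u, w} = {a1, b1, u1, w1}" by simp
    moreover have "card {a1, b1, u1, w1} = 4" "card {a, b, u, w} = 4"
      using distinct_card[OF d1] distinct_card[OF d2] by simp_all
    ultimately have fY: "f ` {a, b, u, w} \<subseteq> Y" and cf: "card (f ` {a, b, u, w}) = card {a, b, u, w}"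
      using in1 by (simp_all only:)
    have "inj_on f {a, b, u, w}" by (rule eq_card_imp_inj_on[OF _ cf]) simp
    from permutes_extend[OF fin in2 fY this]
    obtain \<sigma> where "\<sigma> permutes Y" "\<forall>x\<in>{a, b, u, w}. \<sigma> x = f x" by blast
    then show ?thesis using that f by simp
  qed
  \<comment> \<open>On the quadruple of \<open>Q2\<close>, the relations \<open>F\<close> and
    \<open>Q2\<close> now contain the same pairs between \<open>{a, b}\<close> and
    \<open>{u, w}\<close>.\<close>
  define F where "F = relabel \<sigma> Q1"
  have F: "(a, u) \<in> F" "(b, w) \<in> F" "(a, w) \<notin> F" "(b, u) \<notin> F"
    using alt1 \<sigma> by (auto simp: F_def relabel_def alternating_def)
  have "sym F" using Q1(2) by (auto simp: F_def relabel_def sym_def)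
  then have F': "(u, a) \<in> F" "(w, b) \<in> F" "(w, a) \<notin> F" "(u, b) \<notin> F"
    using F by (auto dest: symD)
  have Q: "(a, u) \<in> Q2" "(b, w) \<in> Q2" "(a, w) \<notin> Q2" "(b, u) \<notin> Q2"
    using alt2 by (auto simp: alternating_def)
  have Q': "(u, a) \<in> Q2" "(w, b) \<in> Q2" "(w, a) \<notin> Q2" "(u, b) \<notin> Q2"
    using Q Q2(2) by (auto dest: symD)
  have neq: "a \<noteq> b" "b \<noteq> a" "a \<noteq> u" "u \<noteq> a" "a \<noteq> w" "w \<noteq> a" "b \<noteq> u" "u \<noteq> b" "b \<noteq> w" "w \<noteq> b" "u \<noteq> w" "w \<noteq> u"
    using d2 by auto
  define s where "s = transpose a b"
  define t where "t = transpose u w"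
  have s: "s a = b" "s b = a" "s x = x" if "x \<noteq> a" "x \<noteq> b" for x
    using that by (auto simp: s_def)
  have t: "t u = w" "t w = u" "t x = x" if "x \<noteq> u" "x \<noteq> w" for x
    using that by (auto simp: t_def)
  have st: "s permutes Y" "t permutes Y"
    using in2 by (auto simp: s_def t_def intro!: permutes_swap_id)
  define I :: "'a rel \<Rightarrow> 'a \<Rightarrow> 'a \<Rightarrow> int" where "I R x y = of_bool ((x, y) \<in> R)" for R x y
  define N :: "('a \<Rightarrow> 'a) \<Rightarrow> int" where
    "N \<tau> = (\<Sum>(x, y)\<in>Y \<times> Y. I Q2 x y * I F (\<tau> x) (\<tau> y))" for \<tau>
  have N: "N \<tau> = int c" if "\<tau> permutes Y" for \<tau>
  proof -
    have "relabel \<tau> F = relabel (\<sigma> \<circ> \<tau>) Q1" by (auto simp: F_def relabel_def)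
    then have "card (relabel \<tau> F \<inter> Q2) = c"
      using const permutes_compose[OF that \<sigma>(1)] by simp
    moreover have "N \<tau> = (\<Sum>z\<in>Y \<times> Y. of_bool (z \<in> relabel \<tau> F \<inter> Q2))"
      unfolding N_def by (rule sum.cong) (auto simp: I_def relabel_def)
    moreover have "\<dots> = int (card (relabel \<tau> F \<inter> Q2))"
    proof -
      have "Y \<times> Y \<inter> (relabel \<tau> F \<inter> Q2) = relabel \<tau> F \<inter> Q2" using Q2(1) by auto
      then show ?thesis using fin by (simp add: sum_of_bool_eq Int_def)
    qed
    ultimately show ?thesis by simp
  qed
  \<comment> \<open>The second difference at a single pair. With a constant overlap, its total over
    \<open>Q2\<close> would be \<open>c - c - c + c = 0\<close>.\<close>
  define D where "D x y = I F x y - I F (s x) (s y) - I F (t x) (t y) + I F (s (t x)) (s (t y))" for x y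
  have "N id - N s - N t + N (s \<circ> t) = 0"
    using N[OF permutes_id] N[OF st(1)] N[OF st(2)] N[OF permutes_compose[OF st(2,1)]] by simp
  moreover have "N id - N s - N t + N (s \<circ> t) = (\<Sum>(x, y)\<in>Y \<times> Y. I Q2 x y * D x y)"
    unfolding N_def D_def by (simp add: sum_subtractf[symmetric] sum.distrib[symmetric] split_beta algebra_simps)
  moreover have "(\<Sum>(x, y)\<in>Y \<times> Y. I Q2 x y * D x y) > 0"
  proof (rule sum_pos2)
    show "finite (Y \<times> Y)" using fin by simp
    show "(a, u) \<in> Y \<times> Y" using in2 by simp
    show "0 < (case (a, u) of (x, y) \<Rightarrow> I Q2 x y * D x y)"
      using F Q neq by (simp add: D_def I_def s_def t_def transpose_def)
    fix z assume "z \<in> Y \<times> Y"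
    obtain x y where z: "z = (x, y)" by fastforce
    \<comment> \<open>Between \<open>{a, b}\<close> and \<open>{u, w}\<close> the value of
      \<open>D\<close> is 2 on pairs in \<open>F\<close> and -2 on the others, which lie outside
      \<open>Q2\<close>. Elsewhere the four terms cancel.\<close>
    have "I Q2 x y * D x y = (if (x, y) \<in> {(a, u), (u, a), (b, w), (w, b)} then 2 else 0)"
    proof -
      consider "x = a" | "x = b" | "x = u" | "x = w" | "x \<notin> {a, b, u, w}" by blast
      then show ?thesis
      proof cases
        case 1
        consider "y = a" | "y = b" | "y = u" | "y = w" | "y \<notin> {a, b, u, w}" by blast
        then show ?thesis using 1 F F' Q Q' neq by cases (simp_all add: D_def I_def s_def t_def transpose_def)
      next
        case 2
        consider "y = a" | "y = b" | "y = u" | "y = w" | "y \<notin> {a, b, u, w}" by blast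
        then show ?thesis using 2 F F' Q Q' neq by cases (simp_all add: D_def I_def s_def t_def transpose_def)
      next
        case 3
        consider "y = a" | "y = b" | "y = u" | "y = w" | "y \<notin> {a, b, u, w}" by blast
        then show ?thesis using 3 F F' Q Q' neq by cases (simp_all add: D_def I_def s_def t_def transpose_def)
      next
        case 4
        consider "y = a" | "y = b" | "y = u" | "y = w" | "y \<notin> {a, b, u, w}" by blast
        then show ?thesis using 4 F F' Q Q' neq by cases (simp_all add: D_def I_def s_def t_def transpose_def)
      next
        case 5
        then have "s x = x" "t x = x" by (auto simp: s_def t_def transpose_def)
        moreover have "t y = y \<or> s y = y \<and> s (t y) = t y"
          using neq by (cases "y \<in> {u, w}") (auto simp: s_def t_def transpose_def)
        ultimately have "D x y = 0" by (auto simp: D_def)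
        then show ?thesis using 5 by auto
      qed
    qed
    then show "0 \<le> (case z of (x, y) \<Rightarrow> I Q2 x y * D x y)" by (simp add: z)
  qed
  ultimately show False by simp
qed

text \<open>Take nonadjacent \<open>u\<close> and \<open>b\<close> and a neighbour \<open>a\<close>
  of \<open>u\<close>. Of \<open>a\<close> and \<open>b\<close>, which have equal degree, only
  \<open>a\<close> is adjacent to \<open>u\<close>, so some \<open>w\<close> is adjacent only to
  \<open>b\<close>. Deleting \<open>a\<close> and \<open>b\<close> from each other's neighbourhoods
  accounts for a possible edge between them.\<close>

lemma regular_alternating:
  assumes fin: "finite Y" and Q: "Q \<subseteq> Y \<times> Y" "sym Q" "irrefl Q"
    and reg: "\<And>x. x \<in> Y \<Longrightarrow> card (nbrs Q x Y) = d"
    and edge: "Q \<noteq> {}" and nonedge: "x0 \<in> Y" "y0 \<in> Y" "x0 \<noteq> y0" "(x0, y0) \<notin> Q"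
  shows "\<exists>a b u w. alternating Q a b u w"
proof -
  have fin_n: "finite (nbrs Q x Y)" for x using fin by (simp add: nbrs_def)
  have irr: "(x, x) \<notin> Q" for x using Q(3) by (simp add: irrefl_def)
  obtain e1 e2 where e: "(e1, e2) \<in> Q" using edge by auto
  then have "e2 \<in> nbrs Q e1 Y" "e1 \<in> Y" using Q(1) by (auto simp: nbrs_def)
  then have d_pos: "0 < d" using reg[of e1] fin_n[of e1] by (metis card_gt_0_iff empty_iff)
  define u where "u = x0"
  have u: "u \<in> Y" using nonedge by (simp add: u_def)
  obtain a where a: "a \<in> nbrs Q u Y" using d_pos reg[OF u] by (metis card.empty ex_in_conv less_irrefl)
  define b where "b = y0"
  have b: "b \<in> Y" "b \<noteq> u" "(b, u) \<notin> Q" using nonedge Q(2) by (auto simp: b_def u_def dest: symD)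
  have a': "a \<in> Y" "(u, a) \<in> Q" "(a, u) \<in> Q" using a Q(2) by (auto simp: nbrs_def dest: symD)
  have ab: "a \<noteq> b" "a \<noteq> u" using a'(3) b(3) irr by auto
  have "\<exists>w. w \<in> nbrs Q b Y - {a} \<and> w \<notin> nbrs Q a Y - {b}"
  proof (rule ccontr)
    assume "\<not> ?thesis"
    then have "nbrs Q b Y - {a} \<subseteq> nbrs Q a Y - {b}" by blast
    moreover have "u \<in> nbrs Q a Y - {b}" "u \<notin> nbrs Q b Y - {a}" using a'(3) b u by (auto simp: nbrs_def)
    ultimately have "nbrs Q b Y - {a} \<subset> nbrs Q a Y - {b}" by blast
    then have "card (nbrs Q b Y - {a}) < card (nbrs Q a Y - {b})"
      using fin_n by (intro psubset_card_mono) auto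
    moreover have "card (nbrs Q b Y) = card (nbrs Q a Y)" using reg a' b by simp
    moreover have "a \<in> nbrs Q b Y \<longleftrightarrow> b \<in> nbrs Q a Y" using a' b Q(2) by (auto simp: nbrs_def dest: symD)
    ultimately show False using fin_n by (cases "a \<in> nbrs Q b Y") (auto simp: card_Diff_singleton)
  qed
  then obtain w where w: "w \<in> Y" "(b, w) \<in> Q" "w \<noteq> a" "(a, w) \<notin> Q" by (auto simp: nbrs_def irr)
  then have "alternating Q a b u w" using ab a' b irr by (auto simp: alternating_def)
  then show ?thesis by blast
qed

text \<open>Some relabelling makes the two matchings agree everywhere; one further transposition
  breaks the agreement, since \<open>k\<close> is injective.\<close>

lemma matching_relabel_not_constant:
  assumes fin: "finite Y" and two: "2 \<le> card Y" and h: "bij_betw h Y Z" and k: "bij_betw k Y Z"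
  shows "\<not> (\<forall>\<tau>. \<tau> permutes Y \<longrightarrow> card {y \<in> Y. h (\<tau> y) = k y} = c)"
proof
  assume const: "\<forall>\<tau>. \<tau> permutes Y \<longrightarrow> card {y \<in> Y. h (\<tau> y) = k y} = c"
  define \<tau> where "\<tau> y = (if y \<in> Y then inv_into Y h (k y) else y)" for y
  have "bij_betw (inv_into Y h \<circ> k) Y Y" using bij_betw_trans[OF k bij_betw_inv_into[OF h]] .
  then have "bij_betw \<tau> Y Y" by (rule bij_betw_cong[THEN iffD1, rotated]) (simp add: \<tau>_def)
  then have \<tau>: "\<tau> permutes Y" by (rule bij_imp_permutes) (simp add: \<tau>_def)
  have h\<tau>: "h (\<tau> y) = k y" if "y \<in> Y" for y
    using that h k by (auto simp: \<tau>_def bij_betw_def intro!: f_inv_into_f)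
  then have "{y \<in> Y. h (\<tau> y) = k y} = Y" by blast
  then have c: "c = card Y" using const \<tau> by metis
  obtain y1 y2 where y: "y1 \<in> Y" "y2 \<in> Y" "y1 \<noteq> y2"
    using two by (metis card_2_iff' obtain_subset_with_card_n subsetD)
  let ?\<tau>' = "\<tau> \<circ> transpose y1 y2"
  have "?\<tau>' permutes Y" using permutes_compose[OF permutes_swap_id[OF y(1,2)] \<tau>] .
  then have "card {y \<in> Y. h (?\<tau>' y) = k y} = card Y" using const c by metis
  then have "{y \<in> Y. h (?\<tau>' y) = k y} = Y" using fin by (metis (no_types, lifting) card_subset_eq mem_Collect_eq subsetI)
  then have "h (?\<tau>' y1) = k y1" using y(1) by blast
  then have "k y2 = k y1" using h\<tau>[OF y(2)] by simp
  then show False using k y by (auto simp: bij_betw_def inj_on_def)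
qed

section \<open>Structures on the cells of a rigid partition\<close>

context rigid_partition
begin

lemma cell_sub: "X \<in> P \<Longrightarrow> X \<subseteq> V" and cell_finite: "X \<in> P \<Longrightarrow> finite X"
  and cell_nonempty: "X \<in> P \<Longrightarrow> X \<noteq> {}"
  using partition finite_V by (auto simp: partition_on_def intro: finite_subset)

lemma cell_disjoint: "\<lbrakk>X \<in> P; Y \<in> P; u \<in> X; u \<in> Y\<rbrakk> \<Longrightarrow> X = Y"
  using partition by (auto simp: partition_on_def disjoint_def)

lemma E_sym: "(u, v) \<in> E \<longleftrightarrow> (v, u) \<in> E"
  using sym_E by (auto dest: symD)

definition aniso :: "'a set \<Rightarrow> 'a set \<Rightarrow> bool" where
  "aniso X Y \<longleftrightarrow> X \<in> P \<and> Y \<in> P \<and> X \<noteq> Y \<and> E \<inter> X \<times> Y \<noteq> {} \<and> \<not> X \<times> Y \<subseteq> E"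

lemma aniso_sym: "aniso X Y \<longleftrightarrow> aniso Y X"
proof -
  have "E \<inter> X \<times> Y \<noteq> {} \<longleftrightarrow> E \<inter> Y \<times> X \<noteq> {}" "X \<times> Y \<subseteq> E \<longleftrightarrow> Y \<times> X \<subseteq> E"
    using E_sym by auto
  then show ?thesis by (auto simp: aniso_def)
qed

definition cell_map :: "('a \<Rightarrow> 'a) \<Rightarrow> bool" where
  "cell_map f \<longleftrightarrow> f permutes V \<and> (\<forall>X\<in>P. f ` X = X)"

lemma cell_map_in: "\<lbrakk>cell_map f; X \<in> P\<rbrakk> \<Longrightarrow> u \<in> X \<Longrightarrow> f u \<in> X"
  by (auto simp: cell_map_def)

lemma cell_map_inj: "cell_map f \<Longrightarrow> f u = f v \<longleftrightarrow> u = v"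
  by (meson cell_map_def permutes_inj injD)

lemma cell_map_comp: "\<lbrakk>cell_map f; cell_map g\<rbrakk> \<Longrightarrow> cell_map (g \<circ> f)"
  unfolding cell_map_def by (metis image_comp permutes_compose)

lemma cell_map_permutes_cell:
  assumes "Y \<in> P" "\<tau> permutes Y"
  shows "cell_map \<tau>"
  unfolding cell_map_def
proof (intro conjI ballI)
  show "\<tau> permutes V" using assms cell_sub permutes_subset by blast
  fix X assume X: "X \<in> P"
  show "\<tau> ` X = X"
  proof (cases "X = Y")
    case True
    then show ?thesis using assms permutes_image by blast
  next
    case False
    then have "\<tau> x = x" if "x \<in> X" for x
      using that X assms cell_disjoint by (metis permutes_not_in)
    then show ?thesis by simp
  qed
qed

text \<open>Isomorphisms obtained from an altered graph respect \<open>E\<close> only off the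
  altered blocks; \<open>S\<close> lists the ordered pairs of cells on which they are known to
  respect it.\<close>

definition preserves :: "('a \<Rightarrow> 'a) \<Rightarrow> ('a set \<times> 'a set) set \<Rightarrow> bool" where
  "preserves f S \<longleftrightarrow> (\<forall>(C, D)\<in>S. \<forall>u\<in>C. \<forall>v\<in>D. (u, v) \<in> E \<longleftrightarrow> (f u, f v) \<in> E)"

lemma rigid':
  assumes E': "E' \<subseteq> V \<times> V" "sym E'" "irrefl E'"
    and deg: "\<And>X Y u. \<lbrakk>X \<in> P; Y \<in> P; u \<in> X\<rbrakk> \<Longrightarrow> card (nbrs E' u Y) = card (nbrs E u Y)"
  obtains f where "cell_map f" "\<And>u v. \<lbrakk>u \<in> V; v \<in> V\<rbrakk> \<Longrightarrow> (u, v) \<in> E \<longleftrightarrow> (f u, f v) \<in> E'"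
proof -
  have "\<exists>f. f permutes V \<and> (\<forall>X\<in>P. f ` X = X) \<and> (\<forall>u\<in>V. \<forall>v\<in>V. (u, v) \<in> E \<longleftrightarrow> (f u, f v) \<in> E')"
    by (rule rigid[OF E']) (rule deg)
  then obtain f where f: "f permutes V" "\<forall>X\<in>P. f ` X = X"
    "\<forall>u\<in>V. \<forall>v\<in>V. (u, v) \<in> E \<longleftrightarrow> (f u, f v) \<in> E'" by (elim exE conjE)
  show thesis by (rule that[of f]) (use f in \<open>simp_all add: cell_map_def\<close>)
qed

text \<open>Putting any \<open>B\<close> with the same degrees in place of the block keeps every
  degree into every cell, and the isomorphism given by rigidity restricts to one of the blocks. The
  strict bounds come from an edge and a nonedge between the cells.\<close>

lemma aniso_biregular:
  assumes an: "aniso X Y"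
  obtains p q where "biregular_unique X Y p q (E \<inter> X \<times> Y)" "0 < p" "p < card Y" "0 < q" "q < card X"
proof -
  have XP: "X \<in> P" and YP: "Y \<in> P" and XY: "X \<noteq> Y" using an by (auto simp: aniso_def)
  note fin = cell_finite[OF XP] cell_finite[OF YP]
  obtain x0 y0 where e: "(x0, y0) \<in> E" "x0 \<in> X" "y0 \<in> Y" using an by (auto simp: aniso_def)
  obtain x1 y1 where ne: "(x1, y1) \<notin> E" "x1 \<in> X" "y1 \<in> Y" using an by (auto simp: aniso_def)
  define p where "p = card (nbrs E x0 Y)"
  define q where "q = card (nbrs E y0 X)"
  have p: "card (nbrs E x Y) = p" if "x \<in> X" for x using equitable[OF XP YP that e(2)] by (simp add: p_def)
  have q: "card (nbrs E y X) = q" if "y \<in> Y" for y using equitable[OF YP XP that e(3)] by (simp add: q_def)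
  have im: "(E \<inter> X \<times> Y) `` {x} = nbrs E x Y" if "x \<in> X" for x using that by (auto simp: nbrs_def)
  have im': "(E \<inter> X \<times> Y)\<inverse> `` {y} = nbrs E y X" if "y \<in> Y" for y
    using that E_sym by (auto simp: nbrs_def)
  have "biregular X Y p q (E \<inter> X \<times> Y)" using p q by (simp add: biregular_def im im')
  moreover have "\<exists>f h. bij_betw f X X \<and> bij_betw h Y Y \<and>
      (\<forall>x\<in>X. \<forall>y\<in>Y. (x, y) \<in> E \<inter> X \<times> Y \<longleftrightarrow> (f x, h y) \<in> B)" if B: "biregular X Y p q B" for B
  proof -
    have Bs: "B \<subseteq> X \<times> Y" using B by (simp add: biregular_def)
    define E' where "E' = (E - X \<times> Y - Y \<times> X) \<union> B \<union> B\<inverse>"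
    have XYd: "X \<inter> Y = {}" using cell_disjoint XP YP XY by blast
    have E'_XY: "nbrs E' x Y = B `` {x}" if "x \<in> X" for x
      using that XYd Bs by (auto simp: E'_def nbrs_def)
    have E'_YX: "nbrs E' y X = B\<inverse> `` {y}" if "y \<in> Y" for y
      using that XYd Bs by (auto simp: E'_def nbrs_def)
    have E'_other: "nbrs E' u D = nbrs E u D"
      if "C \<in> P" "D \<in> P" "u \<in> C" "(C, D) \<noteq> (X, Y)" "(C, D) \<noteq> (Y, X)" for C D u
    proof -
      have "\<not> (u \<in> X \<and> w \<in> Y)" "\<not> (u \<in> Y \<and> w \<in> X)" if "w \<in> D" for w
        using \<open>C \<in> P\<close> \<open>D \<in> P\<close> \<open>u \<in> C\<close> that \<open>(C, D) \<noteq> (X, Y)\<close> \<open>(C, D) \<noteq> (Y, X)\<close> XP YP cell_disjoint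
        by blast+
      then show ?thesis using Bs by (auto simp: E'_def nbrs_def)
    qed
    obtain f where f: "cell_map f" "\<And>u v. \<lbrakk>u \<in> V; v \<in> V\<rbrakk> \<Longrightarrow> (u, v) \<in> E \<longleftrightarrow> (f u, f v) \<in> E'"
    proof (rule rigid')
      show "E' \<subseteq> V \<times> V" using E_sub Bs cell_sub[OF XP] cell_sub[OF YP] by (auto simp: E'_def)
      show "sym E'" using sym_E by (auto simp: E'_def sym_def)
      show "irrefl E'" using irrefl_E Bs XYd by (auto simp: E'_def irrefl_def)
      show "card (nbrs E' u D) = card (nbrs E u D)" if "C \<in> P" "D \<in> P" "u \<in> C" for C D u
      proof -
        consider "C = X" "D = Y" | "C = Y" "D = X" | "(C, D) \<noteq> (X, Y)" "(C, D) \<noteq> (Y, X)" by blast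
        then show ?thesis
          using that B p q E'_XY E'_YX E'_other by cases (auto simp: biregular_def)
      qed
    qed blast
    have inj: "inj_on f A" for A using f(1) by (auto simp: cell_map_def intro: permutes_inj_on)
    have "bij_betw f X X" "bij_betw f Y Y" using f(1) XP YP inj by (auto simp: bij_betw_def cell_map_def)
    moreover have "(x, y) \<in> E \<inter> X \<times> Y \<longleftrightarrow> (f x, f y) \<in> B" if xy: "x \<in> X" "y \<in> Y" for x y
    proof -
      have "(x, y) \<in> E \<longleftrightarrow> (f x, f y) \<in> E'" using f(2) xy cell_sub XP YP by blast
      moreover have "f x \<in> X" "f y \<in> Y" using cell_map_in f(1) XP YP xy by auto
      then have "(f x, f y) \<in> E' \<longleftrightarrow> (f x, f y) \<in> B" using XYd Bs by (auto simp: E'_def)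
      ultimately show ?thesis using xy by auto
    qed
    ultimately show ?thesis by blast
  qed
  ultimately have "biregular_unique X Y p q (E \<inter> X \<times> Y)" by (simp add: biregular_unique_def)
  moreover have "0 < p" using e fin p[of x0] by (auto simp: nbrs_def card_gt_0_iff)
  moreover have "0 < q" using e fin q[of y0] E_sym by (auto simp: nbrs_def card_gt_0_iff)
  moreover have "p < card Y"
    using ne fin p[of x1] psubset_card_mono[of Y "nbrs E x1 Y"] by (auto simp: nbrs_def)
  moreover have "q < card X"
    using ne fin q[of y1] psubset_card_mono[of X "nbrs E y1 X"] E_sym by (auto simp: nbrs_def)
  ultimately show ?thesis using that by blast
qed

text \<open>The smaller side \<open>X\<close> of an anisotropic pair carries the centres of the stars.\<close>

lemma aniso_star:
  assumes an: "aniso X Y" and le: "card X \<le> card Y"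
  obtains t F where "F = E \<inter> X \<times> Y \<or> F = X \<times> Y - E" "biregular X Y t 1 F" "1 \<le> t"
    "card Y = card X * t" "2 \<le> card X"
proof -
  have XP: "X \<in> P" and YP: "Y \<in> P" using an by (auto simp: aniso_def)
  note fin = cell_finite[OF XP] cell_finite[OF YP]
  obtain p q where un: "biregular_unique X Y p q (E \<inter> X \<times> Y)" and
    b: "0 < p" "p < card Y" "0 < q" "q < card X"
    using aniso_biregular[OF an] .
  \<comment> \<open>If \<open>p' = 1\<close>, then \<open>card X = card Y * q'\<close> and
    \<open>card X \<le> card Y\<close> force \<open>q' = 1\<close>. So degree one on either side
    means stars centred in \<open>X\<close>.\<close>
  have one: "\<exists>t F. (F = E \<inter> X \<times> Y \<or> F = X \<times> Y - E) \<and> biregular X Y t 1 F \<and> 1 \<le> t \<and>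
      card Y = card X * t \<and> 2 \<le> card X" if F: "F = E \<inter> X \<times> Y \<or> F = X \<times> Y - E" "biregular X Y p' q' F" "0 < p'" "0 < q'" "p' = 1 \<or> q' = 1"
    for F p' q'
  proof -
    have eq: "card X * p' = card Y * q'" by (rule biregular_card_eq[OF fin F(2)])
    have "q' = 1"
    proof (cases "p' = 1")
      case True
      then have "card Y * q' \<le> card Y * 1" using eq le by simp
      then show ?thesis using F(4) b(2) by (simp only: mult_le_cancel1) linarith
    qed (use F(5) in blast)
    then have "biregular X Y p' 1 F" "1 \<le> p'" "card Y = card X * p'" "2 \<le> card X" using F eq b by auto
    then show ?thesis using F(1) by blast
  qed
  have bi: "biregular X Y p q (E \<inter> X \<times> Y)" using un by (simp add: biregular_unique_def)
  have "X \<times> Y - E \<inter> X \<times> Y = X \<times> Y - E" by blast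
  then have bi': "biregular X Y (card Y - p) (card X - q) (X \<times> Y - E)"
    using biregular_complement[OF fin bi] by simp
  consider "p = 1 \<or> q = 1" | "card Y - p = 1 \<or> card X - q = 1"
    using biregular_unique_cases[OF fin un b(2,4)] b by linarith
  then have "\<exists>t F. (F = E \<inter> X \<times> Y \<or> F = X \<times> Y - E) \<and> biregular X Y t 1 F \<and> 1 \<le> t \<and>
      card Y = card X * t \<and> 2 \<le> card X"
  proof cases
    case 1
    then show ?thesis by (intro one[OF _ bi b(1,3)]) auto
  next
    case 2
    then show ?thesis using b by (intro one[OF _ bi']) auto
  qed
  then show thesis using that by blast
qed

text \<open>The competitor is \<open>E\<close> with the block \<open>XY\<close> pulled back along
  \<open>\<tau>\<close>. Hence \<open>f\<close> respects \<open>E\<close> on all other blocks, and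
  \<open>\<tau> \<circ> f\<close> respects it on this one. The case \<open>X = Y\<close> relabels
  the graph inside a cell; if \<open>X \<noteq> Y\<close>, then \<open>\<tau>\<close> fixes
  \<open>X\<close> pointwise.\<close>

lemma perturb_block:
  assumes XP: "X \<in> P" and YP: "Y \<in> P" and \<tau>: "\<tau> permutes Y"
  obtains f where "cell_map f" "preserves (\<tau> \<circ> f) {(X, Y), (Y, X)}"
    "\<And>S. \<lbrakk>S \<subseteq> P \<times> P; (X, Y) \<notin> S; (Y, X) \<notin> S\<rbrakk> \<Longrightarrow> preserves f S"
proof -
  note \<tau>m = cell_map_permutes_cell[OF YP \<tau>]
  define B where "B = X \<times> Y \<union> Y \<times> X"
  define E' where "E' = {(u, v). if (u, v) \<in> B then (\<tau> u, \<tau> v) \<in> E else (u, v) \<in> E}"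
  have B_sym: "(u, v) \<in> B \<longleftrightarrow> (v, u) \<in> B" for u v by (auto simp: B_def)
  have B_cells: "(u, v) \<in> B \<longleftrightarrow> (C, D) \<in> {(X, Y), (Y, X)}"
    if "C \<in> P" "D \<in> P" "u \<in> C" "v \<in> D" for u v C D
    using that XP YP cell_disjoint by (auto simp: B_def)
  obtain f where f: "cell_map f" "\<And>u v. \<lbrakk>u \<in> V; v \<in> V\<rbrakk> \<Longrightarrow> (u, v) \<in> E \<longleftrightarrow> (f u, f v) \<in> E'"
  proof (rule rigid')
    show "E' \<subseteq> V \<times> V" using E_sub cell_sub[OF XP] cell_sub[OF YP] by (auto simp: E'_def B_def split: if_splits)
    show "sym E'" using B_sym E_sym by (auto simp: E'_def sym_def)
    show "irrefl E'" using irrefl_E by (auto simp: E'_def irrefl_def)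
    show "card (nbrs E' u D) = card (nbrs E u D)" if CD: "C \<in> P" "D \<in> P" "u \<in> C" for C D u
    proof (cases "(C, D) \<in> {(X, Y), (Y, X)}")
      case True
      have "nbrs E' u D = {w \<in> D. (\<tau> u, \<tau> w) \<in> E}" using B_cells[OF CD] True by (auto simp: nbrs_def E'_def)
      moreover have "\<tau> ` {w \<in> D. (\<tau> u, \<tau> w) \<in> E} = {w \<in> \<tau> ` D. (\<tau> u, w) \<in> E}" by blast
      moreover have "\<tau> ` D = D" using \<tau>m CD(2) by (simp add: cell_map_def)
      ultimately have "\<tau> ` nbrs E' u D = nbrs E (\<tau> u) D" by (simp add: nbrs_def)
      then have "card (nbrs E' u D) = card (nbrs E (\<tau> u) D)"
        using card_image[OF permutes_inj_on[OF \<tau>], of "nbrs E' u D"] by simp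
      also have "\<dots> = card (nbrs E u D)" by (rule equitable[OF CD(1,2) cell_map_in[OF \<tau>m CD(1,3)] CD(3)])
      finally show ?thesis .
    next
      case False
      then have "(u, w) \<notin> B" if "w \<in> D" for w using B_cells[OF CD that] by blast
      then have "nbrs E' u D = nbrs E u D" by (auto simp: nbrs_def E'_def)
      then show ?thesis by simp
    qed
  qed blast
  have f_pres: "(u, v) \<in> E \<longleftrightarrow> (if (C, D) \<in> {(X, Y), (Y, X)} then (\<tau> (f u), \<tau> (f v)) \<in> E else (f u, f v) \<in> E)"
    if "C \<in> P" "D \<in> P" "u \<in> C" "v \<in> D" for u v C D
  proof -
    have "u \<in> V" "v \<in> V" using that cell_sub by auto
    moreover have "f u \<in> C" "f v \<in> D" using that cell_map_in f(1) by auto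
    ultimately show ?thesis using f(2) B_cells[OF that(1,2), of "f u" "f v"] by (simp add: E'_def)
  qed
  show thesis
  proof
    show "cell_map f" by (rule f(1))
    show "preserves (\<tau> \<circ> f) {(X, Y), (Y, X)}"
      using f_pres XP YP by (auto simp: preserves_def)
    fix S assume S: "S \<subseteq> P \<times> P" "(X, Y) \<notin> S" "(Y, X) \<notin> S"
    show "preserves f S"
      unfolding preserves_def
    proof (clarify)
      fix C D u v assume "(C, D) \<in> S" "u \<in> C" "v \<in> D"
      moreover have "C \<in> P" "D \<in> P" "(C, D) \<notin> {(X, Y), (Y, X)}" using S \<open>(C, D) \<in> S\<close> by auto
      ultimately show "(u, v) \<in> E \<longleftrightarrow> (f u, f v) \<in> E" using f_pres[of C D u v] by (auto split: if_splits)
    qed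
  qed
qed

text \<open>
  A nontrivial relation on the cell \<open>Y\<close> that can be read off from the blocks of \<open>E\<close> in \<open>S\<close>.
\<close>

definition cell_structure :: "('a set \<times> 'a set) set \<Rightarrow> 'a set \<Rightarrow> 'a rel \<Rightarrow> bool" where
  "cell_structure S Y Q \<longleftrightarrow> S \<subseteq> P \<times> P \<and> Y \<in> P \<and> Q \<subseteq> Y \<times> Y \<and> sym Q \<and>
     (\<exists>a b u w. alternating Q a b u w) \<and>
     (\<forall>f. cell_map f \<longrightarrow> preserves f S \<longrightarrow> (\<forall>u\<in>Y. \<forall>v\<in>Y. (u, v) \<in> Q \<longleftrightarrow> (f u, f v) \<in> Q))"

text \<open>Relabel the block of \<open>Q1\<close> by \<open>\<tau>\<close>. The isomorphism
  \<open>f\<close> takes \<open>Q1\<close> to its relabelling and, as no block of \<open>S\<close>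
  was touched, \<open>Q2\<close> to itself, so the number of common pairs would be the same for all
  \<open>\<tau>\<close>.\<close>

lemma independent_structures_conflict:
  assumes Q1: "cell_structure {(X, Y), (Y, X)} Y Q1" and Q2: "cell_structure S Y Q2"
    and S: "(X, Y) \<notin> S" "(Y, X) \<notin> S"
  shows False
proof -
  have XY: "X \<in> P" "Y \<in> P" and SP: "S \<subseteq> P \<times> P" using Q1 Q2 by (auto simp: cell_structure_def)
  have sub: "Q1 \<subseteq> Y \<times> Y" "Q2 \<subseteq> Y \<times> Y" using Q1 Q2 by (auto simp: cell_structure_def)
  have "card (relabel \<tau> Q1 \<inter> Q2) = card (Q1 \<inter> Q2)" if \<tau>: "\<tau> permutes Y" for \<tau>
  proof -
    obtain f where f: "cell_map f" "preserves (\<tau> \<circ> f) {(X, Y), (Y, X)}" "preserves f S"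
      using perturb_block[OF XY \<tau>] S SP by metis
    have \<tau>f: "cell_map (\<tau> \<circ> f)" by (rule cell_map_comp[OF f(1) cell_map_permutes_cell[OF XY(2) \<tau>]])
    have 1: "(u, v) \<in> Q1 \<longleftrightarrow> (f u, f v) \<in> relabel \<tau> Q1" if "u \<in> Y" "v \<in> Y" for u v
      using Q1 \<tau>f f(2) that by (auto simp: cell_structure_def relabel_def)
    have 2: "(u, v) \<in> Q2 \<longleftrightarrow> (f u, f v) \<in> Q2" if "u \<in> Y" "v \<in> Y" for u v
      using Q2 f that by (auto simp: cell_structure_def)
    have fY: "f ` Y = Y" using f(1) XY by (auto simp: cell_map_def)
    have "map_prod f f ` (Q1 \<inter> Q2) = relabel \<tau> Q1 \<inter> Q2"
    proof (intro subset_antisym subsetI)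
      fix z assume "z \<in> map_prod f f ` (Q1 \<inter> Q2)"
      then show "z \<in> relabel \<tau> Q1 \<inter> Q2" using 1 2 sub by auto
    next
      fix z assume z: "z \<in> relabel \<tau> Q1 \<inter> Q2"
      then have "fst z \<in> f ` Y" "snd z \<in> f ` Y" using sub fY by auto
      then obtain u v where "u \<in> Y" "v \<in> Y" "z = (f u, f v)" by (metis imageE prod.collapse)
      then show "z \<in> map_prod f f ` (Q1 \<inter> Q2)" using z 1 2 by force
    qed
    moreover have "inj_on (map_prod f f) (Q1 \<inter> Q2)"
      using f(1) by (auto simp: inj_on_def cell_map_inj)
    ultimately show ?thesis by (metis card_image)
  qed
  moreover obtain a1 b1 u1 w1 where "alternating Q1 a1 b1 u1 w1" using Q1 by (auto simp: cell_structure_def)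
  moreover obtain a b u w where "alternating Q2 a b u w" using Q2 by (auto simp: cell_structure_def)
  moreover have "sym Q1" "sym Q2" using Q1 Q2 by (auto simp: cell_structure_def)
  ultimately show False using relabel_Int_not_constant[OF cell_finite[OF XY(2)] sub(1) _ sub(2)] by metis
qed

definition hetero :: "'a set \<Rightarrow> bool" where
  "hetero Y \<longleftrightarrow> Y \<in> P \<and> E \<inter> Y \<times> Y \<noteq> {} \<and> (\<exists>x\<in>Y. \<exists>y\<in>Y. x \<noteq> y \<and> (x, y) \<notin> E)"

lemma hetero_structure:
  assumes "hetero Y"
  shows "cell_structure {(Y, Y)} Y (E \<inter> Y \<times> Y)"
proof -
  have YP: "Y \<in> P" using assms by (simp add: hetero_def)
  obtain x0 y0 where 0: "x0 \<in> Y" "y0 \<in> Y" "x0 \<noteq> y0" "(x0, y0) \<notin> E" using assms by (auto simp: hetero_def)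
  have "nbrs (E \<inter> Y \<times> Y) x Y = nbrs E x Y" if "x \<in> Y" for x using that by (auto simp: nbrs_def)
  then have "card (nbrs (E \<inter> Y \<times> Y) x Y) = card (nbrs E x0 Y)" if "x \<in> Y" for x
    using equitable[OF YP YP that 0(1)] that by simp
  moreover have sym: "sym (E \<inter> Y \<times> Y)" using E_sym by (auto simp: sym_def)
  moreover have "irrefl (E \<inter> Y \<times> Y)" using irrefl_E by (auto simp: irrefl_def)
  moreover have "E \<inter> Y \<times> Y \<noteq> {}" using assms by (simp add: hetero_def)
  ultimately have "\<exists>a b u w. alternating (E \<inter> Y \<times> Y) a b u w"
    using regular_alternating[OF cell_finite[OF YP], of "E \<inter> Y \<times> Y" _ x0 y0] 0 by blast
  moreover have "(u, v) \<in> E \<inter> Y \<times> Y \<longleftrightarrow> (f u, f v) \<in> E \<inter> Y \<times> Y"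
    if "cell_map f" "preserves f {(Y, Y)}" "u \<in> Y" "v \<in> Y" for f u v
    using that cell_map_in[OF that(1) YP] by (auto simp: preserves_def)
  ultimately show ?thesis using YP sym by (auto simp: cell_structure_def)
qed

text \<open>Related vertices are leaves of the same star. Since \<open>card X < card Y\<close>,
  every star has at least two leaves, and there are at least two stars; two leaves of each of two
  stars alternate. Equality of neighbourhoods expresses this for a star forest and for its
  complement alike.\<close>

lemma sibling_structure:
  assumes an: "aniso X Y" and less: "card X < card Y"
  shows "cell_structure {(X, Y), (Y, X)} Y {(y, y') \<in> Y \<times> Y. nbrs E y X = nbrs E y' X}"
    (is "cell_structure _ _ ?Q")
proof -
  have XP: "X \<in> P" and YP: "Y \<in> P" using an by (auto simp: aniso_def)
  obtain t F where F: "F = E \<inter> X \<times> Y \<or> F = X \<times> Y - E" "biregular X Y t 1 F" "1 \<le> t"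
    "card Y = card X * t" "2 \<le> card X"
    by (rule aniso_star[OF an less_imp_le[OF less]])
  have t: "2 \<le> t" using F(3,4) less by (cases "t = 1") auto
  have Fsub: "F \<subseteq> X \<times> Y" using F(2) by (simp add: biregular_def)
  have eq: "nbrs E y X = nbrs E y' X \<longleftrightarrow> F\<inverse> `` {y} = F\<inverse> `` {y'}" if y: "y \<in> Y" "y' \<in> Y" for y y'
    using F(1)
  proof
    assume "F = E \<inter> X \<times> Y"
    then have "nbrs E z X = F\<inverse> `` {z}" if "z \<in> Y" for z using that E_sym by (auto simp: nbrs_def)
    then show ?thesis using y by simp
  next
    assume F_eq: "F = X \<times> Y - E"
    have "nbrs E z X = X - F\<inverse> `` {z}" "F\<inverse> `` {z} \<subseteq> X" if "z \<in> Y" for z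
      using that E_sym Fsub unfolding F_eq by (auto simp: nbrs_def)
    then show ?thesis using y by (metis double_diff subset_refl)
  qed
  obtain x1 x2 where x: "x1 \<in> X" "x2 \<in> X" "x1 \<noteq> x2"
  proof -
    obtain T where "T \<subseteq> X" "card T = 2" using F(5) by (rule obtain_subset_with_card_n)
    then show ?thesis using that by (auto simp: card_2_iff)
  qed
  have children: "\<exists>a u. a \<noteq> u \<and> (x, a) \<in> F \<and> (x, u) \<in> F" if "x \<in> X" for x
  proof -
    have "2 \<le> card (F `` {x})" using that F(2) t by (simp add: biregular_def)
    then obtain T where "T \<subseteq> F `` {x}" "card T = 2" by (rule obtain_subset_with_card_n)
    then show ?thesis by (auto simp: card_2_iff)
  qed
  obtain a u where au: "a \<noteq> u" "(x1, a) \<in> F" "(x1, u) \<in> F" using children x by blast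
  obtain b w where bw: "b \<noteq> w" "(x2, b) \<in> F" "(x2, w) \<in> F" using children x by blast
  have par: "F\<inverse> `` {y} = {x}" if "(x, y) \<in> F" for x y
  proof -
    have "y \<in> Y" using that Fsub by auto
    then have "card (F\<inverse> `` {y}) = 1" using F(2) by (simp add: biregular_def)
    then obtain z where "F\<inverse> `` {y} = {z}" by (rule card_1_singletonE)
    moreover have "x \<in> F\<inverse> `` {y}" using that by blast
    ultimately show ?thesis by simp
  qed
  note pars = par[OF au(2)] par[OF au(3)] par[OF bw(2)] par[OF bw(3)]
  have in_Y: "a \<in> Y" "u \<in> Y" "b \<in> Y" "w \<in> Y" using au bw Fsub by auto
  have "(a, u) \<in> ?Q" "(b, w) \<in> ?Q" "(a, w) \<notin> ?Q" "(b, u) \<notin> ?Q"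
    using in_Y x(3) by (simp_all add: eq pars)
  moreover have "distinct [a, b, u, w]" using au(1) bw(1) x(3) pars by auto
  ultimately have "alternating ?Q a b u w" unfolding alternating_def by blast
  moreover have "(u, v) \<in> ?Q \<longleftrightarrow> (f u, f v) \<in> ?Q"
    if f: "cell_map f" "preserves f {(X, Y), (Y, X)}" and uv: "u \<in> Y" "v \<in> Y" for f u v
  proof -
    have "nbrs E (f y) X = f ` nbrs E y X" if "y \<in> Y" for y
    proof -
      have fX: "f ` X = X" using f(1) XP by (simp add: cell_map_def)
      have "nbrs E (f y) X = {w \<in> f ` X. (f y, w) \<in> E}" unfolding fX by (simp add: nbrs_def)
      also have "\<dots> = f ` {w \<in> X. (f y, f w) \<in> E}" by blast
      also have "{w \<in> X. (f y, f w) \<in> E} = nbrs E y X"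
        using f(2) that by (auto simp: nbrs_def preserves_def)
      finally show ?thesis .
    qed
    moreover have "inj f" using f(1) by (auto simp: cell_map_def permutes_inj)
    ultimately show ?thesis using uv cell_map_in[OF f(1) YP] by (auto simp: inj_image_eq_iff)
  qed
  moreover have "sym ?Q" by (auto simp: sym_def)
  ultimately show ?thesis using XP YP unfolding cell_structure_def by blast
qed

section \<open>Paths of equally large cells\<close>

definition plateau :: "'a set list \<Rightarrow> bool" where
  "plateau zs \<longleftrightarrow> zs \<noteq> [] \<and> distinct zs \<and> set zs \<subseteq> P \<and> successively aniso zs \<and>
     (\<forall>X\<in>set zs. card X = card (hd zs))"

text \<open>Stars between equally large cells have one leaf each, so they form a perfect matching
  \<open>h\<close>. As \<open>h\<close> can be read off from the block, it commutes with every cell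
  map that respects the block.\<close>

lemma aniso_equal_bij:
  assumes an: "aniso Y Z" and eq: "card Y = card Z"
  shows "\<exists>h. bij_betw h Y Z \<and>
    (\<forall>f. cell_map f \<longrightarrow> preserves f {(Y, Z)} \<longrightarrow> (\<forall>y\<in>Y. h (f y) = f (h y)))"
proof -
  have YP: "Y \<in> P" and ZP: "Z \<in> P" using an by (auto simp: aniso_def)
  obtain t F where F: "F = E \<inter> Y \<times> Z \<or> F = Y \<times> Z - E" "biregular Y Z t 1 F"
    "card Z = card Y * t" "2 \<le> card Y"
    by (rule aniso_star[OF an eq_imp_le[OF eq]])
  have t: "t = 1" using F(3,4) eq by simp
  have Fsub: "F \<subseteq> Y \<times> Z" using F(2) by (simp add: biregular_def)
  define h where "h y = (THE z. (y, z) \<in> F)" for y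
  have h: "(y, z) \<in> F \<longleftrightarrow> z = h y" if "y \<in> Y" for y z
  proof -
    have "card (F `` {y}) = 1" using F(2) that t by (simp add: biregular_def)
    then obtain z0 where "F `` {y} = {z0}" by (auto simp: card_1_singleton_iff)
    then have "(y, z) \<in> F \<longleftrightarrow> z = z0" for z by auto
    then show ?thesis by (simp add: h_def)
  qed
  have hZ: "h y \<in> Z" if "y \<in> Y" for y using h[OF that] Fsub by blast
  have "bij_betw h Y Z"
  proof (rule bij_betw_imageI)
    show inj: "inj_on h Y"
    proof (rule inj_onI)
      fix y y' assume y: "y \<in> Y" "y' \<in> Y" "h y = h y'"
      have "card (F\<inverse> `` {h y}) = 1" using F(2) hZ[OF y(1)] by (simp add: biregular_def)
      moreover have "y \<in> F\<inverse> `` {h y}" "y' \<in> F\<inverse> `` {h y}" using h y by auto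
      ultimately show "y = y'" by (metis card_1_singletonE singletonD)
    qed
    show "h ` Y = Z"
    proof (rule card_subset_eq[OF cell_finite[OF ZP]])
      show "h ` Y \<subseteq> Z" using hZ by blast
      show "card (h ` Y) = card Z" using card_image[OF inj] eq by simp
    qed
  qed
  moreover have "h (f y) = f (h y)" if f: "cell_map f" "preserves f {(Y, Z)}" and y: "y \<in> Y" for f y
  proof -
    have fy: "f y \<in> Y" "f (h y) \<in> Z" using cell_map_in[OF f(1)] YP ZP y hZ[OF y] by auto
    have "(y, h y) \<in> E \<longleftrightarrow> (f y, f (h y)) \<in> E" using f(2) y hZ[OF y] by (auto simp: preserves_def)
    moreover have "(y, h y) \<in> F" using h[OF y] by simp
    ultimately have "(f y, f (h y)) \<in> F" using F(1) fy y hZ[OF y] by auto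
    then show ?thesis using h[OF fy(1)] by simp
  qed
  ultimately show ?thesis by blast
qed

abbreviation steps :: "'b list \<Rightarrow> ('b \<times> 'b) set" where
  "steps zs \<equiv> set (zip zs (tl zs))"

lemma in_stepsD: "(x, y) \<in> steps zs \<Longrightarrow> x \<in> set zs \<and> y \<in> set zs"
  by (cases zs) (auto dest: set_zip_leftD set_zip_rightD)

lemma preserves_mono: "\<lbrakk>preserves f S; T \<subseteq> S\<rbrakk> \<Longrightarrow> preserves f T"
  unfolding preserves_def by blast

lemma plateau_bij:
  assumes "plateau zs"
  shows "\<exists>h. bij_betw h (hd zs) (last zs) \<and>
    (\<forall>f. cell_map f \<longrightarrow> preserves f (steps zs) \<longrightarrow> (\<forall>y\<in>hd zs. h (f y) = f (h y)))"
  using assms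
proof (induction zs)
  case (Cons Y zs)
  show ?case
  proof (cases zs)
    case Nil
    then show ?thesis by (auto intro!: exI[of _ id])
  next
    case (Cons Z zs')
    have pl: "plateau zs" using Cons.prems Cons by (auto simp: plateau_def)
    obtain h where h: "bij_betw h Z (last zs)"
      "\<And>f. \<lbrakk>cell_map f; preserves f (steps zs)\<rbrakk> \<Longrightarrow> \<forall>y\<in>Z. h (f y) = f (h y)"
      using Cons.IH[OF pl] Cons by auto
    have an: "aniso Y Z" "card Y = card Z" using Cons.prems Cons by (auto simp: plateau_def)
    obtain k where k: "bij_betw k Y Z"
      "\<And>f. \<lbrakk>cell_map f; preserves f {(Y, Z)}\<rbrakk> \<Longrightarrow> \<forall>y\<in>Y. k (f y) = f (k y)"
      using aniso_equal_bij[OF an] by blast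
    have "bij_betw (h \<circ> k) Y (last zs)" using bij_betw_trans[OF k(1) h(1)] .
    moreover have "(h \<circ> k) (f y) = f ((h \<circ> k) y)"
      if f: "cell_map f" "preserves f (steps (Y # zs))" and y: "y \<in> Y" for f y
    proof -
      have "preserves f {(Y, Z)}" "preserves f (steps zs)"
        using Cons by (auto intro!: preserves_mono[OF f(2)])
      then have "k (f y) = f (k y)" "h (f (k y)) = f (h (k y))"
        using h(2) k(2) f(1) y bij_betwE[OF k(1)] by auto
      then show ?thesis by simp
    qed
    ultimately show ?thesis using Cons by auto
  qed
qed (simp add: plateau_def)

text \<open>The relation is pulled back along the composed matchings; the price is that maps must
  also respect the blocks in \<open>steps zs\<close>.\<close>

lemma structure_along_plateau:
  assumes zs: "plateau zs" and Q: "cell_structure S (last zs) Q"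
  shows "\<exists>Q'. cell_structure (S \<union> steps zs) (hd zs) Q'"
proof -
  let ?Y = "hd zs" and ?Z = "last zs"
  obtain h where h: "bij_betw h ?Y ?Z"
    "\<And>f. \<lbrakk>cell_map f; preserves f (steps zs)\<rbrakk> \<Longrightarrow> \<forall>y\<in>?Y. h (f y) = f (h y)"
    using plateau_bij[OF zs] by blast
  have P: "?Y \<in> P" "?Z \<in> P" "set zs \<subseteq> P" using zs by (auto simp: plateau_def)
  define Q' where "Q' = {(y, y') \<in> ?Y \<times> ?Y. (h y, h y') \<in> Q}"
  have Qsub: "Q \<subseteq> ?Z \<times> ?Z" "sym Q" "S \<subseteq> P \<times> P" using Q by (auto simp: cell_structure_def)
  have hZ: "?Z = h ` ?Y" "inj_on h ?Y" using h(1) by (auto simp: bij_betw_def)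
  have "\<exists>a b u w. alternating Q' a b u w"
  proof -
    obtain a b u w where alt: "alternating Q a b u w" using Q by (auto simp: cell_structure_def)
    then have "a \<in> h ` ?Y" "b \<in> h ` ?Y" "u \<in> h ` ?Y" "w \<in> h ` ?Y"
      using Qsub(1) hZ(1) by (auto simp: alternating_def)
    then obtain a' b' u' w' where *: "a' \<in> ?Y" "b' \<in> ?Y" "u' \<in> ?Y" "w' \<in> ?Y"
      "a = h a'" "b = h b'" "u = h u'" "w = h w'" by (elim imageE)
    then have "alternating Q' a' b' u' w'" using alt by (auto simp: alternating_def Q'_def)
    then show ?thesis by blast
  qed
  moreover have "steps zs \<subseteq> P \<times> P"
    using P(3) in_stepsD[of _ _ zs] by auto
  moreover have "sym Q'" using Qsub(2) by (auto simp: Q'_def sym_def)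
  moreover have "(u, v) \<in> Q' \<longleftrightarrow> (f u, f v) \<in> Q'"
    if f: "cell_map f" "preserves f (S \<union> steps zs)" and uv: "u \<in> ?Y" "v \<in> ?Y" for f u v
  proof -
    have "preserves f S" "preserves f (steps zs)" by (auto intro: preserves_mono[OF f(2)])
    then have "(h u, h v) \<in> Q \<longleftrightarrow> (f (h u), f (h v)) \<in> Q" "h (f u) = f (h u)" "h (f v) = f (h v)"
      using Q h f(1) uv bij_betwE[OF h(1)] by (auto simp: cell_structure_def)
    then show ?thesis using uv cell_map_in[OF f(1) P(1)] by (auto simp: Q'_def)
  qed
  ultimately have "cell_structure (S \<union> steps zs) ?Y Q'"
    using P Qsub unfolding cell_structure_def by (auto simp: Q'_def)
  then show ?thesis by blast
qed

text \<open>The two sources of a relation on \<open>Y\<close>. Treating a heterogeneous cell as its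
  own anchor lets both sources occupy the block \<open>(X, Y)\<close>.\<close>

definition anchor :: "'a set \<Rightarrow> 'a set \<Rightarrow> bool" where
  "anchor X Y \<longleftrightarrow> X = Y \<and> hetero Y \<or> aniso X Y \<and> card X < card Y"

lemma anchor_structure: "anchor X Y \<Longrightarrow> \<exists>Q. cell_structure {(X, Y), (Y, X)} Y Q"
  using hetero_structure[of Y] sibling_structure[of X Y] unfolding anchor_def by (elim disjE) auto

lemma steps_neq:
  assumes "distinct zs" "(x, y) \<in> steps zs"
  shows "x \<noteq> y"
proof -
  obtain i where "i < length (tl zs)" "x = zs ! i" "y = tl zs ! i"
    using assms(2) unfolding set_zip by auto
  moreover from this have "y = zs ! Suc i" "Suc i < length zs" by (simp_all add: nth_tl)
  ultimately show ?thesis using nth_eq_iff_index_eq[OF assms(1), of i "Suc i"] by simp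
qed

text \<open>Each anchor puts a relation on its end of the plateau. After the second has been moved
  to the first end, the two rest on different blocks, which is impossible. On a plateau with one
  cell the anchors have to differ, since otherwise one block would be counted twice.\<close>

lemma two_anchors_conflict:
  assumes zs: "plateau zs" and X: "anchor X (hd zs)" and X': "anchor X' (last zs)"
    and neq: "2 \<le> length zs \<or> X \<noteq> X'"
  shows False
proof -
  let ?Y = "hd zs" and ?Z = "last zs"
  have ne: "zs \<noteq> []" and dist: "distinct zs" and card: "\<And>C. C \<in> set zs \<Longrightarrow> card C = card ?Y"
    using zs unfolding plateau_def by blast+
  obtain Q where Q: "cell_structure {(X, ?Y), (?Y, X)} ?Y Q" using anchor_structure[OF X] by blast
  obtain Q' where "cell_structure {(X', ?Z), (?Z, X')} ?Z Q'" using anchor_structure[OF X'] by blast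
  then obtain Q'' where Q'': "cell_structure ({(X', ?Z), (?Z, X')} \<union> steps zs) ?Y Q''"
    using structure_along_plateau[OF zs] by blast
  \<comment> \<open>All plateau cells have the same size, so a strictly smaller anchor lies off the
    plateau.\<close>
  have out: "C \<notin> set zs \<or> C = D" if "anchor C D" "D \<in> set zs" for C D
    using that card unfolding anchor_def by (metis less_irrefl)
  have YZ: "?Y \<in> set zs" "?Z \<in> set zs" using ne by auto
  have "?Y \<noteq> ?Z" if "2 \<le> length zs"
    using that dist by (cases zs) (auto split: if_splits)
  moreover have "?Y = ?Z" if "\<not> 2 \<le> length zs"
    using that ne by (cases zs; cases "tl zs") auto
  ultimately have "(X, ?Y) \<notin> {(X', ?Z), (?Z, X')}" "(?Y, X) \<notin> {(X', ?Z), (?Z, X')}"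
    using neq out[OF X YZ(1)] out[OF X' YZ(2)] YZ by (metis insertE prod.inject singletonD)+
  moreover have "(X, ?Y) \<notin> steps zs" "(?Y, X) \<notin> steps zs"
    using out[OF X YZ(1)] in_stepsD steps_neq[OF dist] by metis+
  ultimately show False using independent_structures_conflict[OF Q Q''] by blast
qed

text \<open>The closing block and the path give two matchings from the first to the last cell.
  Relabelling the closing block leaves the path intact, so the number of their agreements could not
  change, against \<open>matching_relabel_not_constant\<close>.\<close>

lemma plateau_cycle_conflict:
  assumes zs: "plateau zs" and len: "3 \<le> length zs" and an: "aniso (last zs) (hd zs)"
  shows False
proof -
  let ?Y = "hd zs" and ?Z = "last zs"
  have ne: "zs \<noteq> []" and dist: "distinct zs" and card: "\<And>C. C \<in> set zs \<Longrightarrow> card C = card ?Y"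
    and sub: "set zs \<subseteq> P"
    using zs unfolding plateau_def by blast+
  have eq: "card ?Y = card ?Z" using card[of ?Z] ne by simp
  have YP: "?Y \<in> P" "?Z \<in> P" "?Y \<noteq> ?Z" using an by (auto simp: aniso_def)
  obtain h where h: "bij_betw h ?Y ?Z"
    "\<And>f. \<lbrakk>cell_map f; preserves f {(?Y, ?Z)}\<rbrakk> \<Longrightarrow> \<forall>y\<in>?Y. h (f y) = f (h y)"
    using aniso_equal_bij[OF an[unfolded aniso_sym[of ?Z]] eq] by blast
  obtain k where k: "bij_betw k ?Y ?Z"
    "\<And>f. \<lbrakk>cell_map f; preserves f (steps zs)\<rbrakk> \<Longrightarrow> \<forall>y\<in>?Y. k (f y) = f (k y)"
    using plateau_bij[OF zs] by blast
  obtain x y zs' where zs_eq: "zs = x # y # zs'" "zs' \<noteq> []"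
  proof -
    have "zs = hd zs # hd (tl zs) # tl (tl zs) \<and> tl (tl zs) \<noteq> []"
      using len by (cases zs; cases "tl zs"; auto)
    then show ?thesis using that by blast
  qed
  \<comment> \<open>With at least three cells, the closing pair does not occur among the consecutive
    ones.\<close>
  have "(?Y, ?Z) \<notin> steps zs" "(?Z, ?Y) \<notin> steps zs"
  proof -
    have "last zs' \<in> set zs'" using zs_eq by simp
    then show "(?Y, ?Z) \<notin> steps zs" using dist zs_eq by (auto dest: set_zip_leftD set_zip_rightD)
    show "(?Z, ?Y) \<notin> steps zs" using dist zs_eq by (auto dest!: set_zip_leftD set_zip_rightD)
  qed
  moreover have "steps zs \<subseteq> P \<times> P" using in_stepsD[of _ _ zs] sub by auto
  ultimately have steps: "steps zs \<subseteq> P \<times> P" "(?Z, ?Y) \<notin> steps zs" "(?Y, ?Z) \<notin> steps zs" by auto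
  have "card {y \<in> ?Y. h (\<tau> y) = k y} = card {y \<in> ?Y. h y = k y}" if \<tau>: "\<tau> permutes ?Y" for \<tau>
  proof -
    obtain f where f: "cell_map f" "preserves (\<tau> \<circ> f) {(?Z, ?Y), (?Y, ?Z)}" "preserves f (steps zs)"
      using perturb_block[OF YP(2,1) \<tau>] steps by metis
    have \<tau>f: "cell_map (\<tau> \<circ> f)" by (rule cell_map_comp[OF f(1) cell_map_permutes_cell[OF YP(1) \<tau>]])
    have *: "h (\<tau> (f y)) = k (f y) \<longleftrightarrow> h y = k y" if y: "y \<in> ?Y" for y
    proof -
      have hy: "h y \<in> ?Z" using bij_betwE[OF h(1)] y by simp
      have "preserves (\<tau> \<circ> f) {(?Y, ?Z)}" by (rule preserves_mono[OF f(2)]) blast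
      then have "h (\<tau> (f y)) = \<tau> (f (h y))" using h(2)[OF \<tau>f] y by simp
      also have "\<dots> = f (h y)"
        using \<tau> cell_map_in[OF f(1) YP(2) hy] YP cell_disjoint by (metis permutes_not_in)
      finally have "h (\<tau> (f y)) = f (h y)" .
      moreover have "k (f y) = f (k y)" using k(2)[OF f(1,3)] y by simp
      ultimately show ?thesis using cell_map_inj[OF f(1)] by simp
    qed
    have fY: "f ` ?Y = ?Y" using f(1) YP by (auto simp: cell_map_def)
    have "{y \<in> ?Y. h (\<tau> y) = k y} = {y \<in> f ` ?Y. h (\<tau> y) = k y}" unfolding fY ..
    also have "\<dots> = f ` {y \<in> ?Y. h (\<tau> (f y)) = k (f y)}" by blast
    also have "{y \<in> ?Y. h (\<tau> (f y)) = k (f y)} = {y \<in> ?Y. h y = k y}" using * by blast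
    finally have "{y \<in> ?Y. h (\<tau> y) = k y} = f ` {y \<in> ?Y. h y = k y}" .
    moreover have "inj_on f {y \<in> ?Y. h y = k y}" using f(1) by (auto simp: cell_map_def permutes_inj_on)
    ultimately show ?thesis by (simp add: card_image)
  qed
  moreover have "2 \<le> card ?Y" using aniso_star[of ?Y ?Z] an eq aniso_sym by (metis order_refl)
  ultimately show False using matching_relabel_not_constant[OF cell_finite[OF YP(1)] _ h(1) k(1)] by blast
qed

end

section \<open>Anisotropic components\<close>

text \<open>Common initial vertices are dropped by induction. Where the paths part, the first later
  vertex \<open>w\<close> of one that also lies on the other closes a cycle.\<close>

lemma unique_simple_path:
  assumes sym: "\<And>x y. R x y \<Longrightarrow> R y x"
    and no_cycle: "\<And>zs. \<lbrakk>distinct zs; 3 \<le> length zs; successively R zs; R (last zs) (hd zs)\<rbrakk> \<Longrightarrow> False"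
  shows "\<lbrakk>distinct p; distinct q; successively R p; successively R q; p \<noteq> []; q \<noteq> [];
    hd p = hd q; last p = last q\<rbrakk> \<Longrightarrow> p = q"
proof (induction p arbitrary: q)
  case (Cons s p')
  obtain q' where q: "q = s # q'" using Cons.prems by (cases q) auto
  show ?case
  proof (cases "p' = [] \<or> q' = []")
    case True
    then show ?thesis using Cons.prems q last_in_set[of p'] last_in_set[of q'] by (auto split: if_splits)
  next
    case False
    have dist: "distinct p'" "distinct q'" "s \<notin> set p'" "s \<notin> set q'"
      using Cons.prems q by auto
    have succ: "successively R p'" "successively R q'" "R s (hd p')" "R s (hd q')"
      using Cons.prems q False by (auto simp: successively_Cons)
    have last: "last p' = last q'" using Cons.prems q False by simp
    show ?thesis
    proof (cases "hd p' = hd q'")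
      case True
      then show ?thesis using Cons.IH[of q'] dist succ last False q by simp
    next
      case neq: False
      have "last p' \<in> set p'" "last p' \<in> set q'" using last False last_in_set by metis+
      then obtain xs w p2 where p': "p' = xs @ w # p2" "w \<in> set q'" "\<forall>x\<in>set xs. x \<notin> set q'"
        using split_list_first_prop[of p' "\<lambda>x. x \<in> set q'"] by blast
      obtain ys q2 where q': "q' = ys @ w # q2" using p'(2) by (meson split_list)
      \<comment> \<open>Out along \<open>xs\<close> to \<open>w\<close> and back along
        \<open>ys\<close>. As the paths part after \<open>s\<close>, the lists \<open>xs\<close> and
        \<open>ys\<close> are not both empty, so the cycle has at least three vertices.\<close>
      let ?c = "s # xs @ w # rev ys"
      have "distinct ?c" using dist p' q' by auto
      moreover have "xs \<noteq> [] \<or> ys \<noteq> []" using neq p' q' by auto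
      then have "3 \<le> length ?c" by (cases xs; cases ys) auto
      moreover have "successively R ?c"
      proof -
        have "successively R (ys @ [w])" "successively R (xs @ [w])"
          using succ(1,2) p' q' by (auto simp: successively_append_iff successively_Cons)
        moreover have "successively R (rev (ys @ [w]))"
          unfolding successively_rev
          by (rule successively_mono[OF \<open>successively R (ys @ [w])\<close>]) (use sym in auto)
        ultimately show ?thesis using succ(3) p'
          by (auto simp: successively_append_iff successively_Cons hd_append split: if_splits)
      qed
      moreover have "R (last ?c) (hd ?c)"
        using succ(4) q' sym by (auto simp: last_rev hd_append split: if_splits)
      ultimately show ?thesis using no_cycle by blast
    qed
  qed
qed simp

text \<open>The cut is before the first entry of maximal value. On a path of cells,
  \<open>ps\<close> is a plateau and the last entry of \<open>qs\<close> is a smaller neighbour of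
  its first cell, that is, an anchor.\<close>

lemma sorted_plateau_suffix:
  fixes c :: "'b \<Rightarrow> nat"
  assumes "zs \<noteq> []" "sorted (map c zs)"
  obtains qs ps where "zs = qs @ ps" "ps \<noteq> []" "last ps = last zs" "\<forall>x\<in>set ps. c x = c (last zs)"
    "qs \<noteq> [] \<longrightarrow> c (last qs) < c (last zs)"
proof
  let ?Q = "\<lambda>x. c x < c (last zs)"
  let ?qs = "takeWhile ?Q zs" and ?ps = "dropWhile ?Q zs"
  show zs: "zs = ?qs @ ?ps" by simp
  show ne: "?ps \<noteq> []" using assms(1) by (auto simp: dropWhile_eq_Nil_conv intro: last_in_set)
  show last: "last ?ps = last zs" using ne by (metis zs last_appendR)
  show "?qs \<noteq> [] \<longrightarrow> c (last ?qs) < c (last zs)"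
    using set_takeWhileD[of _ ?Q zs] last_in_set by blast
  have sorted: "sorted (map c ?ps)" using assms(2) zs by (metis map_append sorted_append)
  show "\<forall>x\<in>set ?ps. c x = c (last zs)"
  proof
    fix x assume x: "x \<in> set ?ps"
    have "c (hd ?ps) \<le> c x"
      using sorted x ne by (cases ?ps) auto
    moreover have "\<not> ?Q (hd ?ps)" using ne by (rule hd_dropWhile)
    moreover have "c x \<le> c (last ?ps)"
    proof (cases "x = last ?ps")
      case False
      have "?ps = butlast ?ps @ [last ?ps]" using ne by simp
      then have "sorted (map c (butlast ?ps @ [last ?ps]))" "x \<in> set (butlast ?ps)"
        using sorted x False by (metis, metis Un_iff empty_iff empty_set list.set(2) set_append singletonD)
      then show ?thesis by (auto simp: sorted_append)
    qed simp
    ultimately show "c x = c (last zs)" using last by simp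
  qed
qed

context rigid_partition
begin

text \<open>If the sizes around the cycle differ, a maximal run of largest cells has smaller cells
  on both sides, and these are two anchors of the run.\<close>

lemma no_aniso_cycle:
  assumes dist: "distinct zs" and len: "3 \<le> length zs" and succ: "successively aniso zs"
    and close: "aniso (last zs) (hd zs)"
  shows False
proof -
  define m where "m = Max (card ` set zs)"
  have ne: "zs \<noteq> []" using len by auto
  have sub: "set zs \<subseteq> P"
  proof
    fix X assume "X \<in> set zs"
    then obtain us vs where zs: "zs = us @ X # vs" by (meson split_list)
    show "X \<in> P"
    proof (cases vs)
      case Nil
      then show ?thesis using close zs by (simp add: aniso_def)
    next
      case (Cons Y vs')
      then show ?thesis using succ zs by (auto simp: successively_append_iff aniso_def)
    qed
  qed
  have le_m: "card X \<le> m" if "X \<in> set zs" for X using that by (simp add: m_def)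
  have "m \<in> card ` set zs" unfolding m_def using ne by (intro Max_in) auto
  then obtain M where M: "M \<in> set zs" "card M = m" by auto
  show False
  proof (cases "\<forall>X\<in>set zs. card X = m")
    case True
    then have "plateau zs" using ne dist sub succ hd_in_set[OF ne] by (auto simp: plateau_def)
    then show False using plateau_cycle_conflict len close by blast
  next
    case False
    then obtain x where x: "x \<in> set zs" "card x < m" using le_m by force
    obtain us vs where zs: "zs = us @ x # vs" using x(1) by (meson split_list)
    \<comment> \<open>Rotating the cycle so that it ends in the smaller cell \<open>x\<close> keeps
      the run from wrapping around the end of the list.\<close>
    define zs' where "zs' = vs @ us @ [x]"
    have set': "set zs' = set zs" and dist': "distinct zs'" and len': "length zs' = length zs"
      using dist by (auto simp: zs zs'_def)
    have succ': "successively aniso zs'" and close': "aniso x (hd zs')"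
      using succ close
      by (auto simp: zs zs'_def successively_append_iff successively_Cons hd_append split: if_splits)
    define as where "as = takeWhile (\<lambda>X. card X \<noteq> m) zs'"
    define bs where "bs = dropWhile (\<lambda>X. card X \<noteq> m) zs'"
    define ps where "ps = takeWhile (\<lambda>X. card X = m) bs"
    define cs where "cs = dropWhile (\<lambda>X. card X = m) bs"
    have zs'_eq: "zs' = as @ ps @ cs" by (simp add: as_def bs_def ps_def cs_def)
    have "bs \<noteq> []" using M set' by (auto simp: bs_def dropWhile_eq_Nil_conv)
    then have "card (hd bs) = m" using hd_dropWhile[of "\<lambda>X. card X \<noteq> m" zs'] by (simp add: bs_def)
    then have ps: "ps \<noteq> []" using \<open>bs \<noteq> []\<close> by (cases bs) (auto simp: ps_def)
    have bs_last: "last bs = x" using \<open>bs \<noteq> []\<close> zs'_def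
      by (metis bs_def last_appendR last_snoc append_assoc takeWhile_dropWhile_id)
    have cs: "cs \<noteq> []"
    proof
      assume "cs = []"
      then have "\<forall>X\<in>set bs. card X = m" by (simp add: cs_def dropWhile_eq_Nil_conv)
      then show False using bs_last \<open>bs \<noteq> []\<close> x(2) last_in_set by fastforce
    qed
    have last_cs: "last cs = x" using bs_last cs by (metis cs_def last_appendR takeWhile_dropWhile_id)
    have card_ps: "card X = m" if "X \<in> set ps" for X using that set_takeWhileD unfolding ps_def by force
    have subs: "set as \<subseteq> set zs" "set ps \<subseteq> set zs" "set cs \<subseteq> set zs"
      unfolding set'[symmetric] zs'_eq by auto
    define Z where "Z = hd cs"
    \<comment> \<open>If the run starts the list, its cyclic predecessor is the last cell
      \<open>x\<close>.\<close>
    define X where "X = (if as = [] then x else last as)"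
    have "card Z \<noteq> m" unfolding Z_def using hd_dropWhile[of "\<lambda>X. card X = m" bs] cs by (simp add: cs_def)
    moreover have "Z \<in> set zs" using hd_in_set[OF cs] subs(3) by (auto simp: Z_def)
    ultimately have Z_less: "card Z < m" using le_m[of Z] by simp
    have "card X \<noteq> m"
      using x(2) set_takeWhileD[of "last as" "\<lambda>X. card X \<noteq> m" zs'] last_in_set[of as] by (auto simp: X_def as_def)
    moreover have "X \<in> set zs" using x(1) subs(1) last_in_set[of as] by (auto simp: X_def)
    ultimately have X_less: "card X < m" using le_m[of X] by simp
    have "plateau ps"
      unfolding plateau_def
    proof (intro conjI)
      show "successively aniso ps" using succ' zs'_eq by (simp add: successively_append_iff)
      show "distinct ps" using dist' zs'_eq by simp
      show "set ps \<subseteq> P" using sub subs(2) by blast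
      show "\<forall>X\<in>set ps. card X = card (hd ps)" using card_ps hd_in_set[OF ps] by metis
    qed (rule ps)
    moreover have "aniso X (hd ps)"
      using succ' close' ps by (auto simp: X_def zs'_eq successively_append_iff hd_append split: if_splits)
    then have "anchor X (hd ps)" using X_less card_ps[OF hd_in_set[OF ps]] by (simp add: anchor_def)
    moreover have "aniso (last ps) Z"
      using succ' ps cs by (auto simp: Z_def zs'_eq successively_append_iff)
    then have "anchor Z (last ps)" using Z_less card_ps[OF last_in_set[OF ps]] aniso_sym by (simp add: anchor_def)
    \<comment> \<open>For a run of one cell, its two neighbours could coincide only in a cycle of
      length 2.\<close>
    moreover have "2 \<le> length ps \<or> X \<noteq> Z"
    proof (cases "as = []")
      case False
      then have "X \<in> set as" by (simp add: X_def)
      moreover have "Z \<in> set cs" using cs by (simp add: Z_def)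
      ultimately show ?thesis using dist' zs'_eq by auto
    next
      case True
      have "length cs = 1" if "hd cs = last cs"
        using that dist' zs'_eq cs by (cases cs) (auto split: if_splits)
      then show ?thesis
        using len len' zs'_eq True last_cs by (auto simp: X_def Z_def)
    qed
    ultimately show False using two_anchors_conflict by blast
  qed
qed

end

text \<open>\<open>R_hetero\<close> says only that \<open>R\<close> is heterogeneous as soon as some
  cell of the component is; that no other cell is heterogeneous is derived in
  \<open>hetero_imp_root\<close>.\<close>

locale rooted_component = rigid_partition +
  fixes A :: "'a set set" and R :: "'a set"
  assumes A_sub: "A \<subseteq> P" and R_in: "R \<in> A"
    and A_closed: "\<lbrakk>X \<in> A; aniso X Y\<rbrakk> \<Longrightarrow> Y \<in> A"
    and A_connected: "X \<in> A \<Longrightarrow> aniso\<^sup>*\<^sup>* R X"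
    and R_hetero: "\<lbrakk>X \<in> A; hetero X\<rbrakk> \<Longrightarrow> hetero R"
    and R_min: "\<lbrakk>\<And>X. X \<in> A \<Longrightarrow> \<not> hetero X; X \<in> A\<rbrakk> \<Longrightarrow> card R \<le> card X"
begin

section \<open>Simple paths from the root\<close>

definition root_path :: "'a set list \<Rightarrow> bool" where
  "root_path zs \<longleftrightarrow> zs \<noteq> [] \<and> hd zs = R \<and> distinct zs \<and> successively aniso zs"

lemma root_path_prefix: "root_path (zs @ ys) \<Longrightarrow> zs \<noteq> [] \<Longrightarrow> root_path zs"
  by (auto simp: root_path_def successively_append_iff)

lemma root_path_snoc:
  "\<lbrakk>root_path zs; aniso (last zs) Y; Y \<notin> set zs\<rbrakk> \<Longrightarrow> root_path (zs @ [Y])"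
  by (auto simp: root_path_def successively_append_iff)

lemma root_path_in: "root_path zs \<Longrightarrow> set zs \<subseteq> A"
proof (induction zs rule: rev_induct)
  case (snoc Y zs)
  show ?case
  proof (cases "zs = []")
    case True
    then show ?thesis using snoc.prems R_in by (simp add: root_path_def)
  next
    case False
    then have "set zs \<subseteq> A" using snoc root_path_prefix by blast
    moreover have "aniso (last zs) Y"
      using snoc.prems False by (simp add: root_path_def successively_append_iff)
    ultimately show ?thesis using A_closed False last_in_set by (metis (no_types, lifting) insert_subset list.set(1,2) set_append subsetD Un_subset_iff empty_subsetI)
  qed
qed (simp add: root_path_def)

lemma root_path_exists:
  assumes "Y \<in> A"
  shows "\<exists>zs. root_path zs \<and> last zs = Y"
  using A_connected[OF assms]
proof (induction rule: rtranclp_induct)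
  case base
  have "root_path [R]" by (simp add: root_path_def)
  then show ?case by (intro exI[of _ "[R]"]) simp
next
  case (step Y Z)
  then obtain zs where zs: "root_path zs" "last zs = Y" by blast
  show ?case
  proof (cases "Z \<in> set zs")
    case True
    then obtain us vs where "zs = (us @ [Z]) @ vs" by (metis append_Cons append_Nil append_assoc split_list)
    then have "root_path (us @ [Z])" using zs(1) root_path_prefix[of "us @ [Z]" vs] by simp
    then show ?thesis by (intro exI[of _ "us @ [Z]"]) simp
  next
    case False
    then have "root_path (zs @ [Z])" using root_path_snoc zs step(2) by simp
    then show ?thesis by (intro exI[of _ "zs @ [Z]"]) simp
  qed
qed

lemma root_path_unique:
  assumes "root_path zs" "root_path ys" "last zs = last ys"
  shows "zs = ys"
  by (rule unique_simple_path[of aniso])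
    (use assms aniso_sym no_aniso_cycle in \<open>auto simp: root_path_def\<close>)

text \<open>The final run of equal sizes starts at the root or is anchored by the smaller cell
  before it. Both uses add an anchor at the other end of the run to reach a contradiction.\<close>

lemma root_path_plateau:
  assumes zs: "root_path zs" and sorted: "sorted (map card zs)"
  obtains X ps where "plateau ps" "last ps = last zs" "set ps \<subseteq> set zs"
    "hd ps = R \<or> anchor X (hd ps) \<and> X \<in> set zs \<and> X \<notin> set ps"
proof -
  have ne: "zs \<noteq> []" using zs by (simp add: root_path_def)
  obtain qs ps where ps: "zs = qs @ ps" "ps \<noteq> []" "last ps = last zs"
    "\<forall>x\<in>set ps. card x = card (last zs)" "qs \<noteq> [] \<longrightarrow> card (last qs) < card (last zs)"
    by (rule sorted_plateau_suffix[OF ne sorted])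
  have hd: "card (hd ps) = card (last zs)" using ps(4) hd_in_set[OF ps(2)] by blast
  have "plateau ps"
    unfolding plateau_def
  proof (intro conjI)
    show "distinct ps" "successively aniso ps"
      using zs unfolding ps(1) by (simp_all add: root_path_def successively_append_iff)
    show "set ps \<subseteq> P" using root_path_in[OF zs] A_sub unfolding ps(1) by auto
    show "\<forall>X\<in>set ps. card X = card (hd ps)" unfolding hd by (rule ps(4))
  qed (rule ps(2))
  moreover have "hd ps = R \<or> anchor (last qs) (hd ps) \<and> last qs \<in> set zs \<and> last qs \<notin> set ps"
  proof (cases "qs = []")
    case True
    then show ?thesis using zs ps(1) by (simp add: root_path_def)
  next
    case False
    then have "aniso (last qs) (hd ps)"
      using zs ps(2) unfolding ps(1) by (simp add: root_path_def successively_append_iff)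
    moreover have "card (last qs) < card (hd ps)" using False ps(5) hd by simp
    moreover have "last qs \<in> set qs" using False by simp
    then have "last qs \<in> set zs" "last qs \<notin> set ps" using zs ps(1) by (auto simp: root_path_def)
    ultimately show ?thesis by (simp add: anchor_def)
  qed
  moreover have "set ps \<subseteq> set zs" using ps(1) by auto
  ultimately show ?thesis using that ps(3) by blast
qed

text \<open>A step to a smaller cell \<open>Y\<close> would make \<open>Y\<close> an anchor at the
  end of the run before it. The front of the run has an anchor too, unless it is a homogeneous root;
  but then the whole component is homogeneous and the root has least size.\<close>

lemma root_path_sorted: "root_path zs \<Longrightarrow> sorted (map card zs)"
proof (induction zs rule: rev_induct)
  case (snoc Y zs)
  show ?case
  proof (cases "zs = []")
    case False
    have path: "root_path zs" using snoc.prems False root_path_prefix by blast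
    then have sorted: "sorted (map card zs)" by (rule snoc.IH)
    have an: "aniso (last zs) Y" and Y: "Y \<notin> set zs"
      using snoc.prems False by (auto simp: root_path_def successively_append_iff)
    have YA: "Y \<in> A" using root_path_in[OF snoc.prems] by simp
    have "card (last zs) \<le> card Y"
    proof (rule ccontr)
      assume "\<not> card (last zs) \<le> card Y"
      then have anchor: "anchor Y (last zs)" using an aniso_sym by (simp add: anchor_def)
      obtain X ps where ps: "plateau ps" "last ps = last zs" "set ps \<subseteq> set zs"
        "hd ps = R \<or> anchor X (hd ps) \<and> X \<in> set zs \<and> X \<notin> set ps"
        by (rule root_path_plateau[OF path sorted])
      have psne: "ps \<noteq> []" using ps(1) by (simp add: plateau_def)
      from ps(4) show False
      proof
        assume hd: "hd ps = R"
        show False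
        proof (cases "hetero R")
          case True
          then have "anchor R (hd ps)" using hd by (simp add: anchor_def)
          moreover have "R \<noteq> Y" using Y path by (auto simp: root_path_def)
          ultimately show False using two_anchors_conflict[OF ps(1)] anchor ps(2) by metis
        next
          case False
          then have "card R \<le> card Y" using R_min[OF _ YA] R_hetero by blast
          moreover have "card (last ps) = card (hd ps)"
            using ps(1) last_in_set[OF psne] unfolding plateau_def by blast
          ultimately show False using \<open>\<not> card (last zs) \<le> card Y\<close> hd ps(2) by simp
        qed
      next
        assume X: "anchor X (hd ps) \<and> X \<in> set zs \<and> X \<notin> set ps"
        then have "X \<noteq> Y" using Y by blast
        then show False using two_anchors_conflict[OF ps(1)] X anchor ps(2) by metis
      qed
    qed
    moreover obtain us X where "zs = us @ [X]" using False by (metis rev_exhaust)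
    ultimately show ?thesis using sorted by (fastforce simp: sorted_append)
  qed simp
qed simp

text \<open>A heterogeneous cell anchors itself at the end of its run, while the front is anchored
  by a smaller cell or by the root, itself heterogeneous by \<open>R_hetero\<close>.\<close>

lemma hetero_imp_root:
  assumes "Z \<in> A" "hetero Z"
  shows "Z = R"
proof (rule ccontr)
  assume "Z \<noteq> R"
  obtain zs where zs: "root_path zs" "last zs = Z" using root_path_exists[OF assms(1)] by blast
  obtain X ps where ps: "plateau ps" "last ps = last zs" "set ps \<subseteq> set zs"
    "hd ps = R \<or> anchor X (hd ps) \<and> X \<in> set zs \<and> X \<notin> set ps"
    by (rule root_path_plateau[OF zs(1) root_path_sorted[OF zs(1)]])
  have psne: "ps \<noteq> []" using ps(1) by (simp add: plateau_def)
  have Z: "anchor Z (last ps)" using assms ps(2) zs(2) by (simp add: anchor_def)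
  from ps(4) show False
  proof
    assume hd: "hd ps = R"
    then have "anchor R (hd ps)" using R_hetero[OF assms] by (simp add: anchor_def)
    then show False using two_anchors_conflict[OF ps(1) _ Z] \<open>Z \<noteq> R\<close> by blast
  next
    assume X: "anchor X (hd ps) \<and> X \<in> set zs \<and> X \<notin> set ps"
    moreover have "Z \<in> set ps" using psne ps(2) zs(2) last_in_set by metis
    ultimately show False using two_anchors_conflict[OF ps(1) _ Z] by blast
  qed
qed

section \<open>The tree of cells\<close>

definition parent :: "'a set \<Rightarrow> 'a set \<Rightarrow> bool" where
  "parent X Y \<longleftrightarrow> (\<exists>zs. root_path (zs @ [X, Y]))"

text \<open>Counts the cells on the path, so the root has depth 1.\<close>

definition depth :: "'a set \<Rightarrow> nat" where
  "depth Y = length (THE zs. root_path zs \<and> last zs = Y)"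

lemma depth_eq: "root_path zs \<Longrightarrow> depth (last zs) = length zs"
proof -
  assume zs: "root_path zs"
  then have "(THE ys. root_path ys \<and> last ys = last zs) = zs"
    using root_path_unique by (intro the_equality) auto
  then show ?thesis by (simp add: depth_def)
qed

lemma parent_unique:
  assumes "parent X Y" "parent X' Y"
  shows "X = X'"
proof -
  obtain zs ys where "root_path (zs @ [X, Y])" "root_path (ys @ [X', Y])"
    using assms by (auto simp: parent_def)
  then have "zs @ [X, Y] = ys @ [X', Y]" by (rule root_path_unique) simp
  then show ?thesis by simp
qed

lemma parentD:
  assumes "parent X Y"
  shows "aniso X Y" "card X \<le> card Y" "X \<in> A" "Y \<in> A" "Y \<noteq> R" "depth Y = Suc (depth X)"
proof -
  obtain zs where zs: "root_path (zs @ [X, Y])" using assms by (auto simp: parent_def)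
  then have zs': "root_path (zs @ [X])" using root_path_prefix[of "zs @ [X]" "[Y]"] by simp
  show "aniso X Y" using zs by (auto simp: root_path_def successively_append_iff)
  show "card X \<le> card Y" using root_path_sorted[OF zs] by (auto simp: sorted_append)
  show "X \<in> A" "Y \<in> A" using root_path_in[OF zs] by auto
  show "Y \<noteq> R" using zs by (cases zs) (auto simp: root_path_def)
  show "depth Y = Suc (depth X)" using depth_eq[OF zs] depth_eq[OF zs'] by simp
qed

lemma parent_exists:
  assumes "Y \<in> A" "Y \<noteq> R"
  shows "\<exists>X. parent X Y"
proof -
  obtain zs where zs: "root_path zs" "last zs = Y" using root_path_exists[OF assms(1)] by blast
  have "zs \<noteq> []" using zs by (simp add: root_path_def)
  then obtain us where us: "zs = us @ [Y]" using zs(2) by (metis append_butlast_last_id)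
  have "us \<noteq> []" using us zs assms(2) by (auto simp: root_path_def)
  then obtain vs X where "us = vs @ [X]" by (metis append_butlast_last_id)
  then show ?thesis using us zs by (auto simp: parent_def)
qed

text \<open>A path to \<open>X\<close> either extends to \<open>Y\<close> or already passes through
  \<open>Y\<close>. In the second case its part up to \<open>Y\<close> avoids \<open>X\<close> and
  extends to \<open>X\<close>.\<close>

lemma aniso_parent:
  assumes "X \<in> A" "aniso X Y"
  shows "parent X Y \<or> parent Y X"
proof -
  obtain zs where zs: "root_path zs" "last zs = X" using root_path_exists[OF assms(1)] by blast
  have ne: "zs \<noteq> []" using zs by (simp add: root_path_def)
  show ?thesis
  proof (cases "Y \<in> set zs")
    case False
    then have "root_path (zs @ [Y])" using root_path_snoc zs assms(2) by simp
    moreover have "zs @ [Y] = butlast zs @ [X, Y]" using ne zs(2) by (metis append_Cons append_Nil append_assoc append_butlast_last_id)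
    ultimately show ?thesis by (auto simp: parent_def)
  next
    case True
    then obtain us vs where us: "zs = (us @ [Y]) @ vs" by (metis append_Cons append_Nil append_assoc split_list)
    have XY: "X \<noteq> Y" using assms(2) by (simp add: aniso_def)
    then have "vs \<noteq> []" using zs(2) us by auto
    then have "X \<in> set vs" using zs(2) us by (metis last_appendR last_in_set)
    then have "X \<notin> set (us @ [Y])" using zs(1) us by (auto simp: root_path_def)
    moreover have "root_path (us @ [Y])" using zs(1) us root_path_prefix by blast
    ultimately have "root_path ((us @ [Y]) @ [X])" using root_path_snoc[of "us @ [Y]" X] assms(2) aniso_sym by simp
    then show ?thesis by (auto simp: parent_def)
  qed
qed

end

section \<open>Fixing numbers of rooted forests\<close>

lemma Fix_cells_attained:
  "\<exists>S\<subseteq>pverts F. card S = Fix_cells F P \<and> is_fixing_set (cell_automorphisms F P) S"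
  unfolding Fix_cells_def
proof (rule LeastI_ex)
  have "is_fixing_set (cell_automorphisms F P) (pverts F)"
    unfolding is_fixing_set_def cell_automorphisms_def automorphisms_def
    by (auto intro!: ext simp: permutes_def)
  then show "\<exists>n. \<exists>S\<subseteq>pverts F. card S = n \<and> is_fixing_set (cell_automorphisms F P) S" by blast
qed

lemma Fix_cells_le:
  "\<lbrakk>S \<subseteq> pverts F; is_fixing_set (cell_automorphisms F P) S\<rbrakk> \<Longrightarrow> Fix_cells F P \<le> card S"
  unfolding Fix_cells_def by (rule Least_le) blast

lemma Fix_attained: "\<exists>S\<subseteq>pverts F. card S = Fix F \<and> is_fixing_set (automorphisms F) S"
  unfolding Fix_def
proof (rule LeastI_ex)
  have "is_fixing_set (automorphisms F) (pverts F)"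
    unfolding is_fixing_set_def automorphisms_def
    by (auto intro!: ext simp: permutes_def)
  then show "\<exists>n. \<exists>S\<subseteq>pverts F. card S = n \<and> is_fixing_set (automorphisms F) S" by blast
qed

lemma Fix_le: "\<lbrakk>S \<subseteq> pverts F; is_fixing_set (automorphisms F) S\<rbrakk> \<Longrightarrow> Fix F \<le> card S"
  unfolding Fix_def by (rule Least_le) blast

lemma permutes_if_id_outside:
  assumes "bij f" "\<And>x. x \<notin> S \<Longrightarrow> f x = x"
  shows "f permutes S"
  using assms by (auto simp: permutes_def bij_iff)

lemma permutes_restrict:
  assumes "f permutes V" "finite S" "f ` S \<subseteq> S"
  shows "(\<lambda>x. if x \<in> S then f x else x) permutes S"
proof (rule bij_imp_permutes)
  have "inj_on f S" using assms(1) by (rule permutes_inj_on)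
  then have "bij_betw f S S" using endo_inj_surj[OF assms(2,3)] by (simp add: bij_betw_def)
  then show "bij_betw (\<lambda>x. if x \<in> S then f x else x) S S"
    by (rule bij_betw_cong[THEN iffD1, rotated]) simp
qed simp

text \<open>The abstract jellyfish graph: an arbitrary graph on \<open>R\<close> and below it a tree
  of cells. \<open>children_card\<close> is the condition that makes the legs isomorphic,
  \<open>parent_ex1\<close> the one that keeps them apart.\<close>

locale rooted_forest =
  fixes J :: "'a pair_pre_digraph" and A :: "'a set set" and R :: "'a set"
    and par :: "'a set \<Rightarrow> 'a set \<Rightarrow> bool" and depth :: "'a set \<Rightarrow> nat"
  assumes finite_V: "finite (pverts J)"
    and partition: "partition_on (pverts J) A"
    and R_in: "R \<in> A"
    and arcs_sym: "(u, w) \<in> parcs J \<Longrightarrow> (w, u) \<in> parcs J"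
    and arcs_irrefl: "(u, u) \<notin> parcs J"
    and arc_cases: "\<lbrakk>(u, w) \<in> parcs J; u \<in> X; w \<in> Y; X \<in> A; Y \<in> A\<rbrakk> \<Longrightarrow>
      X = R \<and> Y = R \<or> par X Y \<or> par Y X"
    and arcs_sub: "parcs J \<subseteq> pverts J \<times> pverts J"
    and parD: "par X Y \<Longrightarrow> X \<in> A" "par X Y \<Longrightarrow> Y \<in> A" "par X Y \<Longrightarrow> Y \<noteq> R" "par X Y \<Longrightarrow> depth Y = Suc (depth X)"
    and par_unique: "\<lbrakk>par X Y; par X' Y\<rbrakk> \<Longrightarrow> X = X'"
    and par_exists: "\<lbrakk>Y \<in> A; Y \<noteq> R\<rbrakk> \<Longrightarrow> \<exists>X. par X Y"
    and parent_ex1: "\<lbrakk>par X Y; w \<in> Y\<rbrakk> \<Longrightarrow> \<exists>!u. u \<in> X \<and> (u, w) \<in> parcs J"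
    and children_card: "\<lbrakk>par X Y; u \<in> X; u' \<in> X\<rbrakk> \<Longrightarrow>
      card {w \<in> Y. (u, w) \<in> parcs J} = card {w \<in> Y. (u', w) \<in> parcs J}"
begin

abbreviation V :: "'a set" where "V \<equiv> pverts J"

definition T :: "'a rel" where
  "T = {(u, w) \<in> parcs J. \<exists>X Y. par X Y \<and> u \<in> X \<and> w \<in> Y}"

definition leg_set :: "'a \<Rightarrow> 'a set" where
  "leg_set v = {w. (v, w) \<in> T\<^sup>*}"

lemma cell_sub: "X \<in> A \<Longrightarrow> X \<subseteq> V" and cell_finite: "X \<in> A \<Longrightarrow> finite X"
  using partition finite_V by (auto simp: partition_on_def intro: finite_subset)

lemma cell_eq: "\<lbrakk>X \<in> A; Y \<in> A; u \<in> X; u \<in> Y\<rbrakk> \<Longrightarrow> X = Y"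
  using partition by (auto simp: partition_on_def disjoint_def)

definition cell :: "'a \<Rightarrow> 'a set" where
  "cell w = (THE X. X \<in> A \<and> w \<in> X)"

lemma cell: "X \<in> A \<Longrightarrow> w \<in> X \<Longrightarrow> cell w = X"
  unfolding cell_def using cell_eq by (intro the_equality) auto

lemma cell_in: "w \<in> V \<Longrightarrow> cell w \<in> A" "w \<in> V \<Longrightarrow> w \<in> cell w"
proof -
  assume "w \<in> V"
  then obtain X where "X \<in> A" "w \<in> X" using partition by (auto simp: partition_on_def)
  then show "cell w \<in> A" "w \<in> cell w" using cell by auto
qed

lemma cell_R: "w \<in> R \<Longrightarrow> cell w = R" and R_iff: "w \<in> V \<Longrightarrow> w \<in> R \<longleftrightarrow> cell w = R"
  using cell[OF R_in] cell_in by auto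

lemma T_iff: "(u, w) \<in> T \<longleftrightarrow> (u, w) \<in> parcs J \<and> par (cell u) (cell w)"
proof
  assume "(u, w) \<in> T"
  then obtain X Y where "(u, w) \<in> parcs J" "par X Y" "u \<in> X" "w \<in> Y" by (auto simp: T_def)
  then show "(u, w) \<in> parcs J \<and> par (cell u) (cell w)" using cell parD by metis
next
  assume *: "(u, w) \<in> parcs J \<and> par (cell u) (cell w)"
  then have "u \<in> V" "w \<in> V" using arcs_sub by auto
  then show "(u, w) \<in> T" using * cell_in(2) by (auto simp: T_def)
qed

lemma T_V: "(u, w) \<in> T \<Longrightarrow> u \<in> V" "(u, w) \<in> T \<Longrightarrow> w \<in> V"
  using arcs_sub by (auto simp: T_iff)

lemma T_not_R: "(u, w) \<in> T \<Longrightarrow> w \<notin> R"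
  using parD(3) cell_R by (auto simp: T_iff)

lemma T_depth: "(u, w) \<in> T \<Longrightarrow> depth (cell w) = Suc (depth (cell u))"
  using parD(4) by (auto simp: T_iff)

lemma T_unique:
  assumes "(u, w) \<in> T" "(u', w) \<in> T"
  shows "u = u'"
proof -
  have "cell u = cell u'" using assms par_unique by (auto simp: T_iff)
  moreover have "w \<in> cell w" "u \<in> cell u" "u' \<in> cell u'" using assms T_V cell_in(2) by auto
  ultimately show ?thesis using parent_ex1[of "cell u" "cell w" w] assms by (auto simp: T_iff)
qed

lemma T_exists:
  assumes "w \<in> V" "w \<notin> R"
  shows "\<exists>u. (u, w) \<in> T"
proof -
  have "cell w \<noteq> R" using assms R_iff by blast
  then obtain X where X: "par X (cell w)" using par_exists cell_in(1) assms(1) by blast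
  then obtain u where "u \<in> X" "(u, w) \<in> parcs J" using parent_ex1 cell_in(2)[OF assms(1)] by blast
  then show ?thesis using X cell_in(2)[OF assms(1)] by (auto simp: T_def)
qed

lemma arc_iff:
  "(u, w) \<in> parcs J \<longleftrightarrow> (u, w) \<in> parcs J \<inter> R \<times> R \<or> (u, w) \<in> T \<or> (w, u) \<in> T"
proof
  assume uw: "(u, w) \<in> parcs J"
  then have in_V: "u \<in> V" "w \<in> V" using arcs_sub by auto
  have "cell u = R \<and> cell w = R \<or> par (cell u) (cell w) \<or> par (cell w) (cell u)"
    by (rule arc_cases[OF uw]) (use in_V cell_in in auto)
  then show "(u, w) \<in> parcs J \<inter> R \<times> R \<or> (u, w) \<in> T \<or> (w, u) \<in> T"
    using uw arcs_sym in_V R_iff by (auto simp: T_iff)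
qed (auto simp: T_iff arcs_sym)

lemma leg_set_sub: "v \<in> V \<Longrightarrow> leg_set v \<subseteq> V"
proof
  fix w assume "v \<in> V" "w \<in> leg_set v"
  then have "(v, w) \<in> T\<^sup>*" by (simp add: leg_set_def)
  then show "w \<in> V" by (cases rule: rtranclE) (use \<open>v \<in> V\<close> T_V in auto)
qed

lemma leg_set_self: "v \<in> leg_set v"
  by (simp add: leg_set_def)

lemma R_sub: "R \<subseteq> V" by (rule cell_sub[OF R_in])

lemma finite_R: "finite R" by (rule cell_finite[OF R_in])

lemma finite_leg: "v \<in> V \<Longrightarrow> finite (leg_set v)"
  using leg_set_sub finite_V finite_subset by blast

text \<open>By uniqueness of parents, a path from \<open>v\<close> to \<open>w\<close> ends with the
  arc \<open>(u, w)\<close> unless it is empty.\<close>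

lemma leg_set_step: "(u, w) \<in> T \<Longrightarrow> w \<in> leg_set v \<longleftrightarrow> u \<in> leg_set v \<or> w = v"
proof
  assume uw: "(u, w) \<in> T" and "w \<in> leg_set v"
  then have "(v, w) \<in> T\<^sup>*" by (simp add: leg_set_def)
  then show "u \<in> leg_set v \<or> w = v"
  proof (cases rule: rtranclE)
    case (step y)
    then have "y = u" using uw T_unique by blast
    then show ?thesis using step by (simp add: leg_set_def)
  qed simp
qed (auto simp: leg_set_def)

lemma leg_set_R: "\<lbrakk>v \<in> R; w \<in> R; w \<in> leg_set v\<rbrakk> \<Longrightarrow> w = v"
proof -
  assume "v \<in> R" "w \<in> R" "w \<in> leg_set v"
  then have "(v, w) \<in> T\<^sup>*" by (simp add: leg_set_def)
  then show "w = v" by (cases rule: rtranclE) (use T_not_R \<open>w \<in> R\<close> in auto)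
qed

lemma leg_set_disjoint:
  assumes "v \<in> R" "v' \<in> R" "w \<in> leg_set v" "w \<in> leg_set v'"
  shows "v = v'"
proof -
  have "(v, w) \<in> T\<^sup>*" using assms(3) by (simp add: leg_set_def)
  then show ?thesis using assms(4)
  proof (induction rule: rtrancl_induct)
    case base
    then show ?case using leg_set_R assms(1,2) by blast
  next
    case (step y z)
    then show ?case using leg_set_step[of y z v'] T_not_R[of y z] assms(2) by blast
  qed
qed

lemma depth_induct[consumes 1, case_names root child]:
  assumes "w \<in> V" "\<And>v. v \<in> R \<Longrightarrow> Q v" "\<And>u w. \<lbrakk>(u, w) \<in> T; Q u\<rbrakk> \<Longrightarrow> Q w"
  shows "Q w"
  using assms(1)
proof (induction "depth (cell w)" arbitrary: w rule: less_induct)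
  case less
  show ?case
  proof (cases "w \<in> R")
    case False
    then obtain u where "(u, w) \<in> T" using T_exists less.prems by blast
    then show ?thesis using less.hyps[of u] T_depth T_V(1) assms(3) by fastforce
  qed (rule assms(2))
qed

lemma leg_set_cover: "w \<in> V \<Longrightarrow> \<exists>v\<in>R. w \<in> leg_set v"
proof (induction rule: depth_induct)
  case (root v)
  then show ?case using leg_set_self by blast
next
  case (child u w)
  then show ?case using leg_set_step[OF child(1)] by blast
qed

text \<open>Tree arcs join vertices of one leg, so only an arc of the head can leave it.\<close>

lemma leg_arc_out:
  assumes v: "v \<in> R" and u: "u \<in> leg_set v" and w: "w \<notin> leg_set v" and uw: "(u, w) \<in> parcs J"
  shows "u = v"
  using uw[unfolded arc_iff]
proof (elim disjE)
  assume "(u, w) \<in> parcs J \<inter> R \<times> R" then show ?thesis using leg_set_R[OF v _ u] by blast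
next
  assume "(u, w) \<in> T" then show ?thesis using leg_set_step u w by blast
next
  assume "(w, u) \<in> T" then show ?thesis using leg_set_step u w by blast
qed

lemma leg_arc_iff:
  assumes v: "v \<in> R" and "u \<in> leg_set v" "w \<in> leg_set v"
  shows "(u, w) \<in> parcs J \<longleftrightarrow> (u, w) \<in> T \<or> (w, u) \<in> T"
  using arc_iff[of u w] leg_set_R[OF v] assms(2,3) arcs_irrefl[of v] by blast

section \<open>Automorphisms of the forest and of its legs\<close>

definition "\<Gamma> = cell_automorphisms J A"

definition "\<Lambda> v = cell_automorphisms (induced J (leg_set v)) A"

lemma \<Gamma>_iff: "f \<in> \<Gamma> \<longleftrightarrow> f permutes V \<and> (\<forall>w\<in>V. cell (f w) = cell w) \<and>
    (\<forall>u\<in>V. \<forall>w\<in>V. (f u, f w) \<in> parcs J \<longleftrightarrow> (u, w) \<in> parcs J)"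
proof -
  have "(\<forall>C\<in>A. \<forall>v\<in>V \<inter> C. f v \<in> C) \<longleftrightarrow> (\<forall>w\<in>V. cell (f w) = cell w)" if "f permutes V"
  proof -
    have fV: "f w \<in> V" if "w \<in> V" for w using \<open>f permutes V\<close> that by (simp add: permutes_in_image)
    show ?thesis
    proof
      assume *: "\<forall>C\<in>A. \<forall>v\<in>V \<inter> C. f v \<in> C"
      show "\<forall>w\<in>V. cell (f w) = cell w"
      proof
        fix w assume w: "w \<in> V"
        have "f w \<in> cell w" using * cell_in[OF w] w by blast
        then show "cell (f w) = cell w" by (rule cell[OF cell_in(1)[OF w]])
      qed
    next
      assume *: "\<forall>w\<in>V. cell (f w) = cell w"
      show "\<forall>C\<in>A. \<forall>v\<in>V \<inter> C. f v \<in> C" using * cell_in(2) cell fV by (metis IntE)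
    qed
  qed
  then show ?thesis by (auto simp: \<Gamma>_def cell_automorphisms_def automorphisms_def)
qed

lemma \<Lambda>_iff:
  assumes "v \<in> V"
  shows "f \<in> \<Lambda> v \<longleftrightarrow> f permutes leg_set v \<and> (\<forall>w\<in>leg_set v. cell (f w) = cell w) \<and>
    (\<forall>u\<in>leg_set v. \<forall>w\<in>leg_set v. (f u, f w) \<in> parcs J \<longleftrightarrow> (u, w) \<in> parcs J)"
proof -
  have "(\<forall>C\<in>A. \<forall>v\<in>leg_set v \<inter> C. f v \<in> C) \<longleftrightarrow> (\<forall>w\<in>leg_set v. cell (f w) = cell w)" if f: "f permutes leg_set v"
  proof -
    have fV: "f w \<in> V" "w \<in> V" if "w \<in> leg_set v" for w
      using f that leg_set_sub[OF assms] by (auto simp: permutes_in_image)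
    show ?thesis
    proof
      assume *: "\<forall>C\<in>A. \<forall>v\<in>leg_set v \<inter> C. f v \<in> C"
      show "\<forall>w\<in>leg_set v. cell (f w) = cell w"
      proof
        fix w assume w: "w \<in> leg_set v"
        have "f w \<in> cell w" using * cell_in[OF fV(2)[OF w]] w by blast
        then show "cell (f w) = cell w" by (rule cell[OF cell_in(1)[OF fV(2)[OF w]]])
      qed
    next
      assume *: "\<forall>w\<in>leg_set v. cell (f w) = cell w"
      show "\<forall>C\<in>A. \<forall>v\<in>leg_set v \<inter> C. f v \<in> C" using * cell_in(2) cell fV by (metis IntE)
    qed
  qed
  moreover have "(\<forall>x\<in>leg_set v. \<forall>y\<in>leg_set v.
      ((f x, f y) \<in> parcs J \<and> f x \<in> leg_set v \<and> f y \<in> leg_set v) = ((x, y) \<in> parcs J)) \<longleftrightarrow>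
      (\<forall>u\<in>leg_set v. \<forall>w\<in>leg_set v. (f u, f w) \<in> parcs J \<longleftrightarrow> (u, w) \<in> parcs J)"
    if "f permutes leg_set v"
    using that by (simp add: permutes_in_image)
  ultimately show ?thesis
    by (auto simp: \<Lambda>_def cell_automorphisms_def automorphisms_def induced_def)
qed

lemma \<Lambda>_root:
  assumes "v \<in> R" "\<psi> \<in> \<Lambda> v"
  shows "\<psi> v = v"
proof -
  have vV: "v \<in> V" using assms(1) R_sub by blast
  have *: "cell (\<psi> v) = cell v" "\<psi> v \<in> leg_set v"
    using assms(2) leg_set_self unfolding \<Lambda>_iff[OF vV] by (auto simp: permutes_in_image)
  then have "\<psi> v \<in> R" using R_iff leg_set_sub[OF vV] cell_R[OF assms(1)] by auto
  then show ?thesis using leg_set_R assms(1) *(2) by blast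
qed

text \<open>A leg meets the rest of the graph only in its root \<open>v\<close>, which is fixed as
  the only vertex of the leg in \<open>R\<close>. Being the identity off the leg is part of
  \<open>permutes\<close>, so \<open>\<psi>\<close> is its own extension.\<close>

lemma \<Lambda>_sub_\<Gamma>:
  assumes v: "v \<in> R" and \<psi>: "\<psi> \<in> \<Lambda> v"
  shows "\<psi> \<in> \<Gamma>"
proof -
  have vV: "v \<in> V" using v R_sub by blast
  note sub = leg_set_sub[OF vV]
  have p: "\<psi> permutes leg_set v" and c: "\<And>w. w \<in> leg_set v \<Longrightarrow> cell (\<psi> w) = cell w"
    and a: "\<And>u w. \<lbrakk>u \<in> leg_set v; w \<in> leg_set v\<rbrakk> \<Longrightarrow> (\<psi> u, \<psi> w) \<in> parcs J \<longleftrightarrow> (u, w) \<in> parcs J"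
    using \<psi> unfolding \<Lambda>_iff[OF vV] by auto
  have out: "\<psi> w = w" if "w \<notin> leg_set v" for w using p that by (rule permutes_not_in)
  have inn: "\<psi> w \<in> leg_set v" if "w \<in> leg_set v" for w using p that by (simp add: permutes_in_image)
  have root: "\<psi> v = v" by (rule \<Lambda>_root[OF v \<psi>])
  have mixed: "(\<psi> u, w) \<in> parcs J \<longleftrightarrow> (u, w) \<in> parcs J" if "u \<in> leg_set v" "w \<notin> leg_set v" for u w
  proof (cases "u = v")
    case False
    then have "\<psi> u \<noteq> v" using root p by (metis permutes_inj injD)
    then show ?thesis using False leg_arc_out[OF v _ that(2)] that(1) inn by blast
  qed (simp add: root)
  show ?thesis unfolding \<Gamma>_iff
  proof (intro conjI ballI)
    show "\<psi> permutes V" using p sub by (rule permutes_subset)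
    show "cell (\<psi> w) = cell w" for w using c out by (cases "w \<in> leg_set v") auto
    show "(\<psi> u, \<psi> w) \<in> parcs J \<longleftrightarrow> (u, w) \<in> parcs J" for u w
    proof -
      consider "u \<in> leg_set v" "w \<in> leg_set v" | "u \<in> leg_set v" "w \<notin> leg_set v" |
        "u \<notin> leg_set v" "w \<in> leg_set v" | "u \<notin> leg_set v" "w \<notin> leg_set v" by blast
      then show ?thesis
      proof cases
        case 1 then show ?thesis by (rule a)
      next
        case 2 then show ?thesis using mixed out by simp
      next
        case 3
        then have "(w, \<psi> u) \<in> parcs J \<longleftrightarrow> (w, u) \<in> parcs J" "\<psi> u = u" using out by auto
        then show ?thesis using mixed[OF 3(2,1)] arcs_sym by metis
      next
        case 4 then show ?thesis using out by simp
      qed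
    qed
  qed
qed

lemma \<Gamma>_T:
  assumes "f \<in> \<Gamma>" "(u, w) \<in> T"
  shows "(f u, f w) \<in> T"
  using assms T_V[OF assms(2)] unfolding \<Gamma>_iff T_iff by auto

lemma T_leg_map:
  assumes f: "\<And>u w. (u, w) \<in> T \<Longrightarrow> (f u, f w) \<in> T" and w: "w \<in> leg_set v"
  shows "f w \<in> leg_set (f v)"
proof -
  have "(v, w) \<in> T\<^sup>*" using w by (simp add: leg_set_def)
  then have "(f v, f w) \<in> T\<^sup>*"
    by (induction rule: rtrancl_induct) (auto intro: rtrancl_into_rtrancl f)
  then show ?thesis by (simp add: leg_set_def)
qed

lemma \<Gamma>_R: "f \<in> \<Gamma> \<Longrightarrow> v \<in> R \<Longrightarrow> f v \<in> R"
  using R_sub cell_R R_iff unfolding \<Gamma>_iff by (metis permutes_in_image subsetD)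

lemma \<Gamma>_restrict_leg:
  assumes f: "f \<in> \<Gamma>" and v: "v \<in> R" and fv: "f v = v"
  shows "(\<lambda>x. if x \<in> leg_set v then f x else x) \<in> \<Lambda> v"
proof -
  have vV: "v \<in> V" using v R_sub by blast
  note sub = leg_set_sub[OF vV]
  have "f ` leg_set v \<subseteq> leg_set v"
    using T_leg_map[of f _ v] \<Gamma>_T[OF f] fv by auto
  then have "(\<lambda>x. if x \<in> leg_set v then f x else x) permutes leg_set v"
    using f permutes_restrict[OF _ finite_leg[OF vV], of f V] by (simp add: \<Gamma>_iff)
  moreover have "cell (f w) = cell w" if "w \<in> leg_set v" for w
    using f that sub by (auto simp: \<Gamma>_iff)
  moreover have "(f u, f w) \<in> parcs J \<longleftrightarrow> (u, w) \<in> parcs J" if "u \<in> leg_set v" "w \<in> leg_set v" for u w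
    using f subsetD[OF sub that(1)] subsetD[OF sub that(2)] unfolding \<Gamma>_iff by blast
  ultimately show ?thesis unfolding \<Lambda>_iff[OF vV] by simp
qed

lemma \<Gamma>_restrict_R:
  assumes f: "f \<in> \<Gamma>"
  shows "(\<lambda>x. if x \<in> R then f x else x) \<in> automorphisms (induced J R)"
proof -
  have "f ` R \<subseteq> R" using \<Gamma>_R[OF f] by blast
  moreover have "f permutes V" using f by (simp add: \<Gamma>_iff)
  ultimately have "(\<lambda>x. if x \<in> R then f x else x) permutes R"
    using permutes_restrict finite_R by blast
  then show ?thesis using f \<Gamma>_R[OF f] R_sub by (auto simp: automorphisms_def induced_def \<Gamma>_iff subset_iff)
qed

section \<open>Lifting permutations of the head\<close>

definition children :: "'a \<Rightarrow> 'a set \<Rightarrow> 'a set" where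
  "children u Y = {w \<in> Y. (u, w) \<in> T}"

definition child_bij :: "'a \<Rightarrow> 'a \<Rightarrow> 'a set \<Rightarrow> 'a \<Rightarrow> 'a" where
  "child_bij u u' Y = (SOME b. bij_betw b (children u Y) (children u' Y))"

text \<open>If \<open>Y\<close> is a child cell, \<open>children_card\<close> makes the two sets
  equally large; otherwise both are empty.\<close>

lemma child_bij:
  assumes "u \<in> V" "u' \<in> V" "cell u = cell u'" "Y \<in> A"
  shows "bij_betw (child_bij u u' Y) (children u Y) (children u' Y)"
proof -
  have "children z Y = (if par (cell u) Y then {w \<in> Y. (z, w) \<in> parcs J} else {})"
    if "cell z = cell u" for z
    using that cell[OF assms(4)] by (auto simp: children_def T_iff)
  then have "card (children u Y) = card (children u' Y)"
    using children_card[of "cell u" Y u u'] cell_in(2) assms by auto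
  moreover have "finite (children z Y)" for z
    using cell_finite[OF assms(4)] by (simp add: children_def)
  ultimately have "\<exists>b. bij_betw b (children u Y) (children u' Y)"
    by (simp add: finite_same_card_bij)
  then show ?thesis unfolding child_bij_def by (rule someI_ex)
qed

definition parent_of :: "'a \<Rightarrow> 'a" where
  "parent_of w = (THE u. (u, w) \<in> T)"

lemma parent_of: "(u, w) \<in> T \<Longrightarrow> parent_of w = u"
  unfolding parent_of_def using T_unique by blast

text \<open>The image of a vertex is a child of the image of its parent. The recursion is on a bound
  \<open>n\<close>, since a parent is no structural part of a vertex. In round zero
  \<open>g w\<close> is a mere default off \<open>R\<close>; by \<open>lift_upto_stable\<close> the
  values are final once \<open>n\<close> reaches the depth.\<close>

primrec lift_upto :: "('a \<Rightarrow> 'a) \<Rightarrow> nat \<Rightarrow> 'a \<Rightarrow> 'a" where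
  "lift_upto g 0 w = g w"
| "lift_upto g (Suc n) w = (if w \<in> R then g w
     else child_bij (parent_of w) (lift_upto g n (parent_of w)) (cell w) w)"

lemma lift_upto_stable:
  assumes "w \<in> V" "depth (cell w) \<le> n"
  shows "lift_upto g (Suc n) w = lift_upto g n w"
  using assms
proof (induction n arbitrary: w)
  case 0
  have "w \<in> R"
  proof (rule ccontr)
    assume "w \<notin> R"
    then obtain u where "(u, w) \<in> T" using T_exists 0 by blast
    then show False using T_depth 0 by fastforce
  qed
  then show ?case by simp
next
  case (Suc n)
  show ?case
  proof (cases "w \<in> R")
    case False
    then obtain u where u: "(u, w) \<in> T" using T_exists Suc.prems by blast
    then have "lift_upto g (Suc n) u = lift_upto g n u"
      using Suc T_depth[OF u] T_V by auto
    then show ?thesis using False parent_of[OF u] by simp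
  qed simp
qed

text \<open>Only tree arcs are concerned, so \<open>g\<close> may be any permutation of the head
  vertices. In particular, the transposition of two of them can be lifted, whether or not it
  respects the head.\<close>

lemma lift_exists:
  assumes g: "g permutes R"
  shows "\<exists>f. f permutes V \<and> (\<forall>w\<in>V. cell (f w) = cell w) \<and> (\<forall>v\<in>R. f v = g v) \<and>
    (\<forall>u\<in>V. \<forall>w\<in>V. (f u, f w) \<in> T \<longleftrightarrow> (u, w) \<in> T)"
proof -
  define N where "N = Max (depth ` A)"
  have "finite A" using finite_elements[OF finite_V partition] .
  then have N: "depth (cell w) \<le> N" if "w \<in> V" for w
    using that cell_in(1) by (auto simp: N_def)
  define f where "f w = (if w \<in> V then lift_upto g N w else w)" for w
  have f_R: "f v = g v" if "v \<in> R" for v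
    using that R_sub by (cases N) (auto simp: f_def)
  \<comment> \<open>\<open>N\<close> bounds all depths, so one more round changes nothing and the
    recursion becomes an equation for \<open>f\<close>.\<close>
  have f_T: "f w = child_bij u (f u) (cell w) w" if "(u, w) \<in> T" for u w
  proof -
    have "w \<in> V" "u \<in> V" "w \<notin> R" using that T_V T_not_R by auto
    moreover from this have "lift_upto g N w = lift_upto g (Suc N) w"
      by (intro lift_upto_stable[symmetric] N)
    ultimately show ?thesis using parent_of[OF that] by (simp add: f_def)
  qed
  have step: "f w \<in> children (f u) (cell w)" if uw: "(u, w) \<in> T" and "f u \<in> V" "cell (f u) = cell u" for u w
  proof -
    have "bij_betw (child_bij u (f u) (cell w)) (children u (cell w)) (children (f u) (cell w))"
      using that T_V[OF uw] cell_in by (intro child_bij) auto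
    moreover have "w \<in> children u (cell w)" using uw T_V[OF uw] cell_in by (auto simp: children_def)
    ultimately show ?thesis using f_T[OF uw] by (metis bij_betwE)
  qed
  have f_cell: "f w \<in> V \<and> cell (f w) = cell w" if "w \<in> V" for w
    using that
  proof (induction rule: depth_induct)
    case (root v)
    have "g v \<in> R" using g root by (simp add: permutes_in_image)
    then show ?case using f_R[OF root] cell_R root R_sub by auto
  next
    case (child u w)
    then have "f w \<in> cell w" using step by (simp add: children_def)
    moreover have "cell w \<in> A" using child(1) T_V cell_in by auto
    ultimately show ?case using cell cell_sub by blast
  qed
  have f_T': "(f u, f w) \<in> T" if "(u, w) \<in> T" for u w
    using step[OF that] f_cell T_V[OF that] by (auto simp: children_def)
  \<comment> \<open>Vertices with the same image have parents with the same image, which coincide by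
    induction. So they are siblings in one cell, and a bijection separates them.\<close>
  have f_inj: "w = w'" if "w \<in> V" "w' \<in> V" "f w = f w'" for w w'
    using that
  proof (induction arbitrary: w' rule: depth_induct)
    case (root v)
    have "cell w' = cell v" using f_cell[of v] f_cell[of w'] root R_sub by auto
    then have "w' \<in> R" using R_iff cell_R root by auto
    then show ?case using root f_R g by (metis injD permutes_inj)
  next
    case (child u w)
    have wV: "w \<in> V" "u \<in> V" using T_V child(1) by auto
    have cw: "cell w' = cell w" using f_cell[OF wV(1)] f_cell[OF child(3)] child(4) by simp
    have "w' \<notin> R" using cw cell_R R_iff[OF wV(1)] T_not_R[OF child(1)] by auto
    then obtain u' where u': "(u', w') \<in> T" using T_exists child(3) by blast
    have "f u = f u'" using T_unique f_T'[OF child(1)] f_T'[OF u'] child(4) by simp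
    then have "u = u'" using child.IH[of u'] T_V[OF u'] by blast
    have "bij_betw (child_bij u (f u) (cell w)) (children u (cell w)) (children (f u) (cell w))"
      using f_cell wV cell_in by (intro child_bij) auto
    moreover have "w \<in> children u (cell w)" "w' \<in> children u (cell w)"
      using child(1,3) u' \<open>u = u'\<close> cw cell_in wV by (auto simp: children_def)
    moreover have "child_bij u (f u) (cell w) w = child_bij u (f u) (cell w) w'"
      using f_T[OF child(1)] f_T[OF u'] child(4) \<open>u = u'\<close> cw by simp
    ultimately show ?case by (metis bij_betw_def inj_onD)
  qed
  have inj: "inj_on f V" using f_inj by (auto simp: inj_on_def)
  have "f ` V \<subseteq> V" using f_cell by blast
  with inj have "bij_betw f V V" using endo_inj_surj[OF finite_V _ inj] by (simp add: bij_betw_def)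
  then have "f permutes V" by (rule bij_imp_permutes) (simp add: f_def)
  moreover have "(u, w) \<in> T" if uV: "u \<in> V" and wV: "w \<in> V" and fT: "(f u, f w) \<in> T" for u w
  proof -
    have "w \<notin> R" using T_not_R[OF fT] f_cell[OF wV] R_iff wV by auto
    then obtain u' where u': "(u', w) \<in> T" using T_exists wV by blast
    then have "f u' = f u" using f_T' T_unique fT by blast
    then show ?thesis using f_inj u' T_V uV by blast
  qed
  ultimately show ?thesis using f_cell f_R f_T' by blast
qed

text \<open>A lifted transposition of \<open>v\<close> and \<open>v'\<close> carries one leg onto
  the other. Conjugation with it turns automorphisms of the second leg into automorphisms of the
  first, so it takes fixing sets to fixing sets.\<close>

lemma leg_Fix_le:
  assumes v: "v \<in> R" and v': "v' \<in> R"
  shows "Fix_cells (induced J (leg_set v')) A \<le> Fix_cells (induced J (leg_set v)) A"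
proof -
  have vV: "v \<in> V" "v' \<in> V" using v v' R_sub by auto
  obtain f where f: "f permutes V" "\<forall>w\<in>V. cell (f w) = cell w" "\<forall>z\<in>R. f z = transpose v v' z"
    "\<forall>u\<in>V. \<forall>w\<in>V. (f u, f w) \<in> T \<longleftrightarrow> (u, w) \<in> T"
    using lift_exists[OF permutes_swap_id[OF v v']] by blast
  have fv: "f v = v'" "f v' = v" using f(3) v v' by auto
  have f_T: "(f u, f w) \<in> T" if "(u, w) \<in> T" for u w using f(4) that T_V by blast
  have leg: "f w \<in> leg_set v'" if "w \<in> leg_set v" for w using T_leg_map[of f w v] f_T that fv by auto
  have inj: "f u = f w \<longleftrightarrow> u = w" for u w using f(1) by (metis injD permutes_inj)
  have leg_iff: "f w \<in> leg_set v' \<longleftrightarrow> w \<in> leg_set v" for w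
  proof (cases "w \<in> V")
    case True
    then obtain z where z: "z \<in> R" "w \<in> leg_set z" using leg_set_cover by blast
    then have "f w \<in> leg_set (f z)" using T_leg_map f_T by blast
    moreover have "f z \<in> R" using f(2,1) z(1) R_sub cell_R R_iff by (metis permutes_in_image subsetD)
    ultimately show ?thesis
      using leg leg_set_disjoint[of "f z" v' "f w"] v' fv(1) inj z by metis
  next
    case False
    then show ?thesis using f(1) leg_set_sub vV by (metis permutes_not_in subsetD)
  qed
  \<comment> \<open>Inside a leg all arcs are tree arcs, so it does no harm that \<open>f\<close>
    may destroy arcs of the head.\<close>
  have f_arc: "(f u, f w) \<in> parcs J \<longleftrightarrow> (u, w) \<in> parcs J" if "u \<in> leg_set v" "w \<in> leg_set v" for u w
    using leg_arc_iff[OF v that] leg_arc_iff[OF v' leg leg, OF that] f(4) leg_set_sub[OF vV(1)] that by blast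
  have "bij f" using f(1) by (rule permutes_bij)
  then have f_inv: "f (inv f x) = x" "inv f (f x) = x" for x
    by (simp_all add: bij_is_surj surj_f_inv_f bij_is_inj)
  obtain S where S: "S \<subseteq> leg_set v" "card S = Fix_cells (induced J (leg_set v)) A" "is_fixing_set (\<Lambda> v) S"
    using Fix_cells_attained[of "induced J (leg_set v)" A] by (auto simp: \<Lambda>_def induced_def)
  have "is_fixing_set (\<Lambda> v') (f ` S)"
    unfolding is_fixing_set_def
  proof (intro ballI impI)
    fix \<psi> assume \<psi>: "\<psi> \<in> \<Lambda> v'" and fixed: "\<forall>x\<in>f ` S. \<psi> x = x"
    have p: "\<psi> permutes leg_set v'" and c: "\<And>w. w \<in> leg_set v' \<Longrightarrow> cell (\<psi> w) = cell w"
      and a: "\<And>u w. \<lbrakk>u \<in> leg_set v'; w \<in> leg_set v'\<rbrakk> \<Longrightarrow> (\<psi> u, \<psi> w) \<in> parcs J \<longleftrightarrow> (u, w) \<in> parcs J"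
      using \<psi> unfolding \<Lambda>_iff[OF vV(2)] by auto
    let ?\<phi> = "\<lambda>x. inv f (\<psi> (f x))"
    have \<phi>_in: "?\<phi> w \<in> leg_set v" if "w \<in> leg_set v" for w
      using leg_iff[of "?\<phi> w"] leg[OF that] p by (simp add: f_inv permutes_in_image)
    have "?\<phi> \<in> \<Lambda> v" unfolding \<Lambda>_iff[OF vV(1)]
    proof (intro conjI ballI)
      show "?\<phi> permutes leg_set v"
      proof (rule permutes_if_id_outside)
        have "bij (inv f \<circ> \<psi> \<circ> f)" using \<open>bij f\<close> permutes_bij[OF p] by (intro bij_comp bij_imp_bij_inv)
        then show "bij ?\<phi>" by (simp add: comp_def)
        show "?\<phi> x = x" if "x \<notin> leg_set v" for x
          using that leg_iff p f_inv by (metis permutes_not_in)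
      qed
      show "cell (?\<phi> w) = cell w" if "w \<in> leg_set v" for w
      proof -
        have "cell (f (?\<phi> w)) = cell (?\<phi> w)" "cell (f w) = cell w"
          using f(2) \<phi>_in[OF that] that leg_set_sub[OF vV(1)] by auto
        then show ?thesis using c[OF leg[OF that]] by (simp add: f_inv)
      qed
      show "(?\<phi> u, ?\<phi> w) \<in> parcs J \<longleftrightarrow> (u, w) \<in> parcs J" if uw: "u \<in> leg_set v" "w \<in> leg_set v" for u w
        using f_arc[OF \<phi>_in[OF uw(1)] \<phi>_in[OF uw(2)]] f_arc[OF uw] a[OF leg[OF uw(1)] leg[OF uw(2)]]
        by (simp add: f_inv)
    qed
    moreover have "?\<phi> x = x" if "x \<in> S" for x using fixed that by (simp add: f_inv)
    ultimately have "?\<phi> = id" using S(3) by (auto simp: is_fixing_set_def)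
    then have "inv f (\<psi> (f x)) = x" for x by (metis id_apply)
    then have "\<psi> y = y" for y using f_inv by metis
    then show "\<psi> = id" by auto
  qed
  then have "Fix_cells (induced J (leg_set v')) A \<le> card (f ` S)"
    using S(1) leg by (intro Fix_cells_le) (auto simp: \<Lambda>_def induced_def)
  also have "\<dots> = card S" using inj by (intro card_image) (auto simp: inj_on_def)
  finally show ?thesis using S(2) by simp
qed

lemma leg_Fix_eq:
  "\<lbrakk>v \<in> R; v' \<in> R\<rbrakk> \<Longrightarrow> Fix_cells (induced J (leg_set v)) A = Fix_cells (induced J (leg_set v')) A"
  using leg_Fix_le by (simp add: le_antisym)

lemma eq_id_if_legs_fixed:
  assumes f: "f \<in> \<Gamma>" and "\<And>v w. \<lbrakk>v \<in> R; w \<in> leg_set v\<rbrakk> \<Longrightarrow> f w = w"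
  shows "f = id"
proof
  fix x
  show "f x = id x"
    using assms leg_set_cover[of x] by (cases "x \<in> V") (auto simp: \<Gamma>_iff permutes_not_in)
qed

lemma head_automorphism_lifts:
  assumes g: "g \<in> automorphisms (induced J R)"
  obtains f where "f \<in> \<Gamma>" "\<And>v. v \<in> R \<Longrightarrow> f v = g v"
proof -
  have gp: "g permutes R" and ga: "\<And>u w. \<lbrakk>u \<in> R; w \<in> R\<rbrakk> \<Longrightarrow> (g u, g w) \<in> parcs J \<longleftrightarrow> (u, w) \<in> parcs J"
    using g by (auto simp: automorphisms_def induced_def permutes_in_image)
  obtain f where f: "f permutes V" "\<forall>w\<in>V. cell (f w) = cell w" "\<forall>v\<in>R. f v = g v"
    "\<forall>u\<in>V. \<forall>w\<in>V. (f u, f w) \<in> T \<longleftrightarrow> (u, w) \<in> T"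
    using lift_exists[OF gp] by blast
  have fR: "f w \<in> R \<longleftrightarrow> w \<in> R" if "w \<in> V" for w
    using f(1,2) that R_iff by (metis permutes_in_image)
  have "(f u, f w) \<in> parcs J \<longleftrightarrow> (u, w) \<in> parcs J" if uw: "u \<in> V" "w \<in> V" for u w
  proof -
    have "(f u, f w) \<in> parcs J \<inter> R \<times> R \<longleftrightarrow> (u, w) \<in> parcs J \<inter> R \<times> R"
      using fR uw f(3) ga by auto
    then show ?thesis using arc_iff[of u w] arc_iff[of "f u" "f w"] f(4) uw by blast
  qed
  then have "f \<in> \<Gamma>" using f by (simp add: \<Gamma>_iff)
  then show thesis using that f(3) by blast
qed

text \<open>An element of \<open>\<Gamma>\<close> that fixes a head vertex fixes its whole leg. Thus
  a fixing set of the head also works for \<open>J\<close>, and in a fixing set of \<open>J\<close>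
  each vertex may be replaced by the root of its leg.\<close>

lemma Fix_cells_rigid_legs:
  assumes v: "v \<in> R" and zero: "Fix_cells (induced J (leg_set v)) A = 0"
  shows "Fix_cells J A = Fix (induced J R)"
proof -
  have trivial: "\<psi> = id" if v': "v' \<in> R" and \<psi>: "\<psi> \<in> \<Lambda> v'" for v' \<psi>
  proof -
    have v'V: "v' \<in> V" using v' R_sub by blast
    obtain S where S: "S \<subseteq> leg_set v'" "card S = 0" "is_fixing_set (\<Lambda> v') S"
      using Fix_cells_attained[of "induced J (leg_set v')" A] leg_Fix_eq[OF v' v] zero
      by (auto simp: \<Lambda>_def induced_def)
    have "finite S" using S(1) finite_leg[OF v'V] by (rule finite_subset)
    then have "S = {}" using S(2) by simp
    then show ?thesis using S(3) \<psi> by (simp add: is_fixing_set_def)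
  qed
  have fix_leg: "f w = w" if "f \<in> \<Gamma>" "v' \<in> R" "f v' = v'" "w \<in> leg_set v'" for f v' w
    using fun_cong[OF trivial[OF that(2) \<Gamma>_restrict_leg[OF that(1-3)]], of w] that(4) by simp
  show ?thesis
  proof (rule antisym)
    obtain S where S: "S \<subseteq> R" "card S = Fix (induced J R)" "is_fixing_set (automorphisms (induced J R)) S"
      using Fix_attained[of "induced J R"] by (auto simp: induced_def)
    have "is_fixing_set \<Gamma> S"
      unfolding is_fixing_set_def
    proof (intro ballI impI)
      fix f assume f: "f \<in> \<Gamma>" and "\<forall>x\<in>S. f x = x"
      then have "(\<lambda>x. if x \<in> R then f x else x) = id"
        using S(3) \<Gamma>_restrict_R[OF f] unfolding is_fixing_set_def by auto
      then have "f v' = v'" if "v' \<in> R" for v' using that fun_cong[of _ id v'] by fastforce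
      then show "f = id" using eq_id_if_legs_fixed[OF f] fix_leg[OF f] by blast
    qed
    then show "Fix_cells J A \<le> Fix (induced J R)"
      using Fix_cells_le[of S J A] S R_sub by (auto simp: \<Gamma>_def)
  next
    obtain S where S: "S \<subseteq> V" "card S = Fix_cells J A" "is_fixing_set \<Gamma> S"
      using Fix_cells_attained[of J A] by (auto simp: \<Gamma>_def)
    \<comment> \<open>The root of the leg containing \<open>w\<close>. Several vertices may share
      it, so the image of \<open>S\<close> has at most \<open>card S\<close> elements.\<close>
    define r where "r w = (SOME z. z \<in> R \<and> w \<in> leg_set z)" for w
    have r: "r w \<in> R" "w \<in> leg_set (r w)" if "w \<in> V" for w
      using someI_ex[of "\<lambda>z. z \<in> R \<and> w \<in> leg_set z"] leg_set_cover[OF that] unfolding r_def by blast+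
    have "is_fixing_set (automorphisms (induced J R)) (r ` S)"
      unfolding is_fixing_set_def
    proof (intro ballI impI)
      fix g assume g: "g \<in> automorphisms (induced J R)" and fixed: "\<forall>x\<in>r ` S. g x = x"
      obtain f where f: "f \<in> \<Gamma>" "\<And>v. v \<in> R \<Longrightarrow> f v = g v" by (rule head_automorphism_lifts[OF g]) blast
      have "f w = w" if "w \<in> S" for w
        using fix_leg[OF f(1), of "r w" w] r[of w] that S(1) f(2) fixed by auto
      then have "f = id" using S(3) f(1) by (auto simp: is_fixing_set_def)
      then have "g v = v" if "v \<in> R" for v using f(2)[OF that] by simp
      moreover have "g permutes R" using g by (simp add: automorphisms_def induced_def)
      ultimately show "g = id" by (metis eq_id_iff permutes_not_in)
    qed
    then have "Fix (induced J R) \<le> card (r ` S)"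
      using r S(1) by (intro Fix_le) (auto simp: induced_def)
    also have "\<dots> \<le> card S" using S(1) finite_V by (intro card_image_le finite_subset[of S V])
    finally show "Fix (induced J R) \<le> Fix_cells J A" using S(2) by simp
  qed
qed

text \<open>For the lower bound, automorphisms of a leg extend by the identity, so a fixing set of
  \<open>J\<close> contains one of each leg. The legs are disjoint and, by
  \<open>leg_Fix_eq\<close>, equally expensive.\<close>

lemma Fix_cells_nonrigid_legs:
  assumes v: "v \<in> R" and pos: "Fix_cells (induced J (leg_set v)) A \<noteq> 0"
  shows "Fix_cells J A = card R * Fix_cells (induced J (leg_set v)) A"
proof -
  let ?k = "Fix_cells (induced J (leg_set v)) A"
  have vV: "v' \<in> V" if "v' \<in> R" for v' using that R_sub by blast
  have disj: "leg_set v1 \<inter> leg_set v2 = {}" if "v1 \<in> R" "v2 \<in> R" "v1 \<noteq> v2" for v1 v2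
    using leg_set_disjoint that by blast
  show ?thesis
  proof (rule antisym)
    have "\<forall>v'\<in>R. \<exists>S. S \<subseteq> leg_set v' \<and> card S = ?k \<and> is_fixing_set (\<Lambda> v') S"
    proof
      fix v' assume "v' \<in> R"
      then show "\<exists>S. S \<subseteq> leg_set v' \<and> card S = ?k \<and> is_fixing_set (\<Lambda> v') S"
        using Fix_cells_attained[of "induced J (leg_set v')" A] leg_Fix_eq[OF _ v]
        by (auto simp: \<Lambda>_def induced_def)
    qed
    then obtain S where S: "\<And>v'. v' \<in> R \<Longrightarrow> S v' \<subseteq> leg_set v'" "\<And>v'. v' \<in> R \<Longrightarrow> card (S v') = ?k"
      "\<And>v'. v' \<in> R \<Longrightarrow> is_fixing_set (\<Lambda> v') (S v')" by metis
    have "is_fixing_set \<Gamma> (\<Union>v'\<in>R. S v')"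
      unfolding is_fixing_set_def
    proof (intro ballI impI)
      fix f assume f: "f \<in> \<Gamma>" and fixed: "\<forall>x\<in>\<Union>v'\<in>R. S v'. f x = x"
      have "f w = w" if v': "v' \<in> R" and w: "w \<in> leg_set v'" for v' w
      proof -
        \<comment> \<open>Here \<open>pos\<close> enters: a fixed vertex keeps its leg, hence the
          root of the leg, in place. This is why the head costs nothing extra.\<close>
        have "S v' \<noteq> {}" using S(2)[OF v'] pos by force
        then obtain x where x: "x \<in> S v'" by blast
        then have fx: "f x = x" "x \<in> leg_set v'" using fixed v' S(1) by auto
        have "f x \<in> leg_set (f v')" using T_leg_map \<Gamma>_T[OF f] fx(2) by blast
        then have fv': "f v' = v'" using leg_set_disjoint[OF \<Gamma>_R[OF f v'] v'] fx by simp
        have "(\<lambda>x. if x \<in> leg_set v' then f x else x) = id"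
          using S(3)[OF v'] \<Gamma>_restrict_leg[OF f v' fv'] fixed v' unfolding is_fixing_set_def by auto
        then show ?thesis using w fun_cong[of _ id w] by fastforce
      qed
      then show "f = id" by (rule eq_id_if_legs_fixed[OF f])
    qed
    moreover have "(\<Union>v'\<in>R. S v') \<subseteq> V" using S(1) leg_set_sub vV by blast
    ultimately have "Fix_cells J A \<le> card (\<Union>v'\<in>R. S v')"
      unfolding \<Gamma>_def by (intro Fix_cells_le)
    also have "\<dots> = (\<Sum>v'\<in>R. card (S v'))"
    proof (rule card_UN_disjoint[OF finite_R])
      show "\<forall>v'\<in>R. finite (S v')" using S(1) finite_leg vV finite_subset by blast
      show "\<forall>i\<in>R. \<forall>j\<in>R. i \<noteq> j \<longrightarrow> S i \<inter> S j = {}" using S(1) disj by blast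
    qed
    also have "\<dots> = card R * ?k" using S(2) by simp
    finally show "Fix_cells J A \<le> card R * ?k" .
  next
    obtain S where S: "S \<subseteq> V" "card S = Fix_cells J A" "is_fixing_set \<Gamma> S"
      using Fix_cells_attained[of J A] by (auto simp: \<Gamma>_def)
    have "?k \<le> card (S \<inter> leg_set v')" if v': "v' \<in> R" for v'
    proof -
      have "is_fixing_set (\<Lambda> v') (S \<inter> leg_set v')"
        unfolding is_fixing_set_def
      proof (intro ballI impI)
        fix \<psi> assume \<psi>: "\<psi> \<in> \<Lambda> v'" and fixed: "\<forall>x\<in>S \<inter> leg_set v'. \<psi> x = x"
        have "\<psi> permutes leg_set v'" using \<psi> \<Lambda>_iff[OF vV[OF v']] by blast
        then have "\<psi> x = x" if "x \<in> S" for x using fixed that permutes_not_in by fastforce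
        then show "\<psi> = id" using S(3) \<Lambda>_sub_\<Gamma>[OF v' \<psi>] by (auto simp: is_fixing_set_def)
      qed
      then have "Fix_cells (induced J (leg_set v')) A \<le> card (S \<inter> leg_set v')"
        by (intro Fix_cells_le) (auto simp: \<Lambda>_def induced_def)
      then show ?thesis using leg_Fix_eq[OF v v'] by simp
    qed
    then have "card R * ?k \<le> (\<Sum>v'\<in>R. card (S \<inter> leg_set v'))"
      using sum_mono[of R "\<lambda>_. ?k" "\<lambda>v'. card (S \<inter> leg_set v')"] by simp
    also have "\<dots> = card (\<Union>v'\<in>R. S \<inter> leg_set v')"
    proof (rule card_UN_disjoint[OF finite_R, symmetric])
      show "\<forall>v'\<in>R. finite (S \<inter> leg_set v')" using finite_leg vV by blast
      show "\<forall>i\<in>R. \<forall>j\<in>R. i \<noteq> j \<longrightarrow> S \<inter> leg_set i \<inter> (S \<inter> leg_set j) = {}" using disj by blast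
    qed
    also have "\<dots> \<le> card S" using finite_subset[OF S(1) finite_V] by (intro card_mono) auto
    finally show "card R * ?k \<le> Fix_cells J A" using S(2) by simp
  qed
qed

end

section \<open>The jellyfish graph of an anisotropic component\<close>

lemma star_orientation:
  assumes "finite X" "finite Y" "biregular X Y p q F" "0 < q" "0 < card Y"
    and "card X \<le> card Y" "p = 1 \<or> q = 1"
  shows "q = 1"
proof (cases "p = 1")
  case True
  have "card X * p = card Y * q" by (rule biregular_card_eq[OF assms(1-3)])
  then have "card Y * q \<le> card Y * 1" using True assms(6) by simp
  then have "q \<le> 1" using assms(5) by (simp only: mult_le_cancel1)
  then show ?thesis using assms(4) by simp
qed (use assms(7) in simp)

lemma star_forest_arc_iff:
  "((i, a), (j, b)) \<in> parcs (star_forest s t) \<longleftrightarrow>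
    i = j \<and> i < s \<and> (a = 0 \<and> b \<in> {1..t} \<or> b = 0 \<and> a \<in> {1..t})"
  by (auto simp: star_forest_def)

text \<open>\<open>e\<close> numbers the centres and \<open>b x\<close> the leaves at
  \<open>x\<close>. Surjectivity follows by counting, from
  \<open>card Y = card X * t\<close>.\<close>

lemma isomorphic_star_forest:
  assumes fin: "finite X" "finite Y" and disj: "X \<inter> Y = {}" and F: "biregular X Y t 1 F"
    and K: "pverts K = X \<union> Y" "parcs K = F \<union> F\<inverse>"
  shows "isomorphic K (star_forest (card X) t)"
proof -
  have F_sub: "F \<subseteq> X \<times> Y" using F by (simp add: biregular_def)
  define \<pi> where "\<pi> y = (THE x. (x, y) \<in> F)" for y
  have \<pi>: "(x, y) \<in> F \<longleftrightarrow> x = \<pi> y" if "y \<in> Y" for x y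
  proof -
    have "card (F\<inverse> `` {y}) = 1" using F that by (simp add: biregular_def)
    then obtain z where z: "F\<inverse> `` {y} = {z}" by (rule card_1_singletonE)
    have iff: "(x, y) \<in> F \<longleftrightarrow> x = z" for x using z by blast
    then show ?thesis by (simp add: \<pi>_def)
  qed
  have \<pi>_in: "\<pi> y \<in> X" if "y \<in> Y" for y using \<pi>[OF that, of "\<pi> y"] F_sub by blast
  obtain e where e: "bij_betw e X {..<card X}"
    using ex_bij_betw_finite_nat[OF fin(1)] by (auto simp: atLeast0LessThan)
  have "\<exists>b. bij_betw b (F `` {x}) {1..t}" if "x \<in> X" for x
  proof -
    have "card (F `` {x}) = card {1..t}" using F that by (simp add: biregular_def)
    moreover have "finite (F `` {x})" using F_sub fin(2) by (auto intro: finite_subset)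
    ultimately show ?thesis by (simp add: finite_same_card_bij)
  qed
  then obtain b where b: "\<And>x. x \<in> X \<Longrightarrow> bij_betw (b x) (F `` {x}) {1..t}" by metis
  define f where "f z = (if z \<in> X then (e z, 0) else (e (\<pi> z), b (\<pi> z) z))" for z
  have e_in: "e x < card X" if "x \<in> X" for x using bij_betwE[OF e] that by auto
  have e_inj: "e x = e x' \<longleftrightarrow> x = x'" if "x \<in> X" "x' \<in> X" for x x'
    using e that by (auto simp: bij_betw_def inj_on_def)
  have f_X: "f x = (e x, 0)" if "x \<in> X" for x using that by (simp add: f_def)
  have f_Y: "f y = (e (\<pi> y), b (\<pi> y) y)" if "y \<in> Y" for y using that disj by (auto simp: f_def)
  have b_in: "b (\<pi> y) y \<in> {1..t}" if "y \<in> Y" for y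
    using bij_betwE[OF b[OF \<pi>_in[OF that]]] \<pi>[OF that] by auto
  have inj: "inj_on f (X \<union> Y)"
  proof (rule inj_onI)
    fix z z' assume zz: "z \<in> X \<union> Y" "z' \<in> X \<union> Y" "f z = f z'"
    consider "z \<in> X" "z' \<in> X" | "z \<in> X" "z' \<in> Y" | "z \<in> Y" "z' \<in> X" | "z \<in> Y" "z' \<in> Y"
      using zz by blast
    then show "z = z'"
    proof cases
      case 1 then show ?thesis using zz(3) e_inj by (simp add: f_X)
    next
      case 2 then show ?thesis using zz(3) b_in[OF 2(2)] by (simp add: f_X f_Y)
    next
      case 3 then show ?thesis using zz(3) b_in[OF 3(1)] by (simp add: f_X f_Y)
    next
      case 4
      then have "\<pi> z = \<pi> z'" "b (\<pi> z) z = b (\<pi> z') z'" using zz(3) e_inj \<pi>_in by (auto simp: f_Y)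
      moreover have "inj_on (b (\<pi> z)) (F `` {\<pi> z})" using b[OF \<pi>_in[OF 4(1)]] by (simp add: bij_betw_def)
      moreover have "z \<in> F `` {\<pi> z}" "z' \<in> F `` {\<pi> z'}" using \<pi> 4 by auto
      ultimately show ?thesis by (simp add: inj_on_eq_iff)
    qed
  qed
  have "f ` (X \<union> Y) = {..<card X} \<times> {..t}"
  proof (rule card_subset_eq)
    show "f ` (X \<union> Y) \<subseteq> {..<card X} \<times> {..t}"
      using e_in \<pi>_in b_in by (auto simp: f_X f_Y)
    have "card (f ` (X \<union> Y)) = card X + card Y" using inj fin disj by (simp add: card_image card_Un_disjoint)
    also have "\<dots> = card X + card X * t" using biregular_card_eq[OF fin F] by simp
    finally show "card (f ` (X \<union> Y)) = card ({..<card X} \<times> {..t})" by simp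
  qed simp
  then have bij: "bij_betw f (pverts K) (pverts (star_forest (card X) t))"
    using inj K by (simp add: bij_betw_def star_forest_def)
  show ?thesis
  proof (rule isomorphic_if_bij[OF _ _ bij])
    show "parcs K \<subseteq> pverts K \<times> pverts K" using K F_sub by auto
    show "parcs (star_forest (card X) t) \<subseteq> pverts (star_forest (card X) t) \<times> pverts (star_forest (card X) t)"
      by (auto simp: star_forest_def)
    fix u w assume uw: "u \<in> pverts K" "w \<in> pverts K"
    consider "u \<in> X" "w \<in> X" | "u \<in> X" "w \<in> Y" | "u \<in> Y" "w \<in> X" | "u \<in> Y" "w \<in> Y"
      using uw K by blast
    then show "(u, w) \<in> parcs K \<longleftrightarrow> (f u, f w) \<in> parcs (star_forest (card X) t)"
    proof cases
      case 1
      then have "(u, w) \<notin> parcs K" using K F_sub disj by blast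
      then show ?thesis using 1 by (simp add: f_X star_forest_arc_iff)
    next
      case 2
      then have "(u, w) \<in> parcs K \<longleftrightarrow> u = \<pi> w" using K F_sub disj \<pi>[OF 2(2)] by blast
      then show ?thesis using 2 e_inj[OF 2(1) \<pi>_in[OF 2(2)]] e_in b_in[OF 2(2)]
        by (simp add: f_X f_Y star_forest_arc_iff)
    next
      case 3
      then have "(u, w) \<in> parcs K \<longleftrightarrow> w = \<pi> u" using K F_sub disj \<pi>[OF 3(1)] by blast
      then show ?thesis using 3 e_inj[OF \<pi>_in[OF 3(1)] 3(2)] e_in[OF \<pi>_in[OF 3(1)]] b_in[OF 3(1)]
        by (auto simp: f_X f_Y star_forest_arc_iff)
    next
      case 4
      then have "(u, w) \<notin> parcs K" using K F_sub disj by blast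
      then show ?thesis using 4 b_in[OF 4(1)] b_in[OF 4(2)] by (auto simp: f_Y star_forest_arc_iff)
    qed
  qed
qed

text \<open>A vertex of degree one is all that is used of the isomorphism tested in (M3): in a
  biregular graph it makes one of the two degrees equal to one.\<close>

lemma star_forest_leaf:
  assumes iso: "isomorphic K (star_forest s t)" and st: "1 \<le> s" "1 \<le> t"
  obtains z where "z \<in> pverts K" "card {w \<in> pverts K. (z, w) \<in> parcs K} = 1"
proof -
  obtain f where bij: "bij_betw f (pverts K) (pverts (star_forest s t))"
    and arc: "\<And>u v. \<lbrakk>u \<in> pverts K; v \<in> pverts K\<rbrakk> \<Longrightarrow> (u, v) \<in> parcs K \<longleftrightarrow> (f u, f v) \<in> parcs (star_forest s t)"
    by (rule isomorphic_imp_bij[OF iso]) blast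
  have "(0, 1) \<in> f ` pverts K" "(0, 0) \<in> f ` pverts K"
    using bij st by (auto simp: bij_betw_def star_forest_def)
  then obtain z c where z: "z \<in> pverts K" "f z = (0, 1)" and c: "c \<in> pverts K" "f c = (0, 0)"
    by (metis imageE)
  have "(z, w) \<in> parcs K \<longleftrightarrow> w = c" if w: "w \<in> pverts K" for w
  proof -
    have "(z, w) \<in> parcs K \<longleftrightarrow> (f z, f w) \<in> parcs (star_forest s t)" using arc z(1) w by blast
    also have "\<dots> \<longleftrightarrow> f w = (0, 0)" using st z(2) by (cases "f w") (auto simp: star_forest_arc_iff)
    also have "\<dots> \<longleftrightarrow> w = c" using bij w c by (metis bij_betw_def inj_onD)
    finally show ?thesis .
  qed
  then have "{w \<in> pverts K. (z, w) \<in> parcs K} = {c}" using c(1) by blast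
  then show ?thesis using that z(1) by simp
qed

section \<open>Walks as arc lists and as vertex lists\<close>

lemma pawalk_verts_nonempty: "pawalk_verts u p \<noteq> []"
  by (cases p) auto

lemma pawalk_verts_snoc:
  "pcas u (p @ [(X, Y)]) v \<Longrightarrow>
    pawalk_verts u (p @ [(X, Y)]) = pawalk_verts u p @ [Y] \<and> last (pawalk_verts u p) = X"
  by (induction p arbitrary: u) (auto simp: pawalk_verts_nonempty)

lemma hd_pawalk_verts: "pcas u p v \<Longrightarrow> hd (pawalk_verts u p) = u"
  by (cases p) auto

lemma successively_pawalk_verts:
  "\<lbrakk>pcas u p v; set p \<subseteq> r\<rbrakk> \<Longrightarrow> successively (\<lambda>x y. (x, y) \<in> r) (pawalk_verts u p)"
proof (induction p arbitrary: u)
  case (Cons e p)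
  then have "successively (\<lambda>x y. (x, y) \<in> r) (pawalk_verts (snd e) p)" "hd (pawalk_verts (snd e) p) = snd e"
    using hd_pawalk_verts[of "snd e" p v] by auto
  then show ?case using Cons.prems by (cases e) (auto simp: successively_Cons)
qed simp

lemma pawalk_of_list:
  "\<lbrakk>zs \<noteq> []; successively (\<lambda>x y. (x, y) \<in> r) zs\<rbrakk> \<Longrightarrow>
    pcas (hd zs) (zip zs (tl zs)) (last zs) \<and> set (zip zs (tl zs)) \<subseteq> r \<and> pawalk_verts (hd zs) (zip zs (tl zs)) = zs"
proof (induction zs)
  case (Cons z zs)
  then show ?case by (cases zs) auto
qed simp

lemma zip_tl_snoc2: "zip (zs @ [X, Y]) (tl (zs @ [X, Y])) = zip (zs @ [X]) (tl (zs @ [X])) @ [(X, Y)]"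
proof (induction zs)
  case (Cons z zs)
  then show ?case by (cases zs) auto
qed simp

text \<open>Cells outside \<open>A\<close> contain no vertex of \<open>F\<close> and thus impose no
  condition.\<close>

lemma cell_automorphisms_cong:
  assumes "pverts F \<subseteq> \<Union>A" "A \<subseteq> P" "disjoint P"
  shows "cell_automorphisms F P = cell_automorphisms F A"
proof -
  have "pverts F \<inter> C = {}" if "C \<in> P - A" for C
    using assms that by (fastforce simp: disjoint_def)
  then have "(\<forall>C\<in>P. \<forall>v\<in>pverts F \<inter> C. f v \<in> C) \<longleftrightarrow> (\<forall>C\<in>A. \<forall>v\<in>pverts F \<inter> C. f v \<in> C)" for f
    using assms(2) by blast
  then show ?thesis by (simp add: cell_automorphisms_def)
qed

text \<open>A nonempty root cell thereby excludes the graph without vertices, and rigidity becomes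
  available.\<close>

lemma stable_partition_empty: "pverts G = {} \<Longrightarrow> \<Union>(stable_partition G) = {}"
proof -
  assume "pverts G = {}"
  then have "\<Union>(refinement G i) = {}" for i
    by (cases i) (auto simp: refinement_def refine_eq_quotient quotient_def)
  then show ?thesis by (simp add: stable_partition_def)
qed

locale amenable_component =
  fixes G :: "'a pair_pre_digraph" and A :: "'a set set" and R :: "'a set"
  assumes graph: "pair_graph G" and amenable: "amenable G"
    and component: "A \<in> anisotropic_components G" and root: "is_root G A R"
    and R_ne: "R \<noteq> {}"
begin

abbreviation "An \<equiv> anisotropic_graph G"

lemma component_sub: "A \<subseteq> stable_partition G"
proof
  fix X assume "X \<in> A"
  then have "reachable (with_proj An) X X"
    using component by (auto simp: anisotropic_components_def pre_digraph.sccs_verts_def)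
  then show "X \<in> stable_partition G"
    unfolding reachable_def by (auto dest: in_rtrancl_on_in_F simp: anisotropic_graph_def)
qed

lemma root_in: "R \<in> A"
  using root by (simp add: is_root_def)

lemma verts_ne: "pverts G \<noteq> {}"
  using stable_partition_empty[of G] component_sub root_in R_ne by blast

sublocale rigid_partition "pverts G" "parcs G" "stable_partition G"
  by (rule amenable_rigid_partition[OF graph amenable verts_ne])

lemma empty_between_iff: "empty_graph (bipartite_between G X Y) \<longleftrightarrow> parcs G \<inter> X \<times> Y = {}"
  using E_sym by (auto simp: empty_graph_def bipartite_between_def)

lemma complete_between_iff: "complete_between G X Y \<longleftrightarrow> X \<times> Y \<subseteq> parcs G"
proof -
  have "X \<times> Y \<subseteq> parcs G \<longleftrightarrow> Y \<times> X \<subseteq> parcs G" using E_sym by auto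
  then show ?thesis by (auto simp: complete_between_def bipartite_between_def)
qed

lemma aniso_iff_arc: "aniso X Y \<longleftrightarrow> (X, Y) \<in> parcs An"
  by (auto simp: aniso_def anisotropic_graph_def isotropic_def empty_between_iff complete_between_iff)

lemma hetero_iff: "X \<in> stable_partition G \<Longrightarrow> hetero X \<longleftrightarrow> heterogeneous G X"
proof -
  assume X: "X \<in> stable_partition G"
  have "empty_graph (induced G X) \<longleftrightarrow> parcs G \<inter> X \<times> X = {}"
    by (simp add: empty_graph_def induced_def)
  moreover have "complete_graph (induced G X) \<longleftrightarrow> (\<forall>x\<in>X. \<forall>y\<in>X. x \<noteq> y \<longrightarrow> (x, y) \<in> parcs G)"
    using irrefl_E by (auto simp: complete_graph_def induced_def irrefl_def)
  ultimately show ?thesis using X by (auto simp: hetero_def homogeneous_def)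
qed

text \<open>The components are defined as maximal sets of mutually reachable cells; as anisotropy is
  symmetric, they are closed under anisotropic neighbours.\<close>

sublocale rooted_component "pverts G" "parcs G" "stable_partition G" A R
proof
  show "A \<subseteq> stable_partition G" "R \<in> A" by (rule component_sub, rule root_in)
  have scc: "reachable (with_proj An) X Y" if "X \<in> A" "Y \<in> A" for X Y
    using component that by (auto simp: anisotropic_components_def pre_digraph.sccs_verts_def)
  show "Y \<in> A" if X: "X \<in> A" and XY: "aniso X Y" for X Y
  proof (rule ccontr)
    assume "Y \<notin> A"
    then have "\<not> reachable (with_proj An) X Y \<or> \<not> reachable (with_proj An) Y X"
      using component X by (auto simp: anisotropic_components_def pre_digraph.sccs_verts_def)
    moreover have "reachable (with_proj An) C D" if "aniso C D" for C D
    proof -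
      have "C \<in> pverts An" "D \<in> pverts An" using that by (auto simp: aniso_def anisotropic_graph_def)
      then show ?thesis
        using that unfolding reachable_def with_proj_simps aniso_iff_arc
        by (meson rtrancl_on_into_rtrancl_on rtrancl_on_refl)
    qed
    ultimately show False using XY aniso_sym by blast
  qed
  show "aniso\<^sup>*\<^sup>* R X" if "X \<in> A" for X
    using scc[OF root_in that] unfolding reachable_def with_proj_simps
    by (induction rule: rtrancl_on_induct) (auto simp: aniso_iff_arc intro: rtranclp.rtrancl_into_rtrancl)
  show "hetero R" if "X \<in> A" "hetero X" for X
    using root that hetero_iff component_sub root_in by (auto simp: is_root_def split: if_splits)
  show "card R \<le> card X" if "\<And>X. X \<in> A \<Longrightarrow> \<not> hetero X" "X \<in> A" for X
    using root that hetero_iff component_sub by (auto simp: is_root_def split: if_splits)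
qed

lemma parent_cell_iff: "parent_cell G R X Y \<longleftrightarrow> parent X Y"
proof
  assume "parent_cell G R X Y"
  then obtain p where "pre_digraph.apath (with_proj An) R (p @ [(X, Y)]) Y" by (auto simp: parent_cell_def)
  then have p: "set (p @ [(X, Y)]) \<subseteq> parcs An" "pcas R (p @ [(X, Y)]) Y"
    "distinct (pawalk_verts R (p @ [(X, Y)]))"
    by (auto simp: pre_digraph.apath_def pre_digraph.awalk_def awalk_verts_with_proj_eq cas_with_proj_eq)
  let ?zs = "pawalk_verts R (p @ [(X, Y)])"
  have "?zs = pawalk_verts R p @ [Y]" "last (pawalk_verts R p) = X"
    using pawalk_verts_snoc[OF p(2)] by auto
  then have zs: "?zs = butlast (pawalk_verts R p) @ [X, Y]"
    using append_butlast_last_id[OF pawalk_verts_nonempty[of R p]]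
    by (metis append_Cons append_Nil append_assoc)
  have "root_path ?zs"
    unfolding root_path_def
    using hd_pawalk_verts[OF p(2)] pawalk_verts_nonempty p(3) successively_pawalk_verts[OF p(2,1)] by (simp add: aniso_iff_arc)
  then show "parent X Y" using zs by (auto simp: parent_def)
next
  assume "parent X Y"
  then obtain zs where "root_path (zs @ [X, Y])" by (auto simp: parent_def)
  then have zs: "hd (zs @ [X, Y]) = R" "distinct (zs @ [X, Y])" "successively (\<lambda>x y. (x, y) \<in> parcs An) (zs @ [X, Y])"
    by (auto simp: root_path_def aniso_iff_arc)
  define p where "p = zip (zs @ [X]) (tl (zs @ [X]))"
  have zip: "zip (zs @ [X, Y]) (tl (zs @ [X, Y])) = p @ [(X, Y)]" unfolding p_def by (rule zip_tl_snoc2)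
  have "pcas R (p @ [(X, Y)]) Y" "set (p @ [(X, Y)]) \<subseteq> parcs An" "pawalk_verts R (p @ [(X, Y)]) = zs @ [X, Y]"
    using pawalk_of_list[OF _ zs(3)] unfolding zip zs(1) by auto
  moreover have "R \<in> pverts An" using root_in component_sub by (auto simp: anisotropic_graph_def)
  ultimately have "pre_digraph.apath (with_proj An) R (p @ [(X, Y)]) Y"
    using zs(2) by (simp add: pre_digraph.apath_def pre_digraph.awalk_def awalk_verts_with_proj_eq cas_with_proj_eq)
  then show "parent_cell G R X Y" by (auto simp: parent_cell_def)
qed

section \<open>The modified cells and blocks\<close>

abbreviation "F \<equiv> induced G (\<Union>A)"

definition "J = jellyfish F A R"

lemma modified_cell_head:
  assumes "X \<in> A"
  shows "parcs (modified_cell F R X) \<subseteq> X \<times> X"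
    and "(u, w) \<in> parcs (modified_cell F R X) \<Longrightarrow> (w, u) \<in> parcs (modified_cell F R X)"
    and "(u, u) \<notin> parcs (modified_cell F R X)"
  using E_sym irrefl_E
  by (auto simp: modified_cell_def Let_def induced_def graph_complement_def irrefl_def split: if_splits)

text \<open>Cells other than the root are homogeneous by \<open>hetero_imp_root\<close>, and (M2)
  empties the complete ones.\<close>

lemma modified_cell_nonroot:
  assumes X: "X \<in> A" "X \<noteq> R"
  shows "parcs (modified_cell F R X) = {}"
proof -
  have F_X: "induced F X = induced G X" using X by (auto simp: induced_def)
  have "homogeneous G X" using hetero_imp_root hetero_iff X component_sub by blast
  then have "empty_graph (induced G X) \<or> complete_graph (induced G X)" by (simp add: homogeneous_def)
  then show ?thesis
    using X(2) by (auto simp: modified_cell_def F_X Let_def complete_graph_def empty_graph_def graph_complement_def)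
qed

lemma modified_pair_eq:
  assumes "X \<in> A" "Y \<in> A"
  shows "modified_pair F X Y = modified_pair G X Y"
proof -
  have "bipartite_between F X Y = bipartite_between G X Y"
    "bipartite_complement F X Y = bipartite_complement G X Y"
    using assms by (auto simp: bipartite_between_def bipartite_complement_def induced_def)
  then show ?thesis
    unfolding modified_pair_def isotropic_def complete_between_def by (simp only:)
qed

lemma modified_pair_commute: "modified_pair G X Y = modified_pair G Y X"
proof -
  have "bipartite_between G X Y = bipartite_between G Y X"
    "bipartite_complement G X Y = bipartite_complement G Y X"
    "X \<union> Y = Y \<union> X" "X \<times> Y \<union> Y \<times> X = Y \<times> X \<union> X \<times> Y"
    by (auto simp: bipartite_between_def bipartite_complement_def)
  then show ?thesis
    unfolding modified_pair_def isotropic_def complete_between_def by (simp only:)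
qed

lemma modified_pair_arcs:
  shows "parcs (modified_pair G X Y) \<subseteq> X \<times> Y \<union> Y \<times> X"
    and "(u, w) \<in> parcs (modified_pair G X Y) \<Longrightarrow> (w, u) \<in> parcs (modified_pair G X Y)"
  using E_sym
  by (auto simp: modified_pair_def bipartite_between_def bipartite_complement_def split: if_splits)

lemma modified_pair_isotropic:
  assumes "X \<in> A" "Y \<in> A" "X \<noteq> Y" "\<not> aniso X Y"
  shows "parcs (modified_pair G X Y) = {}"
proof -
  have "isotropic G X Y"
    using assms component_sub by (auto simp: aniso_iff_arc anisotropic_graph_def)
  then show ?thesis
    by (auto simp: modified_pair_def isotropic_def empty_graph_def)
qed

text \<open>If the test of (M3) succeeds, the complement has a vertex of degree one and, as
  \<open>X\<close> is not larger, its stars are centred in \<open>X\<close>. If it fails, the star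
  forest given by \<open>aniso_star\<close> cannot be the complement, so it is the block. When both
  are star forests, the complement is taken and the claim holds for it.\<close>

lemma modified_pair_star:
  assumes an: "aniso X Y" and le: "card X \<le> card Y"
  shows "\<exists>t. biregular X Y t 1 (parcs (modified_pair G X Y) \<inter> X \<times> Y)"
proof -
  have XP: "X \<in> stable_partition G" and YP: "Y \<in> stable_partition G" and XY: "X \<noteq> Y"
    using an by (auto simp: aniso_def)
  note fin = cell_finite[OF XP] cell_finite[OF YP]
  have disj: "X \<inter> Y = {}" using cell_disjoint XP YP XY by blast
  have not_iso: "\<not> isotropic G X Y" using an by (auto simp: aniso_iff_arc anisotropic_graph_def)
  let ?C = "bipartite_complement G X Y"
  have C: "pverts ?C = X \<union> Y" "parcs ?C = (X \<times> Y - parcs G) \<union> (X \<times> Y - parcs G)\<inverse>"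
    using E_sym by (auto simp: bipartite_complement_def)
  have C_X: "parcs ?C \<inter> X \<times> Y = X \<times> Y - parcs G" using disj by (auto simp: bipartite_complement_def)
  have B_X: "parcs (bipartite_between G X Y) \<inter> X \<times> Y = parcs G \<inter> X \<times> Y"
    by (auto simp: bipartite_between_def)
  show ?thesis
  proof (cases "\<exists>s\<ge>1. \<exists>t\<ge>1. isomorphic ?C (star_forest s t)")
    case True
    obtain p q where un: "biregular_unique X Y p q (parcs G \<inter> X \<times> Y)"
      and pq: "0 < p" "p < card Y" "0 < q" "q < card X"
      by (rule aniso_biregular[OF an])
    have eq: "X \<times> Y - parcs G \<inter> X \<times> Y = X \<times> Y - parcs G" by blast
    have bi: "biregular X Y (card Y - p) (card X - q) (X \<times> Y - parcs G)"
      using biregular_complement[OF fin, of p q "parcs G \<inter> X \<times> Y"] un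
      by (simp add: biregular_unique_def eq)
    obtain z where z: "z \<in> pverts ?C" "card {w \<in> pverts ?C. (z, w) \<in> parcs ?C} = 1"
      using True star_forest_leaf by metis
    have "card Y - p = 1 \<or> card X - q = 1"
    proof (cases "z \<in> X")
      case True
      then have "{w \<in> pverts ?C. (z, w) \<in> parcs ?C} = (X \<times> Y - parcs G) `` {z}"
        using disj unfolding C by blast
      then show ?thesis using bi z(2) True by (simp add: biregular_def)
    next
      case False
      then have zY: "z \<in> Y" using z(1) C(1) by blast
      then have "{w \<in> pverts ?C. (z, w) \<in> parcs ?C} = (X \<times> Y - parcs G)\<inverse> `` {z}"
        using disj False unfolding C by blast
      then show ?thesis using bi z(2) zY by (simp add: biregular_def)
    qed
    then have "card X - q = 1" using star_orientation[OF fin bi _ _ le] pq by linarith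
    then have "biregular X Y (card Y - p) 1 (X \<times> Y - parcs G)" using bi by simp
    moreover have "modified_pair G X Y = ?C" using True not_iso by (simp add: modified_pair_def)
    ultimately show ?thesis using C_X by metis
  next
    case False
    obtain t S where S: "S = parcs G \<inter> X \<times> Y \<or> S = X \<times> Y - parcs G" "biregular X Y t 1 S" "1 \<le> t"
      "2 \<le> card X"
      by (rule aniso_star[OF an le])
    have "S \<noteq> X \<times> Y - parcs G"
    proof
      assume S_eq: "S = X \<times> Y - parcs G"
      have "isomorphic ?C (star_forest (card X) t)"
        by (rule isomorphic_star_forest[OF fin disj S(2)]) (use C S_eq in auto)
      then show False using False S(3,4) by auto
    qed
    then have "biregular X Y t 1 (parcs G \<inter> X \<times> Y)" using S by blast
    moreover have "modified_pair G X Y = bipartite_between G X Y"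
      unfolding modified_pair_def using False not_iso by (simp only: if_False)
    ultimately show ?thesis using B_X by metis
  qed
qed

lemma J_verts: "pverts J = \<Union>A"
  by (simp add: J_def jellyfish_def)

lemma J_arcs: "parcs J = (\<Union>X\<in>A. parcs (modified_cell F R X)) \<union>
    (\<Union>X\<in>A. \<Union>Y\<in>A - {X}. parcs (modified_pair G X Y))"
  using modified_pair_eq by (auto simp: J_def jellyfish_def)

lemma A_disjoint: "\<lbrakk>X \<in> A; Y \<in> A; u \<in> X; u \<in> Y\<rbrakk> \<Longrightarrow> X = Y"
  using cell_disjoint component_sub by blast

lemma J_arc_cases:
  assumes "(u, w) \<in> parcs J"
  obtains X where "X \<in> A" "(u, w) \<in> parcs (modified_cell F R X)"
  | X Y where "X \<in> A" "Y \<in> A" "X \<noteq> Y" "u \<in> X" "w \<in> Y" "(u, w) \<in> parcs (modified_pair G X Y)"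
proof -
  from assms consider (cell) X where "X \<in> A" "(u, w) \<in> parcs (modified_cell F R X)"
    | (pair) X Y where "X \<in> A" "Y \<in> A" "X \<noteq> Y" "(u, w) \<in> parcs (modified_pair G X Y)"
    unfolding J_arcs by blast
  then show thesis
  proof cases
    case cell
    then show thesis by (rule that(1))
  next
    case (pair X Y)
    then have "u \<in> X \<and> w \<in> Y \<or> u \<in> Y \<and> w \<in> X" using modified_pair_arcs(1) by blast
    then show thesis
    proof
      assume "u \<in> X \<and> w \<in> Y" then show thesis using that(2) pair by blast
    next
      assume "u \<in> Y \<and> w \<in> X" then show thesis using that(2)[of Y X] pair modified_pair_commute[of X Y] by simp
    qed
  qed
qed

lemma J_block:
  assumes XY: "X \<in> A" "Y \<in> A" "X \<noteq> Y" and uw: "u \<in> X" "w \<in> Y"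
  shows "(u, w) \<in> parcs J \<longleftrightarrow> (u, w) \<in> parcs (modified_pair G X Y)"
proof
  assume "(u, w) \<in> parcs J"
  then show "(u, w) \<in> parcs (modified_pair G X Y)"
  proof (cases rule: J_arc_cases)
    case (1 Z)
    then have "u \<in> Z" "w \<in> Z" using modified_cell_head(1) by auto
    then show ?thesis using A_disjoint XY uw 1(1) by blast
  next
    case (2 X' Y')
    then have "X' = X" "Y' = Y" using A_disjoint XY uw by auto
    then show ?thesis using 2 by simp
  qed
qed (use XY in \<open>auto simp: J_arcs\<close>)

text \<open>Arcs inside a cell survive only in the root. Arcs between cells survive only for
  anisotropic pairs, which are pairs of parent and child; sizes never decrease away from the root,
  so the stars are centred in the parent.\<close>

sublocale jelly: rooted_forest J A R parent depth
proof
  show "finite (pverts J)"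
    unfolding J_verts using component_sub cell_sub finite_V by (meson Union_least finite_subset subsetD)
  show "partition_on (pverts J) A"
  proof -
    have "{} \<notin> A" using component_sub cell_nonempty by blast
    then show ?thesis
      unfolding J_verts partition_on_def using A_disjoint by (auto simp: disjoint_def)
  qed
  show "R \<in> A" by (rule root_in)
  show "(w, u) \<in> parcs J" if "(u, w) \<in> parcs J" for u w
    using that
  proof (cases rule: J_arc_cases)
    case (1 X)
    then show ?thesis using modified_cell_head(2) by (auto simp: J_arcs)
  next
    case (2 X Y)
    then have "(w, u) \<in> parcs (modified_pair G X Y)" using modified_pair_arcs(2) by blast
    then show ?thesis using 2 by (auto simp: J_arcs)
  qed
  show "(u, u) \<notin> parcs J" for u
  proof
    assume "(u, u) \<in> parcs J"
    then show False
      by (cases rule: J_arc_cases) (use modified_cell_head(3) A_disjoint in blast)+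
  qed
  show "X = R \<and> Y = R \<or> parent X Y \<or> parent Y X"
    if uw: "(u, w) \<in> parcs J" "u \<in> X" "w \<in> Y" and XY: "X \<in> A" "Y \<in> A" for u w X Y
    using uw(1)
  proof (cases rule: J_arc_cases)
    case (1 Z)
    then have "u \<in> Z" "w \<in> Z" using modified_cell_head(1) by auto
    then have "X = Z" "Y = Z" using A_disjoint XY uw 1(1) by auto
    moreover have "Z = R" using 1 modified_cell_nonroot by blast
    ultimately show ?thesis by simp
  next
    case (2 X' Y')
    then have "X' = X" "Y' = Y" using A_disjoint XY uw by auto
    then have "aniso X Y" using 2 modified_pair_isotropic by blast
    then show ?thesis using aniso_parent XY by blast
  qed
  show "parcs J \<subseteq> pverts J \<times> pverts J"
  proof (rule subrelI)
    fix u w assume "(u, w) \<in> parcs J"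
    then show "(u, w) \<in> pverts J \<times> pverts J"
      unfolding J_verts by (cases rule: J_arc_cases) (use modified_cell_head(1) in blast)+
  qed
  show "X \<in> A" "Y \<in> A" "Y \<noteq> R" "depth Y = Suc (depth X)" if "parent X Y" for X Y
    using parentD[OF that] by auto
  show "X = X'" if "parent X Y" "parent X' Y" for X X' Y by (rule parent_unique[OF that])
  show "\<exists>X. parent X Y" if "Y \<in> A" "Y \<noteq> R" for Y by (rule parent_exists[OF that])
  have star: "\<exists>t. biregular X Y t 1 ({(u, w) \<in> parcs J. u \<in> X \<and> w \<in> Y})" if XY: "parent X Y" for X Y
  proof -
    have *: "X \<in> A" "Y \<in> A" "X \<noteq> Y" "aniso X Y" "card X \<le> card Y"
      using parentD[OF XY] by (auto simp: aniso_def)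
    have "{(u, w) \<in> parcs J. u \<in> X \<and> w \<in> Y} = parcs (modified_pair G X Y) \<inter> X \<times> Y"
      using J_block[OF *(1-3)] by auto
    then show ?thesis using modified_pair_star[OF *(4,5)] by simp
  qed
  show "\<exists>!u. u \<in> X \<and> (u, w) \<in> parcs J" if XY: "parent X Y" and w: "w \<in> Y" for X Y w
  proof -
    obtain t where "biregular X Y t 1 {(u, w) \<in> parcs J. u \<in> X \<and> w \<in> Y}" using star[OF XY] by blast
    then have "card ({(u, w) \<in> parcs J. u \<in> X \<and> w \<in> Y}\<inverse> `` {w}) = 1" using w by (simp add: biregular_def)
    moreover have "{(u, w) \<in> parcs J. u \<in> X \<and> w \<in> Y}\<inverse> `` {w} = {u. u \<in> X \<and> (u, w) \<in> parcs J}"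
      using w by auto
    ultimately show ?thesis by (metis (mono_tags, lifting) card_1_singletonE mem_Collect_eq singleton_iff)
  qed
  show "card {w \<in> Y. (u, w) \<in> parcs J} = card {w \<in> Y. (u', w) \<in> parcs J}"
    if XY: "parent X Y" and u: "u \<in> X" "u' \<in> X" for X Y u u'
  proof -
    obtain t where t: "biregular X Y t 1 {(u, w) \<in> parcs J. u \<in> X \<and> w \<in> Y}" using star[OF XY] by blast
    have "{(u, w) \<in> parcs J. u \<in> X \<and> w \<in> Y} `` {x} = {w \<in> Y. (x, w) \<in> parcs J}" if "x \<in> X" for x
      using that by auto
    then show ?thesis using t u by (simp add: biregular_def)
  qed
qed

lemma leg_eq: "leg G R J v = induced J (jelly.leg_set v)"
  by (simp add: leg_def jelly.leg_set_def parent_rel_def jelly.T_def parent_cell_iff)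

lemma Fix_cells_eq: "pverts K \<subseteq> \<Union>A \<Longrightarrow> Fix_cells K (stable_partition G) = Fix_cells K A"
  using cell_automorphisms_cong[OF _ component_sub] partition
  by (simp add: Fix_cells_def partition_on_def)

end

theorem theorem12:
  fixes G J H L :: "'a pair_pre_digraph" and A P :: "'a set set" and R :: "'a set" and v :: 'a
  assumes "pair_graph G"
    and "amenable G"
    and "A \<in> anisotropic_components G"
    and "is_root G A R"
    and "v \<in> R"
    and "P = stable_partition G"
    and "J = jellyfish (induced G (\<Union>A)) A R"
    and "H = induced J R"
    and "L = leg G R J v"
  shows "(Fix_cells L P = 0 \<longrightarrow> Fix_cells J P = Fix H) \<and>
         (Fix_cells L P \<noteq> 0 \<longrightarrow> Fix_cells J P = card (pverts H) * Fix_cells L P)"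
proof -
  \<comment> \<open>The root \<open>v\<close> of the leg witnesses that \<open>R\<close> is
    nonempty.\<close>
  interpret C: amenable_component G A R
    by (rule amenable_component.intro) (use assms(1-5) in auto)
  have J: "J = C.J" using assms(7) by (simp add: C.J_def)
  have L: "L = induced C.J (C.jelly.leg_set v)" using assms(9) C.leg_eq by (simp add: J)
  have v: "v \<in> pverts C.J" using assms(5) C.jelly.R_sub by blast
  have "Fix_cells J P = Fix_cells C.J A" using C.Fix_cells_eq[of C.J] assms(6) by (simp add: J C.J_verts)
  moreover have "Fix_cells L P = Fix_cells L A"
    using C.Fix_cells_eq[of L] C.jelly.leg_set_sub[OF v] assms(6) by (simp add: L induced_def C.J_verts)
  moreover have "H = induced C.J R" "pverts H = R" using assms(8) by (auto simp: J induced_def)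
  ultimately show ?thesis
    using C.jelly.Fix_cells_rigid_legs[OF assms(5)] C.jelly.Fix_cells_nonrigid_legs[OF assms(5)] L by simp
qed

end
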